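(* Let $(M^{4n-1}=G/H,g,\xi_i,\eta_i,\varphi_i)$ be a simply-connected homogeneous 3-Sasakian manifold. The space $\Sigma_{\mathrm{inv}}$ of $G$-invariant spinors forms an algebra under the wedge product, and is isomorphic to the algebra of invariant $\varphi_1$-anti-holomorphic differential forms: $$\Sigma_{\mathrm{inv}}\cong\Lambda^{0,\bullet}_{\mathrm{inv}}(T^*_{\mathbb C}M).$$ Furthermore, this algebra is generated by the forms $y_1:=\frac1{\sqrt2}(\xi_2+i\xi_3)$ and $\omega:=-\frac12(\Phi_2|_{\mathcal H}+i\Phi_3|_{\mathcal H})$, where $\Phi_i:=g(-,\varphi_i(-))$.
   Context: A Sasakian structure on $(M,g)$ is a unit Killing field $\xi$ such that, with $\eta=\xi^\flat$, $\varphi=-\nabla^g\xi$, one has $(\nabla^g_X\varphi)Y=g(X,Y)\xi-\eta(Y)X$. A 3-Sasakian structure consists of three Sasakian structures $(g,\xi_i,\eta_i,\varphi_i)$ with orthogonal Reeb fields and $[\xi_i,\xi_j]=2\xi_k$ for even permutations $(i,j,k)$ of $(1,2,3)$. Put $\mathcal V=\mathrm{span}_{\mathbb R}\{\xi_1,\xi_2,\xi_3\}$, $\mathcal H=\bigcap_i\ker\eta_i$, $\Phi_i(X,Y)=g(X,\varphi_i(Y))$; $\Phi_i|_{\mathcal H}$ is its horizontal part. Vectors and covectors are identified by $g$. Homogeneous 3-Sasakian: $M=G/H$ with $G$ acting transitively and preserving $g,\xi_i,\eta_i,\varphi_i$. By the known classification the simply-connected ones (dimension $4n-1$) are: $\mathrm{Sp}(n)/\mathrm{Sp}(n-1)$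 ($n\ge1$, round $S^{4n-1}$), $\mathrm{SU}(n+1)/\mathrm{S}(\mathrm U(n-1)\times\mathrm U(1))$ ($n\ge2$), $\mathrm{SO}(n+3)/(\mathrm{SO}(n-1)\times\mathrm{Sp}(1))$ ($n\ge4$), $\mathrm G_2/\mathrm{Sp}(1)$, $\mathrm F_4/\mathrm{Sp}(3)$, $\mathrm E_6/\mathrm{SU}(6)$, $\mathrm E_7/\mathrm{Spin}(12)$, $\mathrm E_8/\mathrm E_7$. The structure comes from a $\mathbb Z_2$-grading $\mathfrak g=\mathfrak g_0\oplus\mathfrak g_1$ with $\mathfrak g_0=\mathfrak{sp}(1)\oplus\mathfrak h$, $\mathfrak g_1^{\mathbb C}\cong\mathbb C^2\otimes U$ ($U$ an $\mathfrak h^{\mathbb C}$-module of dimension $2(n-1)$, $\mathbb C^2$ standard for $\mathfrak{sp}(1)^{\mathbb C}$), $T_oM\cong\mathfrak m=\mathfrak{sp}(1)\oplus\mathfrak g_1$ ($\mathcal V\leftrightarrow\mathfrak{sp}(1)$, $\mathcal H\leftrightarrow\mathfrak g_1$), with $\xi_i$ the basis of $\mathfrak{sp}(1)$ satisfying $[\xi_i,\xi_j]=2\xi_k$, $\varphi_i=\frac12\mathrm{ad}(\xi_i)$ on $\mathfrak{sp}(1)$ and $\mathrm{ad}(\xi_i)$ on $\mathfrak g_1$, and $g=-\frac1{4(n+1)}\kappa$ on $\mathfrak{sp}(1)$, $-\frac1{8(n+1)}\kappa$ on $\mathfrak g_1$ ($\kappa$ the Killing form, the two summands being orthogonal). Spin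 structure and spinors: isotropy takes values in $\{1\}\times\mathrm{Sp}(n-1)\subset\mathrm{SO}(4n-1)$, hence lifts to $\mathrm{Spin}(\mathfrak m)$ and defines a unique $G$-invariant spin structure, which is the one used; $\Sigma M=G\times_H\Sigma$. Invariant spinors are the vectors of $\Sigma$ fixed by the lifted isotropy action. The spin module $\Sigma$ is realized as follows: let $L'\subset\mathfrak m^{\mathbb C}$ be the $(-i)$-eigenspace of $\varphi_1$ on the complexification of $\xi_1^\perp$ and $L$ the $(+i)$-eigenspace. Then $\Sigma=\Lambda^\bullet L'$ with $x\in L$ acting by $i\sqrt2\,x\lrcorner$, $y\in L'$ by $i\sqrt2\,y\wedge$, and $\xi_1$ by $i$ on even and $-i$ on odd forms (so that $X\cdot Y+Y\cdot X=-2g(X,Y)$). $\varphi_1$-anti-holomorphic forms are sections of the exterior algebra of the $(-i)$-eigenbundle of $\varphi_1$ on the complexification of $(\mathbb R\xi_1)^\perp$ (with $T\cong T^*$ via $g$); $\Lambda^{0,\bullet}_{\mathrm{inv}}$ denotes the $G$-invariant ones, i.e. the $H$-invariants in $\Lambda^\bullet L'$. All algebras are complex and unital. *)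

theory Defs
  imports "HOL-Analysis.Analysis"
begin

section \<open>Matrix Lie groups and their Lie algebras\<close>

text \<open>
  Every compact Lie group is a matrix group, so the groups $G$ and $H$ below are sets of real
  square matrices of arbitrary size, and Lie algebra elements are matrices of the same size.
\<close>

definition mexp :: "real^'k^'k \<Rightarrow> real^'k^'k" where
  "mexp A = (\<Sum>j. (1 / fact j) *\<^sub>R (((**) A ^^ j) (mat 1)))"

definition lie_bracket :: "real^'k^'k \<Rightarrow> real^'k^'k \<Rightarrow> real^'k^'k" where
  "lie_bracket X Y = X ** Y - Y ** X"

definition matrix_group :: "(real^'k^'k) set \<Rightarrow> bool" where
  "matrix_group G \<longleftrightarrow> mat 1 \<in> G \<and> (\<forall>A\<in>G. invertible A \<and> matrix_inv A \<in> G) \<and>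
     (\<forall>A\<in>G. \<forall>B\<in>G. A ** B \<in> G)"

definition lie_algebra_of :: "(real^'k^'k) set \<Rightarrow> (real^'k^'k) set" where
  "lie_algebra_of G = {X. \<forall>t::real. mexp (t *\<^sub>R X) \<in> G}"

definition simple_lie_algebra :: "(real^'k^'k) set \<Rightarrow> bool" where
  "simple_lie_algebra \<gg> \<longleftrightarrow> (\<exists>X\<in>\<gg>. \<exists>Y\<in>\<gg>. lie_bracket X Y \<noteq> 0) \<and>
     (\<forall>I. subspace I \<and> I \<subseteq> \<gg> \<and> (\<forall>X\<in>\<gg>. \<forall>Y\<in>I. lie_bracket X Y \<in> I) \<longrightarrow> I = {0} \<or> I = \<gg>)"

definition Ad :: "real^'k^'k \<Rightarrow> real^'k^'k \<Rightarrow> real^'k^'k" where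
  "Ad h X = h ** X ** matrix_inv h"

definition trace_on :: "'a::real_vector set \<Rightarrow> ('a \<Rightarrow> 'a) \<Rightarrow> real" where
  "trace_on S f = (let B = (SOME B. independent B \<and> span B = S) in \<Sum>b\<in>B. representation B (f b) b)"

definition killing_form :: "(real^'k^'k) set \<Rightarrow> real^'k^'k \<Rightarrow> real^'k^'k \<Rightarrow> real" where
  "killing_form \<gg> X Y = trace_on \<gg> (\<lambda>Z. lie_bracket X (lie_bracket Y Z))"

definition direct_sum :: "'a::real_vector set \<Rightarrow> 'a set \<Rightarrow> 'a set \<Rightarrow> bool" where
  "direct_sum S A B \<longleftrightarrow> subspace A \<and> subspace B \<and> A \<inter> B = {0} \<and> S = {a + b | a b. a \<in> A \<and> b \<in> B}"

definition part :: "'a::real_vector set \<Rightarrow> 'a set \<Rightarrow> 'a \<Rightarrow> 'a" where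
  "part A B x = (THE a. a \<in> A \<and> x - a \<in> B)"
  \<comment> \<open>the component of \<open>x\<close> in \<open>A\<close> along the complement \<open>B\<close>\<close>

definition left_cosets :: "(real^'k^'k) set \<Rightarrow> (real^'k^'k) set \<Rightarrow> (real^'k^'k) set set" where
  "left_cosets G H = (\<lambda>g. (\<lambda>h. g ** h) ` H) ` G"

definition coset_topology :: "(real^'k^'k) set \<Rightarrow> (real^'k^'k) set \<Rightarrow> (real^'k^'k) set topology" where
  "coset_topology G H = topology (\<lambda>U. U \<subseteq> left_cosets G H \<and> openin (top_of_set G) (\<Union>U))"
  \<comment> \<open>the quotient topology of \<open>G/H\<close>\<close>

definition simply_connected_space :: "'a topology \<Rightarrow> bool" where
  "simply_connected_space X \<longleftrightarrow> path_connected_space X \<and>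
     (\<forall>f. continuous_map (top_of_set (sphere (0::complex) 1)) X f \<longrightarrow>
        (\<exists>c. homotopic_with (\<lambda>_. True) (top_of_set (sphere (0::complex) 1)) X f (\<lambda>_. c)))"


section \<open>Simply connected homogeneous 3-Sasakian manifolds\<close>

text \<open>
  The data of $M = G/H$: the groups, the Reeb vectors $\xi_1,\xi_2,\xi_3$ (the values of \<open>reeb\<close> at
  1, 2, 3), the odd part $\mathfrak g_1$ of the grading, and the number $n$ with
  $\dim M = 4n-1$. The Lie algebra of $G$ is
  $\mathfrak{sp}(1)\oplus\mathfrak h\oplus\mathfrak g_1$, where $\mathfrak{sp}(1)$ is spanned by
  the Reeb vectors, and $T_oM = \mathfrak m = \mathfrak{sp}(1)\oplus\mathfrak g_1$.
  Invariant tensor fields on $M$ are given by their values at the base point $o$.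
\<close>

record 'a homog_data =
  Grp :: "'a set"
  Iso :: "'a set"
  reeb :: "nat \<Rightarrow> 'a"
  odd_part :: "'a set"
  quat_dim :: nat

definition vertical :: "(real^'k^'k) homog_data \<Rightarrow> (real^'k^'k) set" where
  "vertical D = span {reeb D 1, reeb D 2, reeb D 3}"

definition tangent :: "(real^'k^'k) homog_data \<Rightarrow> (real^'k^'k) set" where
  "tangent D = {v + p | v p. v \<in> vertical D \<and> p \<in> odd_part D}"

definition ver :: "(real^'k^'k) homog_data \<Rightarrow> real^'k^'k \<Rightarrow> real^'k^'k" where
  "ver D = part (vertical D) (odd_part D)"

definition hor :: "(real^'k^'k) homog_data \<Rightarrow> real^'k^'k \<Rightarrow> real^'k^'k" where
  "hor D = part (odd_part D) (vertical D)"

definition metric :: "(real^'k^'k) homog_data \<Rightarrow> real^'k^'k \<Rightarrow> real^'k^'k \<Rightarrow> real" where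
  "metric D X Y =
     - killing_form (lie_algebra_of (Grp D)) (ver D X) (ver D Y) / (4 * (real (quat_dim D) + 1))
     - killing_form (lie_algebra_of (Grp D)) (hor D X) (hor D Y) / (8 * (real (quat_dim D) + 1))"

definition eta :: "(real^'k^'k) homog_data \<Rightarrow> nat \<Rightarrow> real^'k^'k \<Rightarrow> real" where
  "eta D i X = metric D (reeb D i) X"

definition phi :: "(real^'k^'k) homog_data \<Rightarrow> nat \<Rightarrow> real^'k^'k \<Rightarrow> real^'k^'k" where
  "phi D i X = (1/2) *\<^sub>R lie_bracket (reeb D i) (ver D X) + lie_bracket (reeb D i) (hor D X)"

definition Phi :: "(real^'k^'k) homog_data \<Rightarrow> nat \<Rightarrow> real^'k^'k \<Rightarrow> real^'k^'k \<Rightarrow> real" where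
  "Phi D i X Y = metric D X (phi D i Y)"

text \<open>
  Under $T_oM=\mathfrak m$ the covariant derivatives of invariant tensor fields are computed from a
  map $L:\mathfrak m\times\mathfrak m\to\mathfrak m$ (Nomizu), $\nabla_XY=L(X,Y)$ for invariant $Y$;
  the bracket of invariant vector fields is $[X,Y]_{\mathfrak m}$. The two conditions below
  (metric and torsion-free) determine the Levi-Civita connection.
\<close>

definition levi_civita ::
  "(real^'k^'k) homog_data \<Rightarrow> (real^'k^'k \<Rightarrow> real^'k^'k \<Rightarrow> real^'k^'k) \<Rightarrow> bool" where
  "levi_civita D L \<longleftrightarrow> (\<forall>X\<in>tangent D. \<forall>Y\<in>tangent D.
     L X Y \<in> tangent D \<and>
     L X Y - L Y X = part (tangent D) (lie_algebra_of (Iso D)) (lie_bracket X Y) \<and>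
     (\<forall>Z\<in>tangent D. metric D (L X Y) Z + metric D Y (L X Z) = 0))"

definition sasakian ::
  "(real^'k^'k) homog_data \<Rightarrow> (real^'k^'k \<Rightarrow> real^'k^'k \<Rightarrow> real^'k^'k) \<Rightarrow> nat \<Rightarrow> bool" where
  "sasakian D L i \<longleftrightarrow>
     metric D (reeb D i) (reeb D i) = 1 \<and>
     (\<forall>X\<in>tangent D. phi D i X = - L X (reeb D i)) \<and>
     (\<forall>X\<in>tangent D. \<forall>Y\<in>tangent D.
        metric D (L X (reeb D i)) Y + metric D X (L Y (reeb D i)) = 0 \<and>
        L X (phi D i Y) - phi D i (L X Y) = metric D X Y *\<^sub>R reeb D i - eta D i Y *\<^sub>R X)"

definition even_perms :: "(nat \<times> nat \<times> nat) set" where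
  "even_perms = {(1,2,3), (2,3,1), (3,1,2)}"

definition three_sasakian :: "(real^'k^'k) homog_data \<Rightarrow> bool" where
  "three_sasakian D \<longleftrightarrow>
     (\<forall>X\<in>tangent D. X \<noteq> 0 \<longrightarrow> metric D X X > 0) \<and>
     (\<exists>L. levi_civita D L \<and> (\<forall>i\<in>{1,2,3}. sasakian D L i)) \<and>
     (\<forall>(i,j,k)\<in>even_perms. metric D (reeb D i) (reeb D j) = 0 \<and>
        lie_bracket (reeb D i) (reeb D j) = 2 *\<^sub>R reeb D k)"

text \<open>
  The complexification of a real vector space is realised on pairs, $(a,b)$ standing for $a+ib$.
\<close>

definition cscale :: "complex \<Rightarrow> 'a::real_vector \<times> 'a \<Rightarrow> 'a \<times> 'a" where
  "cscale z v = (Re z *\<^sub>R fst v - Im z *\<^sub>R snd v, Re z *\<^sub>R snd v + Im z *\<^sub>R fst v)"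

text \<open>
  The standard representation of $\mathfrak{sp}(1)$ on $\mathbb C^2$, with indices in $\{0,1\}$:
  $\xi_1\mapsto\mathrm{diag}(i,-i)$, and $\xi_2$, $\xi_3$ act by the matrices with rows
  $(0,1),(-1,0)$ and $(0,i),(i,0)$.
\<close>

definition std_sp1 :: "nat \<Rightarrow> nat \<Rightarrow> nat \<Rightarrow> complex" where
  "std_sp1 j a b =
     (if j = 1 then (if a = b then (if a = 0 then \<i> else - \<i>) else 0)
      else if j = 2 then (if a = b then 0 else if a = 0 then 1 else - 1)
      else (if a = b then 0 else \<i>))"

definition C2_tensor :: "nat \<Rightarrow> (nat \<Rightarrow> nat \<Rightarrow> complex) set" where
  "C2_tensor N = {t. \<forall>a k. \<not> (a < 2 \<and> k < N) \<longrightarrow> t a k = 0}"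
  \<comment> \<open>$\mathbb C^2\otimes\mathbb C^N$\<close>

definition lie_rep :: "(real^'k^'k) set \<Rightarrow> nat \<Rightarrow> (real^'k^'k \<Rightarrow> nat \<Rightarrow> nat \<Rightarrow> complex) \<Rightarrow> bool" where
  "lie_rep \<hh> N \<rho> \<longleftrightarrow> (\<forall>X\<in>\<hh>. \<forall>Y\<in>\<hh>. \<forall>k<N. \<forall>l<N.
     (\<forall>a b::real. \<rho> (a *\<^sub>R X + b *\<^sub>R Y) k l = of_real a * \<rho> X k l + of_real b * \<rho> Y k l) \<and>
     \<rho> (lie_bracket X Y) k l = (\<Sum>j<N. \<rho> X k j * \<rho> Y j l - \<rho> Y k j * \<rho> X j l))"

text \<open>
  $\mathfrak g_1^{\mathbb C}\cong\mathbb C^2\otimes U$ as a module of $\mathfrak{sp}(1)\oplus\mathfrak h$,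
  with $U=\mathbb C^{2(n-1)}$ carrying a representation of $\mathfrak h$ (equivalently, of
  $\mathfrak h^{\mathbb C}$).
\<close>

definition odd_part_tensor :: "(real^'k^'k) homog_data \<Rightarrow> bool" where
  "odd_part_tensor D \<longleftrightarrow> (let N = 2 * (quat_dim D - 1); P = odd_part D \<times> odd_part D in
     \<exists>\<rho> \<Theta>. lie_rep (lie_algebra_of (Iso D)) N \<rho> \<and>
       bij_betw \<Theta> P (C2_tensor N) \<and>
       (\<forall>v\<in>P. \<forall>w\<in>P. \<forall>a k. \<Theta> (v + w) a k = \<Theta> v a k + \<Theta> w a k) \<and>
       (\<forall>v\<in>P. \<forall>z a k. \<Theta> (cscale z v) a k = z * \<Theta> v a k) \<and>
       (\<forall>j\<in>{1,2,3}. \<forall>v\<in>P. \<forall>a<2. \<forall>k<N.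
          \<Theta> (map_prod (lie_bracket (reeb D j)) (lie_bracket (reeb D j)) v) a k =
            (\<Sum>b<2. std_sp1 j a b * \<Theta> v b k)) \<and>
       (\<forall>X\<in>lie_algebra_of (Iso D). \<forall>v\<in>P. \<forall>a<2. \<forall>k<N.
          \<Theta> (map_prod (lie_bracket X) (lie_bracket X) v) a k = (\<Sum>l<N. \<rho> X k l * \<Theta> v a l)))"

definition sp1_grading :: "(real^'k^'k) homog_data \<Rightarrow> bool" where
  "sp1_grading D \<longleftrightarrow> (\<exists>\<gg>0.
     direct_sum (lie_algebra_of (Grp D)) \<gg>0 (odd_part D) \<and>
     (\<forall>X\<in>\<gg>0. \<forall>Y\<in>\<gg>0. lie_bracket X Y \<in> \<gg>0) \<and>
     (\<forall>X\<in>\<gg>0. \<forall>Y\<in>odd_part D. lie_bracket X Y \<in> odd_part D) \<and>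
     (\<forall>X\<in>odd_part D. \<forall>Y\<in>odd_part D. lie_bracket X Y \<in> \<gg>0) \<and>
     direct_sum \<gg>0 (vertical D) (lie_algebra_of (Iso D)) \<and>
     (\<forall>X\<in>lie_algebra_of (Iso D). \<forall>Y\<in>lie_algebra_of (Iso D). lie_bracket X Y \<in> lie_algebra_of (Iso D)) \<and>
     (\<forall>X\<in>vertical D. \<forall>Y\<in>lie_algebra_of (Iso D). lie_bracket X Y = 0)) \<and>
     odd_part_tensor D"

text \<open>
  The subgroup $\{1\}\times\mathrm{Sp}(n-1)$ of $\mathrm{SO}(\mathfrak m)$: the linear isometries of
  $\mathfrak m$ preserving all $\xi_i$ and $\varphi_i$ (and hence $\eta_i$).
\<close>

definition Sp_hor :: "(real^'k^'k) homog_data \<Rightarrow> (real^'k^'k \<Rightarrow> real^'k^'k) set" where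
  "Sp_hor D = {A \<in> tangent D \<rightarrow>\<^sub>E tangent D.
     (\<forall>X\<in>tangent D. \<forall>Y\<in>tangent D. \<forall>a b::real. A (a *\<^sub>R X + b *\<^sub>R Y) = a *\<^sub>R A X + b *\<^sub>R A Y) \<and>
     (\<forall>X\<in>tangent D. \<forall>Y\<in>tangent D. metric D (A X) (A Y) = metric D X Y) \<and>
     (\<forall>i\<in>{1,2,3}. A (reeb D i) = reeb D i \<and> (\<forall>X\<in>tangent D. A (phi D i X) = phi D i (A X)))}"

definition isotropy :: "(real^'k^'k) homog_data \<Rightarrow> real^'k^'k \<Rightarrow> real^'k^'k \<Rightarrow> real^'k^'k" where
  "isotropy D h = restrict (Ad h) (tangent D)"

text \<open>
  The 3-Sasakian condition on the invariant structure together with its description through a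
  $\mathbb Z_2$-grading of a simple Lie algebra; by the known classification this covers exactly the
  simply connected homogeneous 3-Sasakian manifolds. The condition on \<open>isotropy\<close> says that $G$
  preserves the structure of $G/H$.
\<close>

definition sc_homogeneous_3_sasakian :: "(real^'k^'k) homog_data \<Rightarrow> bool" where
  "sc_homogeneous_3_sasakian D \<longleftrightarrow>
     quat_dim D \<ge> 1 \<and>
     matrix_group (Grp D) \<and> compact (Grp D) \<and> connected (Grp D) \<and>
     matrix_group (Iso D) \<and> Iso D \<subseteq> Grp D \<and> closed (Iso D) \<and>
     simply_connected_space (coset_topology (Grp D) (Iso D)) \<and>
     simple_lie_algebra (lie_algebra_of (Grp D)) \<and>
     sp1_grading D \<and>
     (\<forall>h\<in>Iso D. isotropy D h \<in> Sp_hor D) \<and>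
     three_sasakian D"


section \<open>Complex exterior forms on the tangent space\<close>

text \<open>
  A complex form on $\mathfrak m$ is a function on lists of tangent vectors, the component of degree
  $k$ being its values on lists of length $k$; the forms below vanish on all lists that are not lists
  of tangent vectors.
\<close>

type_synonym 'a form = "'a list \<Rightarrow> complex"

definition fzero :: "'a form" where "fzero = (\<lambda>_. 0)"

definition fone :: "'a form" where "fone = (\<lambda>vs. if vs = [] then 1 else 0)"

definition fadd :: "'a form \<Rightarrow> 'a form \<Rightarrow> 'a form" where
  "fadd \<alpha> \<beta> = (\<lambda>vs. \<alpha> vs + \<beta> vs)"

definition fscale :: "complex \<Rightarrow> 'a form \<Rightarrow> 'a form" where
  "fscale z \<alpha> = (\<lambda>vs. z * \<alpha> vs)"

text \<open>
  Wedge product as a sum over shuffles: \<open>S\<close> is the set of positions of the arguments given to the first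
  factor, and the exponent counts the inversions of the shuffle. In degree one,
  $(\alpha\wedge\beta)(X,Y)=\alpha(X)\beta(Y)-\alpha(Y)\beta(X)$.
\<close>

definition wedge :: "'a form \<Rightarrow> 'a form \<Rightarrow> 'a form" where
  "wedge \<alpha> \<beta> = (\<lambda>vs. \<Sum>S\<in>Pow {..<length vs}.
     (- 1) ^ card {(i,j). i \<in> S \<and> j \<in> {..<length vs} - S \<and> j < i} *
     \<alpha> (nths vs S) * \<beta> (nths vs (- S)))"

definition contract :: "'a \<times> 'a \<Rightarrow> 'a form \<Rightarrow> 'a form" where
  "contract x \<alpha> = (\<lambda>vs. \<alpha> (fst x # vs) + \<i> * \<alpha> (snd x # vs))"

definition flat :: "(real^'k^'k) homog_data \<Rightarrow> (real^'k^'k) \<times> (real^'k^'k) \<Rightarrow> (real^'k^'k) form" where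
  "flat D y = (\<lambda>vs. case vs of
      [X] \<Rightarrow> (if X \<in> tangent D
             then of_real (metric D (fst y) X) + \<i> * of_real (metric D (snd y) X) else 0)
    | _ \<Rightarrow> 0)"
  \<comment> \<open>the covector identified with \<open>y\<close> by the complex bilinear extension of the metric\<close>

inductive_set wedge_generated :: "'a form set \<Rightarrow> 'a form set" for S where
  one: "fone \<in> wedge_generated S"
| gen: "\<alpha> \<in> S \<Longrightarrow> \<alpha> \<in> wedge_generated S"
| add: "\<alpha> \<in> wedge_generated S \<Longrightarrow> \<beta> \<in> wedge_generated S \<Longrightarrow> fadd \<alpha> \<beta> \<in> wedge_generated S"
| scale: "\<alpha> \<in> wedge_generated S \<Longrightarrow> fscale z \<alpha> \<in> wedge_generated S"
| wedge: "\<alpha> \<in> wedge_generated S \<Longrightarrow> \<beta> \<in> wedge_generated S \<Longrightarrow> wedge \<alpha> \<beta> \<in> wedge_generated S"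

definition wedge_algebra :: "'a form set \<Rightarrow> bool" where
  "wedge_algebra A \<longleftrightarrow> fzero \<in> A \<and> fone \<in> A \<and>
     (\<forall>\<alpha>\<in>A. \<forall>\<beta>\<in>A. fadd \<alpha> \<beta> \<in> A \<and> wedge \<alpha> \<beta> \<in> A) \<and> (\<forall>\<alpha>\<in>A. \<forall>z. fscale z \<alpha> \<in> A)"

definition wedge_iso :: "('a form \<Rightarrow> 'a form) \<Rightarrow> 'a form set \<Rightarrow> 'a form set \<Rightarrow> bool" where
  "wedge_iso F A B \<longleftrightarrow> bij_betw F A B \<and> F fone = fone \<and>
     (\<forall>\<alpha>\<in>A. \<forall>\<beta>\<in>A. F (fadd \<alpha> \<beta>) = fadd (F \<alpha>) (F \<beta>) \<and> F (wedge \<alpha> \<beta>) = wedge (F \<alpha>) (F \<beta>)) \<and>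
     (\<forall>\<alpha>\<in>A. \<forall>z. F (fscale z \<alpha>) = fscale z (F \<alpha>))"

definition perp1 :: "(real^'k^'k) homog_data \<Rightarrow> (real^'k^'k) set" where
  "perp1 D = {X \<in> tangent D. metric D (reeb D 1) X = 0}"

definition eigen1 :: "(real^'k^'k) homog_data \<Rightarrow> complex \<Rightarrow> ((real^'k^'k) \<times> (real^'k^'k)) set" where
  "eigen1 D c = {v \<in> perp1 D \<times> perp1 D. map_prod (phi D 1) (phi D 1) v = cscale c v}"

definition antihol_forms :: "(real^'k^'k) homog_data \<Rightarrow> (real^'k^'k) form set" where
  "antihol_forms D = wedge_generated (flat D ` eigen1 D (- \<i>))"
  \<comment> \<open>$\Lambda^\bullet L'$, also the underlying space of the spin module $\Sigma$\<close>

definition inv_antihol_forms :: "(real^'k^'k) homog_data \<Rightarrow> (real^'k^'k) form set" where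
  "inv_antihol_forms D = {\<alpha> \<in> antihol_forms D.
     \<forall>h\<in>Iso D. \<forall>vs. set vs \<subseteq> tangent D \<longrightarrow> \<alpha> (map (isotropy D h) vs) = \<alpha> vs}"


section \<open>The spin module and invariant spinors\<close>

text \<open>
  Clifford multiplication by $X\in\mathfrak m$: with $X'=X-\eta_1(X)\xi_1$, the components of $X$ in
  $L$ and $L'$ are $\frac12(X'-i\varphi_1X')$ and $\frac12(X'+i\varphi_1X')$.
\<close>

definition cliff :: "(real^'k^'k) homog_data \<Rightarrow> real^'k^'k \<Rightarrow> (real^'k^'k) form \<Rightarrow> (real^'k^'k) form" where
  "cliff D X \<alpha> =
     (let X' = X - eta D 1 X *\<^sub>R reeb D 1;
          x = ((1/2) *\<^sub>R X', - (1/2) *\<^sub>R phi D 1 X');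
          y = ((1/2) *\<^sub>R X', (1/2) *\<^sub>R phi D 1 X')
      in fadd (\<lambda>vs. of_real (eta D 1 X) * (if even (length vs) then \<i> else - \<i>) * \<alpha> vs)
           (fadd (fscale (\<i> * of_real (sqrt 2)) (contract x \<alpha>))
                 (fscale (\<i> * of_real (sqrt 2)) (wedge (flat D y) \<alpha>))))"

text \<open>
  Since $\dim\mathfrak m$ is odd, $\mathrm{Spin}(\mathfrak m)$ acts faithfully on $\Sigma$ and is
  identified with its image, the products of an even number of unit vectors. Operators matter only
  through their values on $\Sigma$.
\<close>

definition spin_operator :: "(real^'k^'k) homog_data \<Rightarrow> ((real^'k^'k) form \<Rightarrow> (real^'k^'k) form) \<Rightarrow> bool" where
  "spin_operator D T \<longleftrightarrow> (\<exists>us. even (length us) \<and>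
     (\<forall>u\<in>set us. u \<in> tangent D \<and> metric D u u = 1) \<and>
     (\<forall>\<psi>\<in>antihol_forms D. T \<psi> = foldr (cliff D) us \<psi>))"

text \<open>
  The lift of the inclusion of $\{1\}\times\mathrm{Sp}(n-1)$ into $\mathrm{SO}(\mathfrak m)$ to a
  continuous homomorphism into $\mathrm{Spin}(\mathfrak m)$; it exists and is unique because
  $\mathrm{Sp}(n-1)$ is simply connected. Continuity refers to the topologies of pointwise convergence.
\<close>

definition spin_lift ::
  "(real^'k^'k) homog_data \<Rightarrow>
   ((real^'k^'k \<Rightarrow> real^'k^'k) \<Rightarrow> (real^'k^'k) form \<Rightarrow> (real^'k^'k) form) \<Rightarrow> bool" where
  "spin_lift D \<tau> \<longleftrightarrow>
     (\<forall>A\<in>Sp_hor D. spin_operator D (\<tau> A) \<and>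
        (\<forall>X\<in>tangent D. \<forall>\<psi>\<in>antihol_forms D. \<tau> A (cliff D X \<psi>) = cliff D (A X) (\<tau> A \<psi>))) \<and>
     (\<forall>A\<in>Sp_hor D. \<forall>B\<in>Sp_hor D. \<forall>\<psi>\<in>antihol_forms D.
        \<tau> (compose (tangent D) A B) \<psi> = \<tau> A (\<tau> B \<psi>)) \<and>
     (\<forall>\<psi>\<in>antihol_forms D. continuous_on (Sp_hor D) (\<lambda>A. \<tau> A \<psi>))"

definition inv_spinors ::
  "(real^'k^'k) homog_data \<Rightarrow>
   ((real^'k^'k \<Rightarrow> real^'k^'k) \<Rightarrow> (real^'k^'k) form \<Rightarrow> (real^'k^'k) form) \<Rightarrow> (real^'k^'k) form set" where
  "inv_spinors D \<tau> = {\<psi> \<in> antihol_forms D. \<forall>h\<in>Iso D. \<tau> (isotropy D h) \<psi> = \<psi>}"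

definition y1_form :: "(real^'k^'k) homog_data \<Rightarrow> (real^'k^'k) form" where
  "y1_form D = flat D (cscale (of_real (1 / sqrt 2)) (reeb D 2, reeb D 3))"

definition omega_form :: "(real^'k^'k) homog_data \<Rightarrow> (real^'k^'k) form" where
  "omega_form D = (\<lambda>vs. case vs of
      [X, Y] \<Rightarrow> (if X \<in> tangent D \<and> Y \<in> tangent D
                then - (1/2) * (of_real (Phi D 2 (hor D X) (hor D Y)) +
                                \<i> * of_real (Phi D 3 (hor D X) (hor D Y))) else 0)
    | _ \<Rightarrow> 0)"

end

theory Submission
  imports Defs "HOL-Computational_Algebra.Fundamental_Theorem_Algebra"
begin

text \<open>
  An invariant spinor is an invariant form, and an invariant form is a polynomial in \<open>y\<^sub>1\<close> and \<open>\<omega>\<close>,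
  for two unrelated reasons.

  \<^bold>\<open>Forms.\<close> Splitting off the vertical direction (\<open>split_form\<close>) writes an antiholomorphic form as
  \<open>\<beta> + y\<^sub>1 \<and> \<gamma>\<close> with \<open>\<beta>\<close> and \<open>\<gamma>\<close> horizontal and again invariant, so the question is which horizontal
  forms of degree \<open>k\<close> are invariant. Let \<open>V\<close> be the odd part, \<open>d = dim V\<close>, and let \<open>R(x,y)\<close> be the action
  on \<open>V\<close> of the isotropy component of \<open>[x,y]\<close>. Torsion-freeness and the Sasakian equations determine the
  vertical component of \<open>[x,y]\<close>, so the Jacobi identity expresses the cyclic sum of \<open>R(x,y)z\<close> by the metric
  and the three complex structures alone. An invariant form is annihilated by every \<open>R(x,y)\<close>; contracting
  this with an orthonormal basis and alternating, only the cyclic sum enters, and what remains is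
  \<open>4 \<omega> \<and> \<Lambda>\<alpha> = k (d + 4 - 2k) \<alpha>\<close>, where \<open>\<Lambda>\<alpha>\<close>, the sum of the values of \<open>\<alpha>\<close>
  on pairs \<open>e, \<phi>\<^sub>2 e\<close>, is a multiple of the contraction with \<open>\<omega>\<close> (\<open>invariant_form_eq_wedge\<close>). The factor vanishes only in degree \<open>0\<close> and in a degree exceeding the number
  \<open>d/2\<close> of independent horizontal antiholomorphic covectors, so an invariant form of positive
  degree is \<open>\<omega>\<close> times an invariant form of degree two less, and induction on the degree finishes (\<open>horizontal_generated\<close>). The identity is the part
  of Kostant's formula for the Laplacian on Lie algebra cohomology that is needed here: the Casimir operator of
  the isotropy algebra, restricted to alternating tensors, is determined by the contact grading.

  \<^bold>\<open>Spinors.\<close> The lift \<open>\<tau> A\<close> of a structure-preserving isometry \<open>A\<close> and the natural action of \<open>A\<close> on forms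
  both intertwine Clifford multiplication along \<open>A\<close>. The form \<open>1\<close> is, up to a factor, the only one killed by all
  contractions, and Clifford multiplication generates everything from it; hence the two actions differ by a scalar
  (\<open>tau_pullback\<close>), which is multiplicative in \<open>A\<close>. Diagonalising \<open>A\<close> on quaternionic lines shows that \<open>A\<close> is a
  commutator of such isometries (\<open>qisom_commutator\<close>), so the scalar is \<open>1\<close> (\<open>lift_scalar_trivial\<close>), and being fixed by
  the lift is the same as being an invariant form.
\<close>

section \<open>Interior products and the wedge product\<close>

definition int_prod :: "'a \<Rightarrow> 'a form \<Rightarrow> 'a form" where
  "int_prod v \<alpha> = (\<lambda>vs. \<alpha> (v # vs))"

text \<open>
  The sign that turns the interior product into an antiderivation on forms of mixed degree.
\<close>
definition parity :: "'a form \<Rightarrow> 'a form" where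
  "parity \<alpha> = (\<lambda>vs. (- 1) ^ length vs * \<alpha> vs)"

lemma wedge_Nil [simp]: "wedge \<alpha> \<beta> [] = \<alpha> [] * \<beta> []"
  by (simp add: wedge_def)

lemma card_inversions_insert_0:
  fixes S :: "nat set"
  shows "card {(i,j). i \<in> insert 0 (Suc ` S) \<and> j \<in> {..<Suc n} - insert 0 (Suc ` S) \<and> j < i}
       = card {(i,j). i \<in> S \<and> j \<in> {..<n} - S \<and> j < i}"
proof -
  have "{(i,j). i \<in> insert 0 (Suc ` S) \<and> j \<in> {..<Suc n} - insert 0 (Suc ` S) \<and> j < i}
      = map_prod Suc Suc ` {(i,j). i \<in> S \<and> j \<in> {..<n} - S \<and> j < i}" (is "?A = ?f ` ?B")
  proof
    show "?A \<subseteq> ?f ` ?B"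
    proof
      fix p assume "p \<in> ?A"
      then obtain i j where p: "p = (i,j)" and i: "i \<in> insert 0 (Suc ` S)"
        and j: "j < Suc n" "j \<notin> insert 0 (Suc ` S)" "j < i" by auto
      from j(2) obtain j' where j': "j = Suc j'" by (cases j) auto
      from i j(3) obtain i' where i': "i = Suc i'" "i' \<in> S" by auto
      show "p \<in> ?f ` ?B" using p i' j' j by (auto intro!: image_eqI[of _ _ "(i',j')"])
    qed
  qed auto
  moreover have "inj_on (map_prod Suc Suc) X" for X by (auto simp: inj_on_def)
  ultimately show ?thesis by (simp only: card_image)
qed

lemma card_inversions_Suc:
  fixes S :: "nat set"
  assumes S: "S \<subseteq> {..<n}"
  shows "card {(i,j). i \<in> Suc ` S \<and> j \<in> {..<Suc n} - Suc ` S \<and> j < i}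
       = card S + card {(i,j). i \<in> S \<and> j \<in> {..<n} - S \<and> j < i}"
proof -
  let ?B = "{(i,j). i \<in> S \<and> j \<in> {..<n} - S \<and> j < i}"
  have fS: "finite S" using S finite_subset by blast
  have "?B \<subseteq> S \<times> {..<n}" by auto
  then have fB: "finite ?B" using fS finite_subset by blast
  have eq: "{(i,j). i \<in> Suc ` S \<and> j \<in> {..<Suc n} - Suc ` S \<and> j < i}
      = (\<lambda>i. (Suc i, 0)) ` S \<union> map_prod Suc Suc ` ?B" (is "?A = ?C")
  proof
    show "?A \<subseteq> ?C"
    proof
      fix p assume "p \<in> ?A"
      then obtain i j where p: "p = (Suc i,j)" and i: "i \<in> S"
        and j: "j < Suc n" "j \<notin> Suc ` S" "j < Suc i" by auto
      show "p \<in> ?C"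
      proof (cases j)
        case 0 then show ?thesis using p i by auto
      next
        case (Suc j')
        then have "(i,j') \<in> ?B" using i j by auto
        moreover have "p = map_prod Suc Suc (i,j')" using p Suc by simp
        ultimately show ?thesis by blast
      qed
    qed
  qed auto
  have "card ?C = card ((\<lambda>i. (Suc i, 0::nat)) ` S) + card (map_prod Suc Suc ` ?B)"
    using fS fB by (intro card_Un_disjoint) auto
  also have "card ((\<lambda>i. (Suc i, 0::nat)) ` S) = card S"
    by (intro card_image) (auto simp: inj_on_def)
  also have "card (map_prod Suc Suc ` ?B) = card ?B"
    by (intro card_image) (auto simp: inj_on_def)
  finally show ?thesis using eq by simp
qed

lemma Pow_lessThan_Suc:
  "Pow {..<Suc n} = (\<lambda>S. insert 0 (Suc ` S)) ` Pow {..<n} \<union> (\<lambda>S. Suc ` S) ` Pow {..<n}"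
proof -
  have "{..<Suc n} = insert 0 (Suc ` {..<n})" by (auto simp: image_iff less_Suc_eq_0_disj)
  then show ?thesis by (simp add: Pow_insert image_Pow_surj[symmetric, of Suc] image_image Un_commute
      flip: image_Pow_surj)
qed

text \<open>
  Sort the shuffles by the factor that receives the first argument: if it is the second factor, the argument is
  moved past all arguments of the first, which is the sign in \<open>parity\<close>. Read as a recursion, this reduces every
  further fact about wedge products to an induction on the argument list, with the forms generalised.
\<close>
lemma wedge_Cons:
  "wedge \<alpha> \<beta> (v # vs) = wedge (int_prod v \<alpha>) \<beta> vs + wedge (parity \<alpha>) (int_prod v \<beta>) vs"
proof -
  let ?n = "length vs"
  let ?t = "\<lambda>S. (- 1) ^ card {(i,j). i \<in> S \<and> j \<in> {..<Suc ?n} - S \<and> j < i} *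
     \<alpha> (nths (v # vs) S) * \<beta> (nths (v # vs) (- S))"
  have "wedge \<alpha> \<beta> (v # vs) = sum ?t (Pow {..<Suc ?n})" by (simp add: wedge_def)
  also have "\<dots> = sum ?t ((\<lambda>S. insert 0 (Suc ` S)) ` Pow {..<?n}) + sum ?t ((\<lambda>S. Suc ` S) ` Pow {..<?n})"
    unfolding Pow_lessThan_Suc by (intro sum.union_disjoint) auto
  also have "sum ?t ((\<lambda>S. insert 0 (Suc ` S)) ` Pow {..<?n}) = wedge (int_prod v \<alpha>) \<beta> vs"
  proof -
    have inj: "inj_on (\<lambda>S. insert 0 (Suc ` S)) (Pow {..<?n})"
    proof (rule inj_onI)
      fix A B assume "insert 0 (Suc ` A) = insert 0 (Suc ` B)"
      then have "Suc ` A = Suc ` B" by auto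
      then show "A = B" by (simp add: inj_image_eq_iff)
    qed
    have 1: "nths (v # vs) (insert 0 (Suc ` S)) = v # nths vs S" for S
      by (auto simp: nths_Cons intro!: arg_cong[where f="nths vs"])
    have 2: "nths (v # vs) (- insert 0 (Suc ` S)) = nths vs (- S)" for S
      by (auto simp: nths_Cons intro!: arg_cong[where f="nths vs"])
    show ?thesis unfolding sum.reindex[OF inj] wedge_def o_def card_inversions_insert_0 1 2 int_prod_def ..
  qed
  also have "sum ?t ((\<lambda>S. Suc ` S) ` Pow {..<?n}) = wedge (parity \<alpha>) (int_prod v \<beta>) vs"
  proof -
    have inj: "inj_on (\<lambda>S. Suc ` S) (Pow {..<?n})"
      by (rule inj_onI) (simp add: inj_image_eq_iff)
    have 1: "nths (v # vs) (Suc ` S) = nths vs S" for S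
      by (auto simp: nths_Cons intro!: arg_cong[where f="nths vs"])
    have 2: "nths (v # vs) (- (Suc ` S)) = v # nths vs (- S)" for S
      by (auto simp: nths_Cons intro!: arg_cong[where f="nths vs"])
    have 3: "length (nths vs S) = card S" if "S \<subseteq> {..<?n}" for S
    proof -
      have "{i. i < length vs \<and> i \<in> S} = S" using that by auto
      then show ?thesis by (simp add: length_nths)
    qed
    show ?thesis unfolding sum.reindex[OF inj] wedge_def o_def 1 2 int_prod_def parity_def
      by (intro sum.cong refl) (simp only: Pow_iff card_inversions_Suc 3 power_add mult_ac)
  qed
  finally show ?thesis .
qed

lemma int_prod_wedge: "int_prod v (wedge \<alpha> \<beta>) = fadd (wedge (int_prod v \<alpha>) \<beta>) (wedge (parity \<alpha>) (int_prod v \<beta>))"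
  by (rule ext) (simp add: int_prod_def[of v "wedge \<alpha> \<beta>"] fadd_def wedge_Cons)

lemma int_prod_fadd [simp]: "int_prod v (fadd \<alpha> \<beta>) = fadd (int_prod v \<alpha>) (int_prod v \<beta>)"
  and int_prod_fscale [simp]: "int_prod v (fscale z \<alpha>) = fscale z (int_prod v \<alpha>)"
  and int_prod_par: "int_prod v (parity \<alpha>) = fscale (- 1) (parity (int_prod v \<alpha>))"
  and parity_fadd [simp]: "parity (fadd \<alpha> \<beta>) = fadd (parity \<alpha>) (parity \<beta>)"
  and parity_fscale [simp]: "parity (fscale z \<alpha>) = fscale z (parity \<alpha>)"
  and parity_par [simp]: "parity (parity \<alpha>) = \<alpha>"
  by (auto simp: int_prod_def parity_def fadd_def fscale_def algebra_simps simp flip: power_mult_distrib)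

lemma wedge_fadd_left: "wedge (fadd \<alpha> \<beta>) \<gamma> = fadd (wedge \<alpha> \<gamma>) (wedge \<beta> \<gamma>)"
  and wedge_fadd_right: "wedge \<gamma> (fadd \<alpha> \<beta>) = fadd (wedge \<gamma> \<alpha>) (wedge \<gamma> \<beta>)"
  and wedge_fscale_left: "wedge (fscale z \<alpha>) \<gamma> = fscale z (wedge \<alpha> \<gamma>)"
  and wedge_fscale_right: "wedge \<gamma> (fscale z \<alpha>) = fscale z (wedge \<gamma> \<alpha>)"
  by (rule ext, simp add: wedge_def fadd_def fscale_def sum_distrib_left sum.distrib algebra_simps)+

lemma parity_wedge: "parity (wedge \<alpha> \<beta>) = wedge (parity \<alpha>) (parity \<beta>)"
proof (rule ext)
  fix vs show "parity (wedge \<alpha> \<beta>) vs = wedge (parity \<alpha>) (parity \<beta>) vs"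
  proof (induction vs arbitrary: \<alpha> \<beta>)
    case Nil then show ?case by (simp add: parity_def)
  next
    case (Cons v vs)
    have "parity (wedge \<alpha> \<beta>) (v # vs) = - parity (wedge (int_prod v \<alpha>) \<beta>) vs - parity (wedge (parity \<alpha>) (int_prod v \<beta>)) vs"
      by (simp add: parity_def[of "wedge _ _"] wedge_Cons algebra_simps)
    also have "\<dots> = - wedge (parity (int_prod v \<alpha>)) (parity \<beta>) vs - wedge (parity (parity \<alpha>)) (parity (int_prod v \<beta>)) vs"
      by (simp only: Cons)
    also have "\<dots> = wedge (parity \<alpha>) (parity \<beta>) (v # vs)"
      by (simp add: wedge_Cons int_prod_par wedge_fscale_left wedge_fscale_right) (simp add: fscale_def)
    finally show ?case .
  qed
qed

lemma wedge_assoc: "wedge (wedge \<alpha> \<beta>) \<gamma> = wedge \<alpha> (wedge \<beta> \<gamma>)"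
proof (rule ext)
  fix vs show "wedge (wedge \<alpha> \<beta>) \<gamma> vs = wedge \<alpha> (wedge \<beta> \<gamma>) vs"
  proof (induction vs arbitrary: \<alpha> \<beta> \<gamma>)
    case (Cons v vs)
    show ?case
      by (simp add: wedge_Cons int_prod_wedge parity_wedge wedge_fadd_left wedge_fadd_right)
         (simp add: fadd_def Cons)
  qed simp
qed

lemma wedge_fone_left [simp]: "wedge fone \<alpha> = \<alpha>"
proof (rule ext)
  have z: "wedge (\<lambda>_. 0) \<beta> = (\<lambda>_. 0)" for \<beta> :: "'a form" by (simp add: wedge_def)
  have i: "int_prod v fone = (\<lambda>_. 0)" for v :: 'a by (simp add: int_prod_def fone_def)
  have p: "parity fone = (fone :: 'a form)" by (rule ext) (simp add: parity_def fone_def)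
  fix vs show "wedge fone \<alpha> vs = \<alpha> vs"
  proof (induction vs arbitrary: \<alpha>)
    case Nil then show ?case by (simp add: fone_def)
  next
    case (Cons v vs)
    then show ?case by (simp add: wedge_Cons i z p) (simp add: int_prod_def)
  qed
qed

lemma wedge_fone_right [simp]: "wedge \<alpha> fone = \<alpha>"
proof (rule ext)
  have z: "wedge \<beta> (\<lambda>_. 0) = (\<lambda>_. 0)" for \<beta> :: "'a form" by (simp add: wedge_def)
  have i: "int_prod v fone = (\<lambda>_. 0)" for v :: 'a by (simp add: int_prod_def fone_def)
  fix vs show "wedge \<alpha> fone vs = \<alpha> vs"
  proof (induction vs arbitrary: \<alpha>)
    case Nil then show ?case by (simp add: fone_def)
  next
    case (Cons v vs)
    then show ?case by (simp add: wedge_Cons i z) (simp add: int_prod_def)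
  qed
qed

section \<open>Alternating forms of antiholomorphic type\<close>
text \<open>
  Linearity and type are imposed on the first argument only; the exchange of neighbours carries them to the others.
  The type condition makes the complex-linear extension vanish on the \<open>(-i)\<close>-eigenspace of \<open>J\<close>, and the covectors
  with this property are those dual to that same eigenspace, because the eigenspaces of a skew \<open>J\<close> are isotropic.
\<close>
definition antihol_on :: "'a::real_vector set \<Rightarrow> ('a \<Rightarrow> 'a) \<Rightarrow> 'a form \<Rightarrow> bool" where
  "antihol_on W J \<alpha> \<longleftrightarrow>
     (\<forall>us v w ws. set us \<subseteq> W \<longrightarrow> v \<in> W \<longrightarrow> w \<in> W \<longrightarrow> set ws \<subseteq> W \<longrightarrow>
        \<alpha> (us @ v # w # ws) = - \<alpha> (us @ w # v # ws)) \<and>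
     (\<forall>a b v w ws. v \<in> W \<longrightarrow> w \<in> W \<longrightarrow> set ws \<subseteq> W \<longrightarrow>
        \<alpha> ((a *\<^sub>R v + b *\<^sub>R w) # ws) = of_real a * \<alpha> (v # ws) + of_real b * \<alpha> (w # ws)) \<and>
     (\<forall>v ws. v \<in> W \<longrightarrow> set ws \<subseteq> W \<longrightarrow> \<alpha> (J v # ws) = \<i> * \<alpha> (v # ws))"

lemma antihol_on_swap:
  "antihol_on W J \<alpha> \<Longrightarrow> set us \<subseteq> W \<Longrightarrow> v \<in> W \<Longrightarrow> w \<in> W \<Longrightarrow> set ws \<subseteq> W \<Longrightarrow>
     \<alpha> (us @ v # w # ws) = - \<alpha> (us @ w # v # ws)"
  unfolding antihol_on_def by blast

lemma antihol_on_swap0: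
  "antihol_on W J \<alpha> \<Longrightarrow> v \<in> W \<Longrightarrow> w \<in> W \<Longrightarrow> set ws \<subseteq> W \<Longrightarrow> \<alpha> (v # w # ws) = - \<alpha> (w # v # ws)"
  using antihol_on_swap[of W J \<alpha> "[]" v w ws] by simp

lemma antihol_on_lin:
  "antihol_on W J \<alpha> \<Longrightarrow> v \<in> W \<Longrightarrow> w \<in> W \<Longrightarrow> set ws \<subseteq> W \<Longrightarrow>
     \<alpha> ((a *\<^sub>R v + b *\<^sub>R w) # ws) = of_real a * \<alpha> (v # ws) + of_real b * \<alpha> (w # ws)"
  unfolding antihol_on_def by blast

lemma antihol_on_type:
  "antihol_on W J \<alpha> \<Longrightarrow> v \<in> W \<Longrightarrow> set ws \<subseteq> W \<Longrightarrow> \<alpha> (J v # ws) = \<i> * \<alpha> (v # ws)"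
  unfolding antihol_on_def by blast

lemma antihol_onI:
  assumes "\<And>us v w ws. set us \<subseteq> W \<Longrightarrow> v \<in> W \<Longrightarrow> w \<in> W \<Longrightarrow> set ws \<subseteq> W \<Longrightarrow>
     \<alpha> (us @ v # w # ws) = - \<alpha> (us @ w # v # ws)"
    and "\<And>a b v w ws. v \<in> W \<Longrightarrow> w \<in> W \<Longrightarrow> set ws \<subseteq> W \<Longrightarrow>
     \<alpha> ((a *\<^sub>R v + b *\<^sub>R w) # ws) = of_real a * \<alpha> (v # ws) + of_real b * \<alpha> (w # ws)"
    and "\<And>v ws. v \<in> W \<Longrightarrow> set ws \<subseteq> W \<Longrightarrow> \<alpha> (J v # ws) = \<i> * \<alpha> (v # ws)"
  shows "antihol_on W J \<alpha>"
  unfolding antihol_on_def by (intro conjI allI impI; rule assms)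

lemma antihol_on_int_prod:
  assumes a: "antihol_on W J \<alpha>" and u: "u \<in> W" and W: "subspace W" and J: "\<And>v. v \<in> W \<Longrightarrow> J v \<in> W"
  shows "antihol_on W J (int_prod u \<alpha>)"
proof (rule antihol_onI)
  fix us v w ws assume "set us \<subseteq> W" "v \<in> W" "w \<in> W" "set ws \<subseteq> W"
  then show "int_prod u \<alpha> (us @ v # w # ws) = - int_prod u \<alpha> (us @ w # v # ws)"
    using antihol_on_swap[OF a, of "u # us" v w ws] u by (simp add: int_prod_def)
next
  fix r s :: real and v w ws assume h: "v \<in> W" "w \<in> W" "set ws \<subseteq> W"
  have "r *\<^sub>R v + s *\<^sub>R w \<in> W" using h W by (simp add: subspace_add subspace_scale)
  then have "\<alpha> (u # (r *\<^sub>R v + s *\<^sub>R w) # ws) = - \<alpha> ((r *\<^sub>R v + s *\<^sub>R w) # u # ws)"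
    using antihol_on_swap0[OF a u] h by simp
  also have "\<dots> = - (of_real r * \<alpha> (v # u # ws) + of_real s * \<alpha> (w # u # ws))"
    using antihol_on_lin[OF a h(1,2), of "u # ws"] u h by simp
  also have "\<dots> = of_real r * \<alpha> (u # v # ws) + of_real s * \<alpha> (u # w # ws)"
    using antihol_on_swap0[OF a u h(1) h(3)] antihol_on_swap0[OF a u h(2) h(3)] by simp
  finally show "int_prod u \<alpha> ((r *\<^sub>R v + s *\<^sub>R w) # ws) = of_real r * int_prod u \<alpha> (v # ws) + of_real s * int_prod u \<alpha> (w # ws)"
    by (simp add: int_prod_def)
next
  fix v ws assume h: "v \<in> W" "set ws \<subseteq> W"
  have "\<alpha> (u # J v # ws) = - \<alpha> (J v # u # ws)" using antihol_on_swap0[OF a u J[OF h(1)] h(2)] .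
  also have "\<dots> = - \<i> * \<alpha> (v # u # ws)" using antihol_on_type[OF a h(1), of "u # ws"] u h by simp
  also have "\<dots> = \<i> * \<alpha> (u # v # ws)" using antihol_on_swap0[OF a u h] by simp
  finally show "int_prod u \<alpha> (J v # ws) = \<i> * int_prod u \<alpha> (v # ws)" by (simp add: int_prod_def)
qed

lemma antihol_on_fadd:
  assumes "antihol_on W J \<alpha>" "antihol_on W J \<beta>"
  shows "antihol_on W J (fadd \<alpha> \<beta>)"
proof (rule antihol_onI)
  fix us v w ws assume h: "set us \<subseteq> W" "v \<in> W" "w \<in> W" "set ws \<subseteq> W"
  show "fadd \<alpha> \<beta> (us @ v # w # ws) = - fadd \<alpha> \<beta> (us @ w # v # ws)"
    using antihol_on_swap[OF assms(1) h] antihol_on_swap[OF assms(2) h] by (simp add: fadd_def)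
next
  fix a b :: real and v w ws assume h: "v \<in> W" "w \<in> W" "set ws \<subseteq> W"
  show "fadd \<alpha> \<beta> ((a *\<^sub>R v + b *\<^sub>R w) # ws) = of_real a * fadd \<alpha> \<beta> (v # ws) + of_real b * fadd \<alpha> \<beta> (w # ws)"
    using antihol_on_lin[OF assms(1) h] antihol_on_lin[OF assms(2) h] by (simp add: fadd_def algebra_simps)
next
  fix v ws assume h: "v \<in> W" "set ws \<subseteq> W"
  show "fadd \<alpha> \<beta> (J v # ws) = \<i> * fadd \<alpha> \<beta> (v # ws)"
    using antihol_on_type[OF assms(1) h] antihol_on_type[OF assms(2) h] by (simp add: fadd_def algebra_simps)
qed

lemma antihol_on_fscale:
  assumes "antihol_on W J \<alpha>"
  shows "antihol_on W J (fscale z \<alpha>)"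
proof (rule antihol_onI)
  fix us v w ws assume h: "set us \<subseteq> W" "v \<in> W" "w \<in> W" "set ws \<subseteq> W"
  show "fscale z \<alpha> (us @ v # w # ws) = - fscale z \<alpha> (us @ w # v # ws)"
    using antihol_on_swap[OF assms(1) h] by (simp add: fscale_def)
next
  fix a b :: real and v w ws assume h: "v \<in> W" "w \<in> W" "set ws \<subseteq> W"
  show "fscale z \<alpha> ((a *\<^sub>R v + b *\<^sub>R w) # ws) = of_real a * fscale z \<alpha> (v # ws) + of_real b * fscale z \<alpha> (w # ws)"
    using antihol_on_lin[OF assms(1) h] by (simp add: fscale_def algebra_simps)
next
  fix v ws assume h: "v \<in> W" "set ws \<subseteq> W"
  show "fscale z \<alpha> (J v # ws) = \<i> * fscale z \<alpha> (v # ws)"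
    using antihol_on_type[OF assms(1) h] by (simp add: fscale_def algebra_simps)
qed

lemma antihol_on_parity:
  assumes "antihol_on W J \<alpha>"
  shows "antihol_on W J (parity \<alpha>)"
proof (rule antihol_onI)
  fix us v w ws assume h: "set us \<subseteq> W" "v \<in> W" "w \<in> W" "set ws \<subseteq> W"
  show "parity \<alpha> (us @ v # w # ws) = - parity \<alpha> (us @ w # v # ws)"
    using antihol_on_swap[OF assms(1) h] by (simp add: parity_def)
next
  fix a b :: real and v w ws assume h: "v \<in> W" "w \<in> W" "set ws \<subseteq> W"
  show "parity \<alpha> ((a *\<^sub>R v + b *\<^sub>R w) # ws) = of_real a * parity \<alpha> (v # ws) + of_real b * parity \<alpha> (w # ws)"
    using antihol_on_lin[OF assms(1) h] by (simp add: parity_def algebra_simps)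
next
  fix v ws assume h: "v \<in> W" "set ws \<subseteq> W"
  show "parity \<alpha> (J v # ws) = \<i> * parity \<alpha> (v # ws)"
    using antihol_on_type[OF assms(1) h] by (simp add: parity_def algebra_simps)
qed

lemma antihol_on_sum:
  assumes "\<And>i. i \<in> I \<Longrightarrow> antihol_on W J (f i)"
  shows "antihol_on W J (\<lambda>vs. \<Sum>i\<in>I. f i vs)"
  using assms
proof (induction I rule: infinite_finite_induct)
  case (insert i I)
  then have "antihol_on W J (fadd (f i) (\<lambda>vs. \<Sum>i\<in>I. f i vs))"
    by (intro antihol_on_fadd) auto
  then show ?case using insert by (simp add: fadd_def)
qed (simp_all add: antihol_on_def)

lemma antihol_on_fone: "antihol_on W J fone"
  by (simp add: antihol_on_def fone_def)

lemma antihol_on_mono: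
  assumes a: "antihol_on W J \<alpha>" and V: "V \<subseteq> W"
  shows "antihol_on V J \<alpha>"
proof (rule antihol_onI)
  fix us v w ws assume "set us \<subseteq> V" "v \<in> V" "w \<in> V" "set ws \<subseteq> V"
  then show "\<alpha> (us @ v # w # ws) = - \<alpha> (us @ w # v # ws)"
    using V by (intro antihol_on_swap[OF a]) auto
next
  fix a b :: real and v w ws assume "v \<in> V" "w \<in> V" "set ws \<subseteq> V"
  then show "\<alpha> ((a *\<^sub>R v + b *\<^sub>R w) # ws) = of_real a * \<alpha> (v # ws) + of_real b * \<alpha> (w # ws)"
    using V by (intro antihol_on_lin[OF assms(1)]) auto
next
  fix v ws assume "v \<in> V" "set ws \<subseteq> V"
  then show "\<alpha> (J v # ws) = \<i> * \<alpha> (v # ws)"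
    using V by (intro antihol_on_type[OF a]) auto
qed

lemma wedge_cong:
  assumes "\<And>us. set us \<subseteq> set vs \<Longrightarrow> \<alpha> us = \<alpha>' us" "\<And>us. set us \<subseteq> set vs \<Longrightarrow> \<beta> us = \<beta>' us"
  shows "wedge \<alpha> \<beta> vs = wedge \<alpha>' \<beta>' vs"
  unfolding wedge_def by (intro sum.cong refl) (simp add: assms set_nths_subset)

lemma wedge_map: "wedge \<alpha> \<beta> (map f vs) = wedge (\<lambda>us. \<alpha> (map f us)) (\<lambda>us. \<beta> (map f us)) vs"
  by (simp add: wedge_def nths_map)

lemma antihol_on_wedge:
  assumes W: "subspace W" and J: "\<And>v. v \<in> W \<Longrightarrow> J v \<in> W"
    and a: "antihol_on W J \<alpha>" and b: "antihol_on W J \<beta>"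
  shows "antihol_on W J (wedge \<alpha> \<beta>)"
proof -
  have lin: "wedge \<alpha> \<beta> ((r *\<^sub>R v + s *\<^sub>R w) # ws) = of_real r * wedge \<alpha> \<beta> (v # ws) + of_real s * wedge \<alpha> \<beta> (w # ws)"
    if a: "antihol_on W J \<alpha>" and b: "antihol_on W J \<beta>" and h: "v \<in> W" "w \<in> W" "set ws \<subseteq> W"
    for \<alpha> \<beta> r s v w ws
  proof -
    have 1: "wedge (int_prod (r *\<^sub>R v + s *\<^sub>R w) \<alpha>) \<beta> ws
        = wedge (fadd (fscale (of_real r) (int_prod v \<alpha>)) (fscale (of_real s) (int_prod w \<alpha>))) \<beta> ws"
      by (intro wedge_cong refl, unfold int_prod_def fadd_def fscale_def)
         (rule antihol_on_lin[OF a h(1,2) order_trans[OF _ h(3)]])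
    have 2: "wedge (parity \<alpha>) (int_prod (r *\<^sub>R v + s *\<^sub>R w) \<beta>) ws
        = wedge (parity \<alpha>) (fadd (fscale (of_real r) (int_prod v \<beta>)) (fscale (of_real s) (int_prod w \<beta>))) ws"
      by (intro wedge_cong refl, unfold int_prod_def fadd_def fscale_def)
         (rule antihol_on_lin[OF b h(1,2) order_trans[OF _ h(3)]])
    show ?thesis unfolding wedge_Cons 1 2
      by (simp add: wedge_fadd_left wedge_fadd_right wedge_fscale_left wedge_fscale_right)
         (simp add: fadd_def fscale_def algebra_simps)
  qed
  have type: "wedge \<alpha> \<beta> (J v # ws) = \<i> * wedge \<alpha> \<beta> (v # ws)"
    if a: "antihol_on W J \<alpha>" and b: "antihol_on W J \<beta>" and h: "v \<in> W" "set ws \<subseteq> W"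
    for \<alpha> \<beta> v ws
  proof -
    have 1: "wedge (int_prod (J v) \<alpha>) \<beta> ws = wedge (fscale \<i> (int_prod v \<alpha>)) \<beta> ws"
      by (intro wedge_cong refl, unfold int_prod_def fscale_def)
         (rule antihol_on_type[OF a h(1) order_trans[OF _ h(2)]])
    have 2: "wedge (parity \<alpha>) (int_prod (J v) \<beta>) ws = wedge (parity \<alpha>) (fscale \<i> (int_prod v \<beta>)) ws"
      by (intro wedge_cong refl, unfold int_prod_def fscale_def)
         (rule antihol_on_type[OF b h(1) order_trans[OF _ h(2)]])
    show ?thesis unfolding wedge_Cons 1 2
      by (simp add: wedge_fscale_left wedge_fscale_right) (simp add: fscale_def algebra_simps)
  qed
  have swap: "wedge \<alpha> \<beta> (us @ v # w # ws) = - wedge \<alpha> \<beta> (us @ w # v # ws)"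
    if a: "antihol_on W J \<alpha>" and b: "antihol_on W J \<beta>" and h: "set us \<subseteq> W" "v \<in> W" "w \<in> W" "set ws \<subseteq> W"
    for \<alpha> \<beta> us v w ws
    using a b h(1)
  proof (induction us arbitrary: \<alpha> \<beta>)
    case Nil
    have 1: "wedge (int_prod w (int_prod v \<alpha>)) \<beta> ws = wedge (fscale (- 1) (int_prod v (int_prod w \<alpha>))) \<beta> ws"
      by (intro wedge_cong refl, unfold int_prod_def fscale_def)
         (simp add: antihol_on_swap0[OF Nil(1) h(2,3) order_trans[OF _ h(4)]])
    have 2: "wedge \<alpha> (int_prod w (int_prod v \<beta>)) ws = wedge \<alpha> (fscale (- 1) (int_prod v (int_prod w \<beta>))) ws"
      by (intro wedge_cong refl, unfold int_prod_def fscale_def)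
         (simp add: antihol_on_swap0[OF Nil(2) h(2,3) order_trans[OF _ h(4)]])
    show ?case
      by (simp add: wedge_Cons int_prod_par wedge_fscale_left wedge_fscale_right 1 2) (simp add: fscale_def)
  next
    case (Cons u us)
    have u: "u \<in> W" "set us \<subseteq> W" using Cons by auto
    show ?case
      using Cons.IH[OF antihol_on_int_prod[OF Cons.prems(1) u(1) W J] Cons.prems(2) u(2)]
        Cons.IH[OF antihol_on_parity[OF Cons.prems(1)] antihol_on_int_prod[OF Cons.prems(2) u(1) W J] u(2)]
      by (simp add: wedge_Cons)
  qed
  show ?thesis by (rule antihol_onI) (blast intro: lin[OF a b] type[OF a b] swap[OF a b])+
qed

section \<open>Linear maps on a subspace\<close>
definition clin :: "'a::real_vector set \<Rightarrow> ('a \<Rightarrow> complex) \<Rightarrow> bool" where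
  "clin V f \<longleftrightarrow> (\<forall>x\<in>V. \<forall>y\<in>V. \<forall>a b::real. f (a *\<^sub>R x + b *\<^sub>R y) = of_real a * f x + of_real b * f y)"

definition rlin :: "'a::real_vector set \<Rightarrow> ('a \<Rightarrow> 'b::real_vector) \<Rightarrow> bool" where
  "rlin V A \<longleftrightarrow> (\<forall>x\<in>V. \<forall>y\<in>V. \<forall>a b::real. A (a *\<^sub>R x + b *\<^sub>R y) = a *\<^sub>R A x + b *\<^sub>R A y)"

lemma rlinD: "rlin V A \<Longrightarrow> x \<in> V \<Longrightarrow> y \<in> V \<Longrightarrow> A (a *\<^sub>R x + b *\<^sub>R y) = a *\<^sub>R A x + b *\<^sub>R A y"
  by (simp add: rlin_def)

lemma clin_iff_rlin: "clin V f \<longleftrightarrow> rlin V f"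
  by (simp add: clin_def rlin_def scaleR_conv_of_real)

context
  fixes V :: "'a::real_vector set" and A :: "'a \<Rightarrow> 'b::real_vector"
  assumes V: "subspace V" and A: "rlin V A"
begin

lemma rlin_add: "x \<in> V \<Longrightarrow> y \<in> V \<Longrightarrow> A (x + y) = A x + A y"
  using rlinD[OF A, of x y 1 1] by simp

lemma rlin_scale: "x \<in> V \<Longrightarrow> A (a *\<^sub>R x) = a *\<^sub>R A x"
  using rlinD[OF A, of x x a 0] by simp

lemma rlin_minus: "x \<in> V \<Longrightarrow> A (- x) = - A x"
  using rlin_scale[of x "-1"] by simp

lemma rlin_diff: "x \<in> V \<Longrightarrow> y \<in> V \<Longrightarrow> A (x - y) = A x - A y"
  using rlinD[OF A, of x y 1 "-1"] by simp

lemma rlin_0: "A 0 = 0"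
  using rlin_scale[of 0 0] subspace_0[OF V] by simp

lemma rlin_sum:
  "(\<And>i. i \<in> S \<Longrightarrow> h i \<in> V) \<Longrightarrow> A (\<Sum>i\<in>S. h i) = (\<Sum>i\<in>S. A (h i))"
proof (induction S rule: infinite_finite_induct)
  case (insert i S)
  then have "(\<Sum>i\<in>S. h i) \<in> V" using V by (intro subspace_sum) auto
  then show ?case using insert by (simp add: rlin_add)
qed (simp_all add: rlin_0)

lemma rlin_scaled_sum:
  "(\<And>i. i \<in> S \<Longrightarrow> h i \<in> V) \<Longrightarrow> A (\<Sum>i\<in>S. c i *\<^sub>R h i) = (\<Sum>i\<in>S. c i *\<^sub>R A (h i))"
  using rlin_sum[of S "\<lambda>i. c i *\<^sub>R h i"] V by (simp add: subspace_scale rlin_scale)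

end

lemma rlin_comp:
  assumes "rlin V A" "\<And>x. x \<in> V \<Longrightarrow> A x \<in> V" "rlin V f"
  shows "rlin V (\<lambda>x. f (A x))"
  using assms by (simp add: rlin_def)

section \<open>Quaternionic Hermitian spaces\<close>
text \<open>
  The model of the horizontal tangent space. All conditions are relative to the subspace \<open>V\<close>, since the metric and the
  complex structures of a homogeneous space are linear on the tangent space only and not on all matrices.
\<close>
locale quat_space =
  fixes V :: "'a::euclidean_space set" and g :: "'a \<Rightarrow> 'a \<Rightarrow> real" and I J K :: "'a \<Rightarrow> 'a"
  assumes V: "subspace V"
    and g_sym: "x \<in> V \<Longrightarrow> y \<in> V \<Longrightarrow> g x y = g y x"
    and g_lin: "y \<in> V \<Longrightarrow> rlin V (\<lambda>x. g x y)"
    and g_pos: "x \<in> V \<Longrightarrow> x \<noteq> 0 \<Longrightarrow> g x x > 0"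
    and I_in: "x \<in> V \<Longrightarrow> I x \<in> V" and J_in: "x \<in> V \<Longrightarrow> J x \<in> V"
    and I_lin: "rlin V I" and J_lin: "rlin V J"
    and I_skew: "x \<in> V \<Longrightarrow> y \<in> V \<Longrightarrow> g (I x) y = - g x (I y)"
    and J_skew: "x \<in> V \<Longrightarrow> y \<in> V \<Longrightarrow> g (J x) y = - g x (J y)"
    and II: "x \<in> V \<Longrightarrow> I (I x) = - x" and JJ: "x \<in> V \<Longrightarrow> J (J x) = - x"
    and IJ: "x \<in> V \<Longrightarrow> I (J x) = K x" and JI: "x \<in> V \<Longrightarrow> J (I x) = - K x"
begin

lemma K_in: "x \<in> V \<Longrightarrow> K x \<in> V"
  using IJ I_in J_in by metis

lemma minus_in: "x \<in> V \<Longrightarrow> - x \<in> V"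
  using V by (rule subspace_neg)

lemmas V_in = I_in J_in K_in minus_in subspace_add[OF V] subspace_scale[OF V] subspace_diff[OF V]

lemma g_lin2: "y \<in> V \<Longrightarrow> rlin V (g y)"
  using g_lin[of y] V unfolding rlin_def by (metis V_in(5) V_in(6) g_sym)

lemma K_lin: "rlin V K"
proof -
  have "rlin V (\<lambda>x. I (J x))" using J_lin J_in I_lin by (rule rlin_comp)
  then show ?thesis unfolding rlin_def by (simp add: IJ V_in)
qed

lemma K_skew:
  assumes x: "x \<in> V" and y: "y \<in> V" shows "g (K x) y = - g x (K y)"
proof -
  have "g (K x) y = g x (J (I y))"
    using x y by (simp add: I_skew J_skew V_in flip: IJ)
  then show ?thesis using x y by (simp add: JI rlin_minus[OF V g_lin2] V_in)
qed

lemma K_mult: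
  assumes x: "x \<in> V"
  shows "K (K x) = - x" "I (K x) = - J x" "K (I x) = J x" "J (K x) = I x" "K (J x) = - I x"
proof -
  show 1: "I (K x) = - J x" using x II[of "J x"] by (simp add: IJ V_in)
  show 2: "K (J x) = - I x" using x IJ[of "J x"] by (simp add: JJ V_in rlin_minus[OF V I_lin])
  have "J (I (J x)) = - K (J x)" using x by (simp add: JI V_in)
  then show 3: "J (K x) = I x" using x 2 by (simp add: IJ)
  show 4: "K (I x) = J x" using x IJ[of "I x"] 1 by (simp add: JI V_in rlin_minus[OF V I_lin])
  show "K (K x) = - x" using x IJ[of "K x"] 3 by (simp add: II V_in)
qed

text \<open>
  The value of \<open>\<omega>\<close> on two horizontal vectors.
\<close>
definition omega_val :: "'a \<Rightarrow> 'a \<Rightarrow> complex" where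
  "omega_val x y = - (1/2) * (of_real (g x (J y)) + \<i> * of_real (g x (K y)))"

lemma omega_val_swap: "x \<in> V \<Longrightarrow> y \<in> V \<Longrightarrow> omega_val y x = - omega_val x y"
  using J_skew[of x y] K_skew[of x y] g_sym[of "J x" y] g_sym[of "K x" y]
  by (simp add: omega_val_def V_in field_simps)

lemma omega_val_I: "x \<in> V \<Longrightarrow> y \<in> V \<Longrightarrow> omega_val (I x) (I y) = - omega_val x y"
  by (simp add: omega_val_def JI K_mult I_skew V_in rlin_minus[OF V g_lin2] IJ field_simps)

lemma clin_minus: "clin V f \<Longrightarrow> x \<in> V \<Longrightarrow> f (- x) = - f x"
  using rlin_minus[OF V, of f] by (simp add: clin_iff_rlin)

lemma clin_comp: "clin V f \<Longrightarrow> rlin V A \<Longrightarrow> (\<And>x. x \<in> V \<Longrightarrow> A x \<in> V) \<Longrightarrow> clin V (\<lambda>x. f (A x))"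
  using rlin_comp[of V A f] by (simp add: clin_iff_rlin)

end

locale quat_basis = quat_space +
  fixes B :: "'a set"
  assumes B_fin: "finite B" and B_in: "e \<in> B \<Longrightarrow> e \<in> V" and B_unit: "e \<in> B \<Longrightarrow> g e e = 1"
    and B_expand: "x \<in> V \<Longrightarrow> x = (\<Sum>e\<in>B. g e x *\<^sub>R e)"
begin

lemma clin_expand: "clin V f \<Longrightarrow> x \<in> V \<Longrightarrow> (\<Sum>e\<in>B. of_real (g e x) * f e) = f x"
  using rlin_scaled_sum[OF V, of f B "\<lambda>e. e" "\<lambda>e. g e x"] B_expand[of x] B_in
  by (simp add: clin_iff_rlin scaleR_conv_of_real)

lemma clin_expand': "clin V f \<Longrightarrow> x \<in> V \<Longrightarrow> (\<Sum>e\<in>B. of_real (g x e) * f e) = f x"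
  using clin_expand[of f x] by (simp add: g_sym B_in cong: sum.cong)

text \<open>
  Contractions do not depend on the orthonormal basis. Applied to a skew complex structure, this is the change of
  basis from \<open>e\<close> to \<open>I e\<close> on which the trace computations below rest.
\<close>
lemma trace_adjoint:
  assumes b1: "\<And>y. y \<in> V \<Longrightarrow> clin V (\<lambda>x. b x y)" and b2: "\<And>x. x \<in> V \<Longrightarrow> clin V (b x)"
    and A: "\<And>x. x \<in> V \<Longrightarrow> A x \<in> V" and A': "\<And>x. x \<in> V \<Longrightarrow> A' x \<in> V"
    and adj: "\<And>x y. x \<in> V \<Longrightarrow> y \<in> V \<Longrightarrow> g (A x) y = g x (A' y)"
  shows "(\<Sum>e\<in>B. b (A e) e) = (\<Sum>e\<in>B. b e (A' e))"
proof -
  have "(\<Sum>e\<in>B. b (A e) e) = (\<Sum>e\<in>B. \<Sum>l\<in>B. of_real (g (A e) l) * b l e)"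
    by (intro sum.cong refl, rule sym, rule clin_expand'[OF b1]) (auto simp: B_in A)
  also have "\<dots> = (\<Sum>e\<in>B. \<Sum>l\<in>B. of_real (g e (A' l)) * b l e)"
    by (intro sum.cong refl) (simp add: adj B_in)
  also have "\<dots> = (\<Sum>l\<in>B. \<Sum>e\<in>B. of_real (g e (A' l)) * b l e)"
    by (rule sum.swap)
  also have "\<dots> = (\<Sum>l\<in>B. b l (A' l))"
    by (intro sum.cong refl clin_expand[OF b2]) (auto simp: B_in A')
  finally show ?thesis .
qed

end

section \<open>Curvature tensors and their traces\<close>
text \<open>
  \<open>R x y\<close> stands for the action of the isotropy component of \<open>[x,y]\<close>. The right side of the cyclic identity is what the
  vertical component \<open>-2 (\<Phi>\<^sub>1(x,y) \<xi>\<^sub>1 + \<Phi>\<^sub>2(x,y) \<xi>\<^sub>2 + \<Phi>\<^sub>3(x,y) \<xi>\<^sub>3)\<close> contributes to the Jacobi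
  identity, moved to the other side.
\<close>
locale quat_curv = quat_basis +
  fixes R :: "'a \<Rightarrow> 'a \<Rightarrow> 'a \<Rightarrow> 'a"
  assumes R_in: "x \<in> V \<Longrightarrow> y \<in> V \<Longrightarrow> z \<in> V \<Longrightarrow> R x y z \<in> V"
    and R_lin1: "y \<in> V \<Longrightarrow> z \<in> V \<Longrightarrow> rlin V (\<lambda>x. R x y z)"
    and R_lin3: "x \<in> V \<Longrightarrow> y \<in> V \<Longrightarrow> rlin V (R x y)"
    and R_skew: "x \<in> V \<Longrightarrow> y \<in> V \<Longrightarrow> z \<in> V \<Longrightarrow> R x y z = - R y x z"
    and R_I: "x \<in> V \<Longrightarrow> y \<in> V \<Longrightarrow> z \<in> V \<Longrightarrow> R (I x) y z = - R x (I y) z"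
    and R_J: "x \<in> V \<Longrightarrow> y \<in> V \<Longrightarrow> z \<in> V \<Longrightarrow> R (J x) y z = - R x (J y) z"
    and R_comm: "x \<in> V \<Longrightarrow> y \<in> V \<Longrightarrow> z \<in> V \<Longrightarrow> R x y (I z) = I (R x y z)"
    and R_cyclic: "x \<in> V \<Longrightarrow> y \<in> V \<Longrightarrow> z \<in> V \<Longrightarrow> R x y z + R y z x + R z x y
      = 2 *\<^sub>R (g x (I y) *\<^sub>R I z + g x (J y) *\<^sub>R J z + g x (K y) *\<^sub>R K z)
      + 2 *\<^sub>R (g y (I z) *\<^sub>R I x + g y (J z) *\<^sub>R J x + g y (K z) *\<^sub>R K x)
      + 2 *\<^sub>R (g z (I x) *\<^sub>R I y + g z (J x) *\<^sub>R J y + g z (K x) *\<^sub>R K y)"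
begin

lemma R_lin2: assumes "x \<in> V" "z \<in> V" shows "rlin V (\<lambda>y. R x y z)"
  unfolding rlin_def
proof (intro ballI allI)
  fix u v a b assume "u \<in> V" "v \<in> V"
  then show "R x (a *\<^sub>R u + b *\<^sub>R v) z = a *\<^sub>R R x u z + b *\<^sub>R R x v z"
    using assms R_skew[of x "a *\<^sub>R u + b *\<^sub>R v" z] R_skew[of x u z] R_skew[of x v z]
      rlinD[OF R_lin1[of x z], of u v a b] by (simp add: V_in)
qed

context
  fixes f :: "'a \<Rightarrow> complex"
  assumes f: "clin V f" and fI: "x \<in> V \<Longrightarrow> f (I x) = \<i> * f x"
begin

lemma f_cyclic:
  assumes "x \<in> V" "y \<in> V" "z \<in> V"
  shows "f (R x y z) + f (R y z x) + f (R z x y)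
      = 2 * (of_real (g x (I y)) * f (I z) + of_real (g x (J y)) * f (J z) + of_real (g x (K y)) * f (K z))
      + 2 * (of_real (g y (I z)) * f (I x) + of_real (g y (J z)) * f (J x) + of_real (g y (K z)) * f (K x))
      + 2 * (of_real (g z (I x)) * f (I y) + of_real (g z (J x)) * f (J y) + of_real (g z (K x)) * f (K y))"
proof -
  have r: "rlin V f" using f by (simp add: clin_iff_rlin)
  have "f (R x y z) + f (R y z x) + f (R z x y) = f (R x y z + R y z x + R z x y)"
    using assms by (simp add: rlin_add[OF V r] R_in V_in)
  also have "\<dots> = 2 * (of_real (g x (I y)) * f (I z) + of_real (g x (J y)) * f (J z) + of_real (g x (K y)) * f (K z))
      + 2 * (of_real (g y (I z)) * f (I x) + of_real (g y (J z)) * f (J x) + of_real (g y (K z)) * f (K x))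
      + 2 * (of_real (g z (I x)) * f (I y) + of_real (g z (J x)) * f (J y) + of_real (g z (K x)) * f (K y))"
    unfolding R_cyclic[OF assms] using assms
    by (simp add: rlin_add[OF V r] rlin_scale[OF V r] V_in scaleR_conv_of_real)
  finally show ?thesis .
qed

lemmas clin_f = clin_comp[OF f] and f_minus = clin_minus[OF f]

text \<open>
  Passing to the basis \<open>J e\<close> changes the sign of the sum, because \<open>J\<close> anticommutes with \<open>I\<close> while \<open>R\<close> is unchanged
  when \<open>J\<close> is applied to both of its first arguments.
\<close>
lemma sum_R_e_Ie:
  assumes x: "x \<in> V"
  shows "(\<Sum>e\<in>B. f (R e (I e) x)) = 0"
proof -
  let ?c = "\<lambda>u v. f (R u (I (J v)) x)"
  have "(\<Sum>e\<in>B. ?c (J e) e) = (\<Sum>e\<in>B. ?c e (- J e))"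
  proof (rule trace_adjoint)
    fix y assume "y \<in> V"
    then show "clin V (\<lambda>u. ?c u y)"
      by (intro clin_f R_lin1) (auto simp: x V_in R_in)
  next
    fix u assume u: "u \<in> V"
    have "rlin V (\<lambda>v. R u (I (J v)) x)"
      by (rule rlin_comp[OF J_lin J_in], simp, rule rlin_comp[OF I_lin I_in], simp, rule R_lin2[OF u x])
    then show "clin V (?c u)"
      by (rule clin_f) (auto simp: x u V_in R_in)
  qed (auto simp: V_in J_skew rlin_minus[OF V g_lin2])
  also have "\<dots> = (\<Sum>e\<in>B. f (R e (I e) x))"
    by (intro sum.cong refl) (simp add: B_in V_in rlin_minus[OF V J_lin] JJ)
  finally have 1: "(\<Sum>e\<in>B. f (R (J e) (I (J e)) x)) = (\<Sum>e\<in>B. f (R e (I e) x))" .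
  have "f (R (J e) (I (J e)) x) = - f (R e (I e) x)" if "e \<in> B" for e
  proof -
    have e: "e \<in> V" using that by (rule B_in)
    have "R (J e) (I (J e)) x = R (J e) (- J (I e)) x" using e by (simp add: IJ JI)
    also have "\<dots> = - R (J e) (J (I e)) x" using e x by (simp add: rlin_minus[OF V R_lin2] V_in)
    also have "\<dots> = R e (J (J (I e))) x" using e x by (simp add: R_J V_in)
    also have "\<dots> = - R e (I e) x" using e x by (simp add: JJ V_in rlin_minus[OF V R_lin2])
    finally show ?thesis using e x by (simp add: f_minus R_in V_in)
  qed
  with 1 show ?thesis by (simp add: sum_negf)
qed

text \<open>
  The cyclic identity for \<open>x, e, I e\<close>, summed over the basis: two of the three terms on the left are equal, and the third is the sum that vanishes by the preceding lemma.
\<close>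
lemma ricci:
  assumes x: "x \<in> V"
  shows "(\<Sum>e\<in>B. f (R x e e)) = - (of_nat (card B) + 2) * f x"
proof -
  let ?S = "\<Sum>e\<in>B. f (R x e e)"
  have s1: "(\<Sum>e\<in>B. f (R x e (I e))) = \<i> * ?S"
    by (simp add: sum_distrib_left R_comm fI B_in x R_in cong: sum.cong)
  have s3: "(\<Sum>e\<in>B. f (R (I e) x e)) = \<i> * ?S"
  proof -
    have "(\<Sum>e\<in>B. f (R (I e) x e)) = - (\<Sum>e\<in>B. f (R x (I e) e))"
      using R_skew[OF I_in[OF B_in] x B_in]
      by (simp add: f_minus R_in V_in B_in x sum_negf cong: sum.cong)
    also have "(\<Sum>e\<in>B. f (R x (I e) e)) = (\<Sum>e\<in>B. f (R x e (- I e)))"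
      by (rule trace_adjoint[where b="\<lambda>u v. f (R x u v)" and A=I and A'="\<lambda>e. - I e"])
         (auto simp: V_in R_in x I_skew rlin_minus[OF V g_lin2] intro!: clin_f R_lin2 R_lin3)
    also have "\<dots> = - (\<Sum>e\<in>B. f (R x e (I e)))"
      by (simp add: rlin_minus[OF V R_lin3] f_minus R_in V_in B_in x sum_negf cong: sum.cong)
    finally show ?thesis using s1 by simp
  qed
  have ex: "(\<Sum>e\<in>B. of_real (g z e) * f (A e)) = f (A z)"
    if "z \<in> V" "rlin V A" "\<And>x. x \<in> V \<Longrightarrow> A x \<in> V" for z A
    using clin_expand'[OF clin_f[of A], of z] that by simp
  have lin: "rlin V (\<lambda>e. I (I e))" "rlin V (\<lambda>e. J (I e))" "rlin V (\<lambda>e. K (I e))"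
    using I_lin J_lin K_lin I_in by (blast intro: rlin_comp)+
  have sk: "g x (I e) = - g (I x) e" "g x (J e) = - g (J x) e" "g x (K e) = - g (K x) e" if "e \<in> B" for e
    using that x by (simp_all add: I_skew J_skew K_skew B_in)
  have t1: "(\<Sum>e\<in>B. of_real (g x (I e)) * f (I (I e)) + of_real (g x (J e)) * f (J (I e)) + of_real (g x (K e)) * f (K (I e)))
      = - \<i> * f x" (is "?X1 = _")
  proof -
    have "(\<Sum>e\<in>B. of_real (g x (I e)) * f (I (I e)) + of_real (g x (J e)) * f (J (I e)) + of_real (g x (K e)) * f (K (I e)))
      = - (f (I (I (I x))) + f (J (I (J x))) + f (K (I (K x))))"
      using x by (simp add: sk sum.distrib sum_negf sum_subtractf ex lin V_in cong: sum.cong)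
    also have "\<dots> = - \<i> * f x"
      using x by (simp add: II IJ K_mult V_in f_minus fI rlin_minus[OF V K_lin])
    finally show ?thesis .
  qed
  have un: "g e (I (I e)) = - 1" "g e (J (I e)) = 0" "g e (K (I e)) = 0" if "e \<in> B" for e
  proof -
    have e: "e \<in> V" using that by (rule B_in)
    have J0: "g e (J e) = 0" using J_skew[OF e e] g_sym[of e "J e"] e by (simp add: V_in)
    have K0: "g e (K e) = 0" using K_skew[OF e e] g_sym[of e "K e"] e by (simp add: V_in)
    show "g e (I (I e)) = - 1" "g e (J (I e)) = 0" "g e (K (I e)) = 0"
      using e that J0 K0 by (simp_all add: II JI K_mult B_unit rlin_minus[OF V g_lin2] V_in)
  qed
  have t2: "(\<Sum>e\<in>B. of_real (g e (I (I e))) * f (I x) + of_real (g e (J (I e))) * f (J x) + of_real (g e (K (I e))) * f (K x))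
      = - of_nat (card B) * (\<i> * f x)" (is "?X2 = _")
    using x by (simp add: un fI sum_negf cong: sum.cong)
  have sk2: "g (I e) (I x) = g x e" "g (I e) (J x) = - g (K x) e" "g (I e) (K x) = g (J x) e" if "e \<in> B" for e
    using that x g_sym[of e x] g_sym[of e "K x"] g_sym[of e "J x"]
    by (simp_all add: I_skew B_in V_in II IJ K_mult rlin_minus[OF V g_lin2])
  have t3: "(\<Sum>e\<in>B. of_real (g (I e) (I x)) * f (I e) + of_real (g (I e) (J x)) * f (J e) + of_real (g (I e) (K x)) * f (K e))
      = - \<i> * f x" (is "?X3 = _")
  proof -
    have "(\<Sum>e\<in>B. of_real (g (I e) (I x)) * f (I e) + of_real (g (I e) (J x)) * f (J e) + of_real (g (I e) (K x)) * f (K e))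
      = f (I x) - f (J (K x)) + f (K (J x))"
      using x by (simp add: sk2 sum.distrib sum_negf sum_subtractf ex I_lin J_lin K_lin V_in cong: sum.cong)
    also have "\<dots> = - \<i> * f x" using x by (simp add: K_mult f_minus fI V_in)
    finally show ?thesis .
  qed
  have "\<i> * ?S + 0 + \<i> * ?S = (\<Sum>e\<in>B. f (R x e (I e)) + f (R e (I e) x) + f (R (I e) x e))"
    by (simp only: sum.distrib s1 s3 sum_R_e_Ie[OF x])
  also have "\<dots> = 2 * ?X1 + 2 * ?X2 + 2 * ?X3"
    using x by (simp only: sum_distrib_left sum.distrib[symmetric]) (intro sum.cong refl f_cyclic; simp add: B_in V_in)
  also have "\<dots> = 2 * (- \<i> * f x) + 2 * (- of_nat (card B) * (\<i> * f x)) + 2 * (- \<i> * f x)"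
    by (simp only: t1 t2 t3)
  finally have "2 * \<i> * ?S = 2 * \<i> * (- (of_nat (card B) + 2) * f x)" by algebra
  then show ?thesis by (simp del: mult_minus_left)
qed

end

text \<open>
  The cyclic identity expresses the left side through the metric, up to a term with \<open>R y x e\<close>. Replacing \<open>x, y\<close> by
  \<open>I x, I y\<close> changes the sign of everything except that term, so subtracting removes it.
\<close>
lemma contracted_cyclic:
  assumes b1: "\<And>y. y \<in> V \<Longrightarrow> clin V (\<lambda>x. b x y)" and b2: "\<And>x. x \<in> V \<Longrightarrow> clin V (b x)"
    and bI1: "\<And>x y. x \<in> V \<Longrightarrow> y \<in> V \<Longrightarrow> b (I x) y = \<i> * b x y"
    and bI2: "\<And>x y. x \<in> V \<Longrightarrow> y \<in> V \<Longrightarrow> b x (I y) = \<i> * b x y"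
    and alt: "\<And>x y. x \<in> V \<Longrightarrow> y \<in> V \<Longrightarrow> b y x = - b x y"
    and x: "x \<in> V" and y: "y \<in> V"
  shows "(\<Sum>e\<in>B. b e (R x e y)) - (\<Sum>e\<in>B. b e (R y e x)) = 4 * (b x y + omega_val x y * (\<Sum>e\<in>B. b e (J e)))"
proof -
  define F where "F x y = (\<Sum>e\<in>B. b e (R x e y))" for x y
  define G where "G x y = (\<Sum>e\<in>B. b e (R y x e))" for x y
  let ?omega_trace = "\<Sum>e\<in>B. b e (J e)"
  have FI: "F (I x) (I y) = - F x y" if x: "x \<in> V" and y: "y \<in> V" for x y
  proof -
    have "F (I x) (I y) = (\<Sum>e\<in>B. - \<i> * b e (R x (I e) y))"
      unfolding F_def
    proof (intro sum.cong refl)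
      fix e assume "e \<in> B" then have e: "e \<in> V" by (rule B_in)
      have "b e (R (I x) e (I y)) = \<i> * b e (R (I x) e y)"
        using e x y by (simp add: R_comm bI2 V_in R_in)
      also have "R (I x) e y = - R x (I e) y" using e x y by (simp add: R_I)
      also have "b e (- R x (I e) y) = - b e (R x (I e) y)"
        using e x y by (simp add: clin_minus[OF b2] V_in R_in)
      finally show "b e (R (I x) e (I y)) = - \<i> * b e (R x (I e) y)" by simp
    qed
    also have "\<dots> = - \<i> * (\<Sum>e\<in>B. b e (R x (I e) y))" by (simp add: sum_distrib_left)
    also have "(\<Sum>e\<in>B. b e (R x (I e) y)) = (\<Sum>e\<in>B. b (- I e) (R x e y))"
      by (rule trace_adjoint[where b="\<lambda>u v. b u (R x v y)" and A="\<lambda>e. - I e" and A'=I, symmetric])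
         (auto simp: V_in R_in x y I_skew rlin_minus[OF V g_lin] intro!: b1 clin_comp[OF b2] R_lin2)
    also have "\<dots> = (\<Sum>e\<in>B. - \<i> * b e (R x e y))"
      using x y by (intro sum.cong refl) (simp add: clin_minus[OF b1] bI1 R_in V_in B_in)
    also have "\<dots> = - \<i> * F x y" by (simp add: sum_distrib_left F_def)
    finally show ?thesis by simp
  qed
  have GI: "G (I x) (I y) = G x y" if x: "x \<in> V" and y: "y \<in> V" for x y
    unfolding G_def
  proof (intro sum.cong refl)
    fix e assume "e \<in> B" then have e: "e \<in> V" by (rule B_in)
    have "R (I y) (I x) e = - R y (- x) e" using e x y by (simp add: R_I II V_in)
    then show "b e (R (I y) (I x) e) = b e (R y x e)"
      using e x y by (simp add: rlin_minus[OF V R_lin2])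
  qed
  have b0: "b e (I e) = 0" if "e \<in> B" for e
    using that alt[of e e] bI2[of e e] by (simp add: B_in)
  have bK: "b e (K e) = \<i> * b e (J e)" if "e \<in> B" for e
    using that bI2[of e "J e"] by (simp add: B_in V_in IJ)
  have main: "F x y - F y x + G x y = 4 * (b x y + omega_val x y * ?omega_trace)" if x: "x \<in> V" and y: "y \<in> V" for x y
  proof -
    have "F x y - F y x + G x y = (\<Sum>e\<in>B. b e (R x e y) + b e (R e y x) + b e (R y x e))"
      using x y R_skew[OF B_in y x]
      by (simp add: F_def G_def sum.distrib clin_minus[OF b2] R_in B_in sum_subtractf cong: sum.cong)
    also have "\<dots> = (\<Sum>e\<in>B. 2 * (of_real (g x (I e)) * b e (I y) + of_real (g x (J e)) * b e (J y) + of_real (g x (K e)) * b e (K y))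
      + 2 * (of_real (g e (I y)) * b e (I x) + of_real (g e (J y)) * b e (J x) + of_real (g e (K y)) * b e (K x))
      + 2 * (of_real (g y (I x)) * b e (I e) + of_real (g y (J x)) * b e (J e) + of_real (g y (K x)) * b e (K e)))"
      using x y by (intro sum.cong refl f_cyclic[OF b2]) (simp_all add: B_in bI2)
    also have "\<dots> = - 2 * (b (I x) (I y) + b (J x) (J y) + b (K x) (K y))
       + 2 * (b (I y) (I x) + b (J y) (J x) + b (K y) (K x))
       + 2 * (of_real (g y (J x)) + \<i> * of_real (g y (K x))) * ?omega_trace"
    proof -
      have sk: "g x (I e) = - g (I x) e" "g x (J e) = - g (J x) e" "g x (K e) = - g (K x) e" if "e \<in> B" for e
        using that x by (simp_all add: I_skew J_skew K_skew B_in)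
      have "(\<Sum>e\<in>B. of_real (g x (I e)) * b e (I y) + of_real (g x (J e)) * b e (J y) + of_real (g x (K e)) * b e (K y))
        = - (b (I x) (I y) + b (J x) (J y) + b (K x) (K y))"
        using x y by (simp add: sk sum.distrib sum_negf sum_subtractf clin_expand'[OF b1] V_in cong: sum.cong)
      moreover have "(\<Sum>e\<in>B. of_real (g e (I y)) * b e (I x) + of_real (g e (J y)) * b e (J x) + of_real (g e (K y)) * b e (K x))
        = b (I y) (I x) + b (J y) (J x) + b (K y) (K x)"
        using x y by (simp add: sum.distrib clin_expand[OF b1] V_in)
      moreover have "(\<Sum>e\<in>B. of_real (g y (I x)) * b e (I e) + of_real (g y (J x)) * b e (J e) + of_real (g y (K x)) * b e (K e))
        = (of_real (g y (J x)) + \<i> * of_real (g y (K x))) * ?omega_trace"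
        by (simp add: b0 bK sum.distrib sum_distrib_left algebra_simps cong: sum.cong)
      ultimately show ?thesis unfolding sum.distrib sum_distrib_left[symmetric] by simp
    qed
    also have "\<dots> = 4 * (b x y + omega_val x y * ?omega_trace)"
    proof -
      have "b (I x) (I y) = - b x y" using x y by (simp add: bI1 bI2 V_in)
      moreover have "b (K x) (K y) = - b (J x) (J y)"
        using x y by (simp add: bI1 bI2 V_in flip: IJ)
      moreover have "b (I y) (I x) = b x y" using x y alt[of x y] by (simp add: bI1 bI2 V_in)
      moreover have "b (K y) (K x) = - b (J y) (J x)"
        using x y by (simp add: bI1 bI2 V_in flip: IJ)
      moreover have "of_real (g y (J x)) + \<i> * of_real (g y (K x)) = 2 * omega_val x y"
        using omega_val_swap[OF x y] unfolding omega_val_def[of y x] by (simp add: field_simps)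
      ultimately show ?thesis by (simp add: algebra_simps)
    qed
    finally show ?thesis .
  qed
  have "F (I x) (I y) - F (I y) (I x) + G (I x) (I y) = 4 * (b (I x) (I y) + omega_val (I x) (I y) * ?omega_trace)"
    using x y by (intro main V_in)
  then have "- (F x y - F y x) + G x y = - 4 * (b x y + omega_val x y * ?omega_trace)"
    using x y by (simp add: FI GI omega_val_I bI1 bI2 V_in algebra_simps)
  with main[OF x y] have "2 * (F x y - F y x) = 2 * (4 * (b x y + omega_val x y * ?omega_trace))"
    by algebra
  then have "F x y - F y x = 4 * (b x y + omega_val x y * ?omega_trace)"
    by (simp only: mult_cancel_left) simp
  then show ?thesis unfolding F_def .
qed

end

section \<open>Alternation over the arguments\<close>
text \<open>
  Up to sign, the infinitesimal action of \<open>A\<close> on forms.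
\<close>
fun form_deriv :: "('a \<Rightarrow> 'a) \<Rightarrow> 'a form \<Rightarrow> 'a form" where
  "form_deriv A \<alpha> [] = 0"
| "form_deriv A \<alpha> (v # vs) = \<alpha> (A v # vs) + form_deriv A (int_prod v \<alpha>) vs"

text \<open>
  The sum over all positions of \<open>f\<close> at the argument there, evaluated on the remaining arguments, with
  alternating signs; equivalently, the sum of \<open>e\<^sup>* \<and> f e\<close> over a basis.
\<close>
fun alternate :: "('a \<Rightarrow> 'a form) \<Rightarrow> 'a form" where
  "alternate f [] = 0"
| "alternate f (v # vs) = f v vs - alternate (\<lambda>x. int_prod v (f x)) vs"

lemma alternate_cong:
  assumes "set vs \<subseteq> V" "\<And>x us. x \<in> V \<Longrightarrow> set us \<subseteq> V \<Longrightarrow> f x us = h x us"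
  shows "alternate f vs = alternate h vs"
  using assms
proof (induction vs arbitrary: f h)
  case (Cons v vs)
  have "alternate (\<lambda>x. int_prod v (f x)) vs = alternate (\<lambda>x. int_prod v (h x)) vs"
    using Cons.prems by (intro Cons.IH) (auto simp: int_prod_def)
  then show ?case using Cons.prems by simp
qed simp

lemma alternate_add: "alternate (\<lambda>x us. f x us + h x us) vs = alternate f vs + alternate h vs"
  by (induction vs arbitrary: f h) (simp_all add: int_prod_def)

lemma alternate_scale: "alternate (\<lambda>x us. c * f x us) vs = c * alternate f vs"
  by (induction vs arbitrary: f) (simp_all add: int_prod_def algebra_simps)

lemma alternate_minus: "alternate (\<lambda>x us. - f x us) vs = - alternate f vs"
  using alternate_scale[of "-1"] by simp

lemma alternate_diff: "alternate (\<lambda>x us. f x us - h x us) vs = alternate f vs - alternate h vs"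
  using alternate_add[of f "\<lambda>x us. - h x us"] by (simp add: alternate_minus)

lemma alternate_sum: "alternate (\<lambda>x us. \<Sum>e\<in>B. f e x us) vs = (\<Sum>e\<in>B. alternate (f e) vs)"
  by (induction vs arbitrary: f) (simp_all add: int_prod_def sum_subtractf)

lemma form_deriv_cong:
  assumes "set vs \<subseteq> V" "\<And>x. x \<in> V \<Longrightarrow> A x \<in> V" "\<And>us. set us \<subseteq> V \<Longrightarrow> \<alpha> us = \<beta> us"
  shows "form_deriv A \<alpha> vs = form_deriv A \<beta> vs"
  using assms(1,3)
proof (induction vs arbitrary: \<alpha> \<beta>)
  case (Cons v vs)
  have "form_deriv A (int_prod v \<alpha>) vs = form_deriv A (int_prod v \<beta>) vs"
    using Cons.prems by (intro Cons.IH) (auto simp: int_prod_def)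
  then show ?case using Cons.prems assms(2) by simp
qed simp

lemma form_deriv_minus: "form_deriv A (\<lambda>us. - \<alpha> us) vs = - form_deriv A \<alpha> vs"
  by (induction vs arbitrary: \<alpha>) (simp_all add: int_prod_def)

lemma wedge_one_form:
  assumes "\<And>us. length us \<noteq> 1 \<Longrightarrow> a us = 0"
  shows "wedge a \<tau> vs = alternate (\<lambda>x us. a [x] * \<tau> us) vs"
proof (induction vs arbitrary: \<tau>)
  case Nil then show ?case by (simp add: assms)
next
  case (Cons v vs)
  have 1: "int_prod v a = fscale (a [v]) fone"
    by (rule ext) (auto simp: int_prod_def fscale_def fone_def assms)
  have 2: "parity a = fscale (- 1) a"
  proof (rule ext)
    fix us show "parity a us = fscale (- 1) a us"
      using assms[of us] by (cases "length us = 1") (simp_all add: parity_def fscale_def)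
  qed
  show ?case
    by (simp add: wedge_Cons 1 2 wedge_fscale_left) (simp add: fscale_def Cons int_prod_def)
qed

context
  fixes V :: "'a::real_vector set" and I :: "'a \<Rightarrow> 'a"
  assumes V: "subspace V" and I: "\<And>x. x \<in> V \<Longrightarrow> I x \<in> V"
begin

lemma alternate_int_prod:
  assumes "antihol_on V I \<alpha>" "set vs \<subseteq> V"
  shows "alternate (\<lambda>x. int_prod x \<alpha>) vs = of_nat (length vs) * \<alpha> vs"
  using assms
proof (induction vs arbitrary: \<alpha>)
  case (Cons v vs)
  have v: "v \<in> V" "set vs \<subseteq> V" using Cons.prems by auto
  have "alternate (\<lambda>x. int_prod v (int_prod x \<alpha>)) vs = alternate (\<lambda>x us. - int_prod x (int_prod v \<alpha>) us) vs"
    using antihol_on_swap0[OF Cons.prems(1) _ v(1)] by (intro alternate_cong[OF v(2)]) (simp add: int_prod_def)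
  also have "\<dots> = - (of_nat (length vs) * int_prod v \<alpha> vs)"
    unfolding alternate_minus using Cons.IH[OF antihol_on_int_prod[OF Cons.prems(1) v(1) V I] v(2)] by simp
  finally show ?case by (simp add: int_prod_def algebra_simps)
qed simp

lemma form_deriv_alternate:
  assumes "antihol_on V I \<alpha>" "set vs \<subseteq> V" and A: "\<And>x. x \<in> V \<Longrightarrow> A x \<in> V"
  shows "form_deriv A \<alpha> vs = alternate (\<lambda>x. int_prod (A x) \<alpha>) vs"
  using assms(1,2)
proof (induction vs arbitrary: \<alpha>)
  case (Cons v vs)
  have v: "v \<in> V" "set vs \<subseteq> V" using Cons.prems by auto
  have "alternate (\<lambda>x. int_prod v (int_prod (A x) \<alpha>)) vs = alternate (\<lambda>x us. - int_prod (A x) (int_prod v \<alpha>) us) vs"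
    using antihol_on_swap0[OF Cons.prems(1) _ v(1)] by (intro alternate_cong[OF v(2)]) (simp add: int_prod_def A)
  also have "\<dots> = - form_deriv A (int_prod v \<alpha>) vs"
    unfolding alternate_minus using Cons.IH[OF antihol_on_int_prod[OF Cons.prems(1) v(1) V I] v(2)] by simp
  finally show ?case by (simp add: int_prod_def)
qed simp

lemma antihol_on_repeat:
  assumes a: "antihol_on V I \<alpha>" and "set us \<subseteq> V" "x \<in> V" "set vs \<subseteq> V" "set ws \<subseteq> V"
  shows "\<alpha> (us @ x # vs @ x # ws) = 0"
  using assms(2-5)
proof (induction vs arbitrary: us)
  case Nil
  then show ?case using antihol_on_swap[OF a Nil(1,2,2,4)] by simp
next
  case (Cons y vs)
  have "\<alpha> (us @ x # y # (vs @ x # ws)) = - \<alpha> (us @ y # x # (vs @ x # ws))"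
    using Cons.prems by (intro antihol_on_swap[OF a]) auto
  also have "\<alpha> (us @ y # x # (vs @ x # ws)) = 0"
    using Cons.IH[of "us @ [y]"] Cons.prems by simp
  finally show ?case by simp
qed

lemma antihol_on_clin: "antihol_on V I \<alpha> \<Longrightarrow> set ws \<subseteq> V \<Longrightarrow> clin V (\<lambda>x. \<alpha> (x # ws))"
  unfolding clin_def by (blast intro: antihol_on_lin)

lemma antihol_on_clin2: "antihol_on V I \<alpha> \<Longrightarrow> y \<in> V \<Longrightarrow> set ws \<subseteq> V \<Longrightarrow> clin V (\<lambda>x. \<alpha> (y # x # ws))"
  using antihol_on_clin[OF antihol_on_int_prod[OF _ _ V I], of \<alpha> y ws] by (simp add: int_prod_def)

text \<open>
  In each argument the form depends only on the coefficients of a complex basis \<open>C\<close>, so more than \<open>card C\<close> arguments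
  force a repetition.
\<close>
lemma antihol_on_zero_long:
  assumes a: "antihol_on V I \<alpha>" and C: "finite C" "C \<subseteq> V"
    and exp: "\<And>x. x \<in> V \<Longrightarrow> \<exists>c d. x = (\<Sum>e\<in>C. c e *\<^sub>R e + d e *\<^sub>R I e)"
    and vs: "set vs \<subseteq> V" "length vs > card C"
  shows "\<alpha> vs = 0"
proof -
  have C0: "\<alpha> us = 0" if us: "set us \<subseteq> C" "length us = length vs" for us
  proof -
    have "\<not> distinct us"
    proof
      assume "distinct us"
      then have "length us = card (set us)" by (simp add: distinct_card)
      also have "\<dots> \<le> card C" using C us by (intro card_mono) auto
      finally show False using us vs by simp
    qed
    then obtain xs ys zs y where "us = xs @ [y] @ ys @ [y] @ zs"
      using not_distinct_decomp by blast
    then show ?thesis using antihol_on_repeat[OF a, of xs y ys zs] us C by auto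
  qed
  have "\<beta> us = 0" if "set us \<subseteq> V" "antihol_on V I \<beta>"
    "\<And>ws. set ws \<subseteq> C \<Longrightarrow> length ws = length us \<Longrightarrow> \<beta> ws = 0" for \<beta> us
    using that
  proof (induction us arbitrary: \<beta>)
    case (Cons x us)
    have x: "x \<in> V" "set us \<subseteq> V" using Cons.prems by auto
    obtain c d where cd: "x = (\<Sum>e\<in>C. c e *\<^sub>R e + d e *\<^sub>R I e)" using exp[OF x(1)] by blast
    have r: "rlin V (\<lambda>x. \<beta> (x # us))"
      using antihol_on_clin[OF Cons.prems(2) x(2)] by (simp add: clin_iff_rlin)
    have e0: "\<beta> (e # us) = 0" if e: "e \<in> C" for e
      using Cons.IH[OF x(2) antihol_on_int_prod[OF Cons.prems(2) _ V I], of e] e C Cons.prems(3)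
      by (auto simp: int_prod_def)
    have "\<beta> (x # us) = (\<Sum>e\<in>C. \<beta> ((c e *\<^sub>R e + d e *\<^sub>R I e) # us))"
      unfolding cd using C V I
      by (intro rlin_sum[OF V r]) (auto intro!: subspace_add subspace_scale)
    also have "\<dots> = 0"
    proof (intro sum.neutral ballI)
      fix e assume e: "e \<in> C"
      then have eV: "e \<in> V" using C by auto
      show "\<beta> ((c e *\<^sub>R e + d e *\<^sub>R I e) # us) = 0"
        using antihol_on_lin[OF Cons.prems(2) eV I[OF eV] x(2)]
          antihol_on_type[OF Cons.prems(2) eV x(2)] e0[OF e] by simp
    qed
    finally show ?case .
  qed simp
  then show ?thesis using a vs C0 by blast
qed

end

context quat_basis
begin

definition omega_trace :: "'a form \<Rightarrow> 'a form" where
  "omega_trace \<alpha> = (\<lambda>vs. \<Sum>e\<in>B. \<alpha> (e # J e # vs))"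

end

context quat_curv
begin

text \<open>
  Unfolding the first argument \<open>v\<close> leaves the same expression for the interior product with \<open>v\<close>, plus the alternation
  of the difference evaluated in \<open>contracted_cyclic\<close>; the degree-dependent term accumulates to \<open>2 k (k - 1)\<close>.
\<close>
lemma alternate_form_deriv_R:
  assumes om2: "\<And>x y. x \<in> V \<Longrightarrow> y \<in> V \<Longrightarrow> \<omega> [x, y] = omega_val x y" "\<And>us. length us \<noteq> 2 \<Longrightarrow> \<omega> us = 0"
    and "antihol_on V I \<alpha>" "set vs \<subseteq> V"
  shows "alternate (\<lambda>x us. \<Sum>e\<in>B. form_deriv (R x e) (int_prod e \<alpha>) us) vs
    = 2 * of_nat (length vs) * (of_nat (length vs) - 1) * \<alpha> vs + 4 * wedge \<omega> (omega_trace \<alpha>) vs"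
  using assms(3,4)
proof (induction vs arbitrary: \<alpha>)
  case Nil
  then show ?case by (simp add: om2(2))
next
  case (Cons v vs)
  let ?k = "of_nat (length vs) :: complex"
  have v: "v \<in> V" and vs: "set vs \<subseteq> V" using Cons.prems by auto
  note a = Cons.prems(1)
  note a_ins = antihol_on_int_prod[OF a _ V I_in]
  have first: "(\<Sum>e\<in>B. form_deriv (R v e) (int_prod e \<alpha>) vs) = alternate (\<lambda>x us. \<Sum>e\<in>B. \<alpha> (e # R v e x # us)) vs"
    unfolding alternate_sum
    by (intro sum.cong refl, subst form_deriv_alternate[OF V I_in a_ins])
       (auto simp: B_in vs v R_in int_prod_def)
  have "alternate (\<lambda>x. int_prod v (\<lambda>us. \<Sum>e\<in>B. form_deriv (R x e) (int_prod e \<alpha>) us)) vs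
      = alternate (\<lambda>x us. (\<Sum>e\<in>B. \<alpha> (e # R x e v # us)) - (\<Sum>e\<in>B. form_deriv (R x e) (int_prod e (int_prod v \<alpha>)) us)) vs"
  proof (rule alternate_cong[OF vs])
    fix x us assume x: "x \<in> V" and us: "set us \<subseteq> V"
    have "form_deriv (R x e) (int_prod e \<alpha>) (v # us) = \<alpha> (e # R x e v # us) - form_deriv (R x e) (int_prod e (int_prod v \<alpha>)) us"
      if "e \<in> B" for e
    proof -
      have e: "e \<in> V" using that by (rule B_in)
      have "form_deriv (R x e) (int_prod v (int_prod e \<alpha>)) us = form_deriv (R x e) (\<lambda>us. - int_prod e (int_prod v \<alpha>) us) us"
      proof (rule form_deriv_cong[OF us])
        fix us' assume "set us' \<subseteq> V"
        then show "int_prod v (int_prod e \<alpha>) us' = - int_prod e (int_prod v \<alpha>) us'"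
          using antihol_on_swap0[OF a e v, of us'] by (simp add: int_prod_def)
      qed (simp add: R_in x e)
      then show ?thesis by (simp add: form_deriv_minus) (simp add: int_prod_def)
    qed
    then show "int_prod v (\<lambda>us. \<Sum>e\<in>B. form_deriv (R x e) (int_prod e \<alpha>) us) us
      = (\<Sum>e\<in>B. \<alpha> (e # R x e v # us)) - (\<Sum>e\<in>B. form_deriv (R x e) (int_prod e (int_prod v \<alpha>)) us)"
      by (simp add: int_prod_def[of v "\<lambda>us. \<Sum>e\<in>B. form_deriv (R x e) (int_prod e \<alpha>) us"] sum_subtractf cong: sum.cong)
  qed
  then have "alternate (\<lambda>x us. \<Sum>e\<in>B. form_deriv (R x e) (int_prod e \<alpha>) us) (v # vs)
      = alternate (\<lambda>x us. (\<Sum>e\<in>B. \<alpha> (e # R v e x # us)) - (\<Sum>e\<in>B. \<alpha> (e # R x e v # us))) vs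
        + alternate (\<lambda>x us. \<Sum>e\<in>B. form_deriv (R x e) (int_prod e (int_prod v \<alpha>)) us) vs"
    by (simp add: first alternate_diff)
  also have "alternate (\<lambda>x us. (\<Sum>e\<in>B. \<alpha> (e # R v e x # us)) - (\<Sum>e\<in>B. \<alpha> (e # R x e v # us))) vs
      = alternate (\<lambda>x us. 4 * (int_prod x (int_prod v \<alpha>) us + int_prod v \<omega> [x] * omega_trace \<alpha> us)) vs"
  proof (rule alternate_cong[OF vs])
    fix x us assume x: "x \<in> V" and us: "set us \<subseteq> V"
    show "(\<Sum>e\<in>B. \<alpha> (e # R v e x # us)) - (\<Sum>e\<in>B. \<alpha> (e # R x e v # us))
       = 4 * (int_prod x (int_prod v \<alpha>) us + int_prod v \<omega> [x] * omega_trace \<alpha> us)"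
      unfolding int_prod_def omega_trace_def om2(1)[OF v x]
    proof (rule contracted_cyclic[OF _ _ _ _ _ v x])
      fix y assume y: "y \<in> V"
      show "clin V (\<lambda>x. \<alpha> (x # y # us))"
        using antihol_on_clin[OF V I_in a, of "y # us"] us y by auto
      show "clin V (\<lambda>x. \<alpha> (y # x # us))"
        using antihol_on_clin2[OF V I_in a y us] by auto
    next
      fix x y assume xy: "x \<in> V" "y \<in> V"
      show 1: "\<alpha> (y # x # us) = - \<alpha> (x # y # us)" using antihol_on_swap0[OF a xy(2,1) us] .
      show "\<alpha> (I x # y # us) = \<i> * \<alpha> (x # y # us)" using antihol_on_type[OF a xy(1), of "y # us"] xy us by auto
      show "\<alpha> (x # I y # us) = \<i> * \<alpha> (x # y # us)"
        using antihol_on_type[OF a_ins xy(2) us] xy by (simp add: int_prod_def)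
    qed
  qed
  also have "\<dots> = 4 * (?k * \<alpha> (v # vs)) + 4 * wedge (int_prod v \<omega>) (omega_trace \<alpha>) vs"
  proof -
    have "wedge (int_prod v \<omega>) (omega_trace \<alpha>) vs = alternate (\<lambda>x us. int_prod v \<omega> [x] * omega_trace \<alpha> us) vs"
      by (rule wedge_one_form) (simp add: int_prod_def om2(2))
    moreover have "alternate (\<lambda>x. int_prod x (int_prod v \<alpha>)) vs = ?k * \<alpha> (v # vs)"
      using alternate_int_prod[OF V I_in a_ins[OF v] vs] by (simp add: int_prod_def)
    ultimately show ?thesis unfolding alternate_scale alternate_add by (simp add: algebra_simps)
  qed
  also have "alternate (\<lambda>x us. \<Sum>e\<in>B. form_deriv (R x e) (int_prod e (int_prod v \<alpha>)) us) vs
      = 2 * ?k * (?k - 1) * \<alpha> (v # vs) + 4 * wedge \<omega> (omega_trace (int_prod v \<alpha>)) vs"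
    using Cons.IH[OF a_ins[OF v] vs] by (simp add: int_prod_def)
  also have "wedge \<omega> (omega_trace (int_prod v \<alpha>)) vs = wedge (parity \<omega>) (int_prod v (omega_trace \<alpha>)) vs"
  proof (rule wedge_cong)
    fix us show "\<omega> us = parity \<omega> us" using om2(2)[of us] by (cases "length us = 2") (simp_all add: parity_def)
  next
    fix us assume "set us \<subseteq> set vs"
    then have us: "set us \<subseteq> V" using vs by auto
    have "\<alpha> (v # e # J e # us) = \<alpha> (e # J e # v # us)" if "e \<in> B" for e
      using antihol_on_swap0[OF a v, of e "J e # us"] antihol_on_swap[OF a, of "[e]" v "J e" us] that us v
      by (auto simp: B_in V_in)
    then show "omega_trace (int_prod v \<alpha>) us = int_prod v (omega_trace \<alpha>) us" by (simp add: omega_trace_def int_prod_def)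
  qed
  finally show ?case by (simp add: wedge_Cons algebra_simps)
qed

text \<open>
  Invariance under \<open>R x e\<close>, evaluated with \<open>e\<close> also as first argument, turns the derivation of the interior product into
  minus the Ricci term. Summed over \<open>e\<close> and alternated, this computes the left side of the preceding lemma a second
  time, and comparing the two gives the identity.
\<close>
lemma invariant_form_eq_wedge:
  assumes om2: "\<And>x y. x \<in> V \<Longrightarrow> y \<in> V \<Longrightarrow> \<omega> [x, y] = omega_val x y" "\<And>us. length us \<noteq> 2 \<Longrightarrow> \<omega> us = 0"
    and a: "antihol_on V I \<alpha>" and vs: "set vs \<subseteq> V"
    and inv: "\<And>x y us. x \<in> V \<Longrightarrow> y \<in> V \<Longrightarrow> set us \<subseteq> V \<Longrightarrow> form_deriv (R x y) \<alpha> us = 0"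
  shows "4 * wedge \<omega> (omega_trace \<alpha>) vs
    = of_nat (length vs) * (of_nat (card B) + 4 - 2 * of_nat (length vs)) * \<alpha> vs"
proof -
  have "alternate (\<lambda>x us. \<Sum>e\<in>B. form_deriv (R x e) (int_prod e \<alpha>) us) vs
      = alternate (\<lambda>x us. (of_nat (card B) + 2) * int_prod x \<alpha> us) vs"
  proof (rule alternate_cong[OF vs])
    fix x us assume x: "x \<in> V" and us: "set us \<subseteq> V"
    have "form_deriv (R x e) (int_prod e \<alpha>) us = - \<alpha> (R x e e # us)" if "e \<in> B" for e
      using inv[of x e "e # us"] x us B_in[OF that] by (simp add: add_eq_0_iff)
    then have "(\<Sum>e\<in>B. form_deriv (R x e) (int_prod e \<alpha>) us) = - (\<Sum>e\<in>B. \<alpha> (R x e e # us))"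
      by (simp add: sum_negf)
    also have "(\<Sum>e\<in>B. \<alpha> (R x e e # us)) = - (of_nat (card B) + 2) * \<alpha> (x # us)"
      by (rule ricci[OF antihol_on_clin[OF V I_in a us] _ x]) (simp_all add: antihol_on_type[OF a _ us])
    finally show "(\<Sum>e\<in>B. form_deriv (R x e) (int_prod e \<alpha>) us) = (of_nat (card B) + 2) * int_prod x \<alpha> us"
      by (simp add: int_prod_def) (simp add: algebra_simps)
  qed
  also have "\<dots> = (of_nat (card B) + 2) * (of_nat (length vs) * \<alpha> vs)"
    using alternate_scale[of _ "\<lambda>x. int_prod x \<alpha>" vs] alternate_int_prod[OF V I_in a vs] by simp
  finally show ?thesis
    using alternate_form_deriv_R[OF om2 a vs] by algebra
qed

end

section \<open>Diagonalising quaternionic isometries\<close>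
lemma linear_relation_seq:
  fixes f :: "nat \<Rightarrow> 'a::euclidean_space"
  obtains c where "\<exists>i\<le>DIM('a). c i \<noteq> 0" "(\<Sum>i\<le>DIM('a). c i *\<^sub>R f i) = 0"
proof (cases "inj_on f {..DIM('a)}")
  case True
  then have "card (f ` {..DIM('a)}) = Suc DIM('a)" by (simp add: card_image)
  then have "dependent (f ` {..DIM('a)})" by (intro dependent_biggerset) auto
  then obtain u where u: "\<exists>v\<in>f ` {..DIM('a)}. u v \<noteq> 0" "(\<Sum>v\<in>f ` {..DIM('a)}. u v *\<^sub>R v) = 0"
    by (auto simp: dependent_finite)
  show thesis using u True by (intro that[of "\<lambda>i. u (f i)"]) (auto simp: sum.reindex)
next
  case False
  then obtain i j where ij: "i \<le> DIM('a)" "j \<le> DIM('a)" "i \<noteq> j" "f i = f j"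
    by (auto simp: inj_on_def)
  let ?c = "\<lambda>k. if k = i then 1 else if k = j then - 1 else (0::real)"
  have "(\<Sum>k\<le>DIM('a). ?c k *\<^sub>R f k) = (\<Sum>k\<in>{i,j}. ?c k *\<^sub>R f k)"
    using ij by (intro sum.mono_neutral_right) auto
  also have "\<dots> = 0" using ij by simp
  finally show thesis using ij by (intro that[of ?c]) auto
qed

context quat_space
begin

text \<open>
  \<open>V\<close> as a complex vector space with \<open>I\<close> as imaginary unit.
\<close>
definition cact :: "complex \<Rightarrow> 'a \<Rightarrow> 'a" where
  "cact z x = Re z *\<^sub>R x + Im z *\<^sub>R I x"

lemma cact_in: "subspace W \<Longrightarrow> (\<And>x. x \<in> W \<Longrightarrow> I x \<in> W) \<Longrightarrow> x \<in> W \<Longrightarrow> cact z x \<in> W"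
  by (simp add: cact_def subspace_add subspace_scale)

lemma cact_mult: "x \<in> V \<Longrightarrow> cact z (cact w x) = cact (z * w) x"
  by (simp add: cact_def rlin_add[OF V I_lin] rlin_scale[OF V I_lin] V_in II algebra_simps)

lemma cact_diff: "cact (z - w) x = cact z x - cact w x"
  by (simp add: cact_def algebra_simps)

lemma rlin_cact: "rlin V (cact z)"
  by (simp add: rlin_def cact_def rlinD[OF I_lin] algebra_simps)

end

text \<open>
  Among the complex polynomials in \<open>A\<close> that kill some nonzero vector of \<open>W\<close>, one of least degree has a root \<open>z\<close>; its
  cofactor, applied to that vector, is nonzero by minimality and is an eigenvector for \<open>z\<close>.
\<close>
lemma (in quat_space) eigenvector:
  fixes A :: "'a \<Rightarrow> 'a"
  assumes W: "subspace W" "W \<subseteq> V" "W \<noteq> {0}" and WI: "\<And>x. x \<in> W \<Longrightarrow> I x \<in> W"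
    and WA: "\<And>x. x \<in> W \<Longrightarrow> A x \<in> W"
    and A: "rlin W A" and AI: "\<And>x. x \<in> W \<Longrightarrow> A (I x) = I (A x)"
  obtains v a b where "v \<in> W" "v \<noteq> 0" "A v = a *\<^sub>R v + b *\<^sub>R I v"
proof -
  obtain x where x: "x \<in> W" "x \<noteq> 0" using W subspace_0[OF W(1)] by blast
  have pow: "(A ^^ i) v \<in> W" if "v \<in> W" for i v using that by (induction i) (auto intro: WA)
  have cW: "cact z v \<in> W" if "v \<in> W" for z v using that cact_in W(1) WI by blast
  define pact where "pact p v = (\<Sum>i\<le>degree p. cact (coeff p i) ((A ^^ i) v))" for p v
  have pactW: "pact p v \<in> W" if "v \<in> W" for p v
    unfolding pact_def using that by (intro subspace_sum W) (auto intro: cW pow)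
  have pact: "pact p v = (\<Sum>i\<le>n. cact (coeff p i) ((A ^^ i) v))" if "degree p \<le> n" for p v n
    unfolding pact_def using that
    by (intro sum.mono_neutral_left) (auto simp: cact_def coeff_eq_0)
  \<comment> \<open>A linear relation between the first \<open>DIM + 1\<close> iterates of a vector yields such a polynomial.\<close>
  define D where "D = DIM('a)"
  obtain c where c: "\<exists>i\<le>D. c i \<noteq> 0" "(\<Sum>i\<le>D. c i *\<^sub>R (A ^^ i) x) = 0"
    using linear_relation_seq[of "\<lambda>i. (A ^^ i) x"] unfolding D_def by blast
  define p where "p = (\<Sum>i\<le>D. monom (complex_of_real (c i)) i)"
  have cp: "coeff p k = (if k \<le> D then of_real (c k) else 0)" for k
    by (auto simp: p_def coeff_sum)
  have p0: "p \<noteq> 0"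
  proof
    assume "p = 0"
    then have "coeff p k = 0" for k by simp
    then show False using c(1) cp by (metis of_real_eq_0_iff)
  qed
  have dp: "degree p \<le> D" by (rule degree_le) (simp add: cp)
  have "pact p x = (\<Sum>i\<le>D. c i *\<^sub>R (A ^^ i) x)"
    unfolding pact[OF dp] by (intro sum.cong refl) (simp add: cp cact_def)
  then have pp: "pact p x = 0" using c(2) by simp
  define Q where "Q n = (\<exists>p v. p \<noteq> 0 \<and> v \<in> W \<and> v \<noteq> 0 \<and> pact p v = 0 \<and> degree p = n)" for n
  have "Q (degree p)" unfolding Q_def using p0 pp x by blast
  then obtain n where n: "Q n" "\<And>m. m < n \<Longrightarrow> \<not> Q m"
    using exists_least_iff[of Q] by blast
  then obtain p v where pv: "p \<noteq> 0" "v \<in> W" "v \<noteq> 0" "pact p v = 0" "degree p = n"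
    unfolding Q_def by blast
  have vV: "v \<in> V" using pv W by auto
  have "n \<noteq> 0"
  proof
    assume "n = 0"
    then obtain d where d: "p = [:d:]" using pv(5) by (metis degree_eq_zeroE)
    then have "cact d v = 0" using pv(4) by (simp add: pact_def)
    then have "cact (1 / d) (cact d v) = 0" by (simp add: cact_def rlin_0[OF V I_lin])
    then show False using d pv vV by (simp add: cact_mult) (simp add: cact_def)
  qed
  then have "\<not> constant (poly p)" using pv(5) by (simp add: constant_degree)
  then obtain z where "poly p z = 0" using fundamental_theorem_of_algebra by blast
  then obtain q where q: "p = [:- z, 1:] * q" by (auto simp: poly_eq_0_iff_dvd)
  then have q0: "q \<noteq> 0" using pv(1) by auto
  have dq: "degree p = Suc (degree q)" unfolding q using q0 by (subst degree_mult_eq) auto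
  define w where "w = pact q v"
  have wW: "w \<in> W" unfolding w_def using pv pactW by blast
  have "w \<noteq> 0"
  proof
    assume "w = 0"
    then have "Q (degree q)" unfolding Q_def w_def using q0 pv by blast
    then show False using n(2)[of "degree q"] dq pv by simp
  qed
  moreover have "A w = cact z w"
  proof -
    let ?t = "\<lambda>i. cact (coeff q i) ((A ^^ i) v)"
    have A_cact: "A (cact d u) = cact d (A u)" if "u \<in> W" for d u
      using that WI AI by (simp add: cact_def rlinD[OF A])
    have cp: "coeff p i = (case i of 0 \<Rightarrow> 0 | Suc j \<Rightarrow> coeff q j) - z * coeff q i" for i
      by (simp add: q coeff_pCons)
    have "0 = (\<Sum>i\<le>Suc (degree q). cact (coeff p i) ((A ^^ i) v))"
      using pv(4) pact[of p "Suc (degree q)" v] dq by simp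
    also have "\<dots> = (\<Sum>i\<le>Suc (degree q). cact (case i of 0 \<Rightarrow> 0 | Suc j \<Rightarrow> coeff q j) ((A ^^ i) v))
        - (\<Sum>i\<le>Suc (degree q). cact (z * coeff q i) ((A ^^ i) v))"
      unfolding cp cact_diff sum_subtractf ..
    also have "(\<Sum>i\<le>Suc (degree q). cact (case i of 0 \<Rightarrow> 0 | Suc j \<Rightarrow> coeff q j) ((A ^^ i) v))
        = (\<Sum>i\<le>degree q. A (?t i))"
      unfolding sum.atMost_Suc_shift using pv by (simp add: A_cact pow) (simp add: cact_def)
    also have "\<dots> = A w"
      unfolding w_def pact_def using pv by (intro rlin_sum[OF W(1) A, symmetric] cW pow)
    also have "(\<Sum>i\<le>Suc (degree q). cact (z * coeff q i) ((A ^^ i) v))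
       = (\<Sum>i\<le>Suc (degree q). cact z (?t i))"
      using pow[OF pv(2)] W(2) by (intro sum.cong refl cact_mult[symmetric]) auto
    also have "\<dots> = cact z (\<Sum>i\<le>Suc (degree q). ?t i)"
      using cW[OF pow[OF pv(2)]] W(2) by (intro rlin_sum[OF V rlin_cact, symmetric]) auto
    also have "(\<Sum>i\<le>Suc (degree q). ?t i) = w"
      unfolding w_def using pact[of q "Suc (degree q)"] by simp
    finally show ?thesis by simp
  qed
  ultimately show thesis using that[of w "Re z" "Im z"] wW by (simp add: cact_def)
qed

context quat_space
begin

lemmas g_add = rlin_add[OF V g_lin] and g_scale = rlin_scale[OF V g_lin]
  and g_diff = rlin_diff[OF V g_lin] and g_minus = rlin_minus[OF V g_lin]
  and g_add2 = rlin_add[OF V g_lin2] and g_scale2 = rlin_scale[OF V g_lin2]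
  and g_diff2 = rlin_diff[OF V g_lin2] and g_minus2 = rlin_minus[OF V g_lin2]
lemmas g_simps = g_add g_scale g_diff g_minus g_add2 g_scale2 g_diff2 g_minus2
lemmas I_simps = rlin_add[OF V I_lin] rlin_scale[OF V I_lin] rlin_diff[OF V I_lin] rlin_minus[OF V I_lin]
lemmas J_simps = rlin_add[OF V J_lin] rlin_scale[OF V J_lin] rlin_diff[OF V J_lin] rlin_minus[OF V J_lin]
lemmas K_simps = rlin_add[OF V K_lin] rlin_scale[OF V K_lin] rlin_diff[OF V K_lin] rlin_minus[OF V K_lin]

lemma g_self_skew:
  assumes x: "x \<in> V" shows "g x (I x) = 0" "g x (J x) = 0" "g x (K x) = 0"
    "g (I x) x = 0" "g (J x) x = 0" "g (K x) x = 0"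
  using x I_skew[OF x x] J_skew[OF x x] K_skew[OF x x]
    g_sym[of x "I x"] g_sym[of x "J x"] g_sym[of x "K x"] by (simp_all add: V_in)

definition qlin :: "('a \<Rightarrow> 'a) \<Rightarrow> bool" where
  "qlin A \<longleftrightarrow> rlin V A \<and> (\<forall>x\<in>V. A x \<in> V \<and> A (I x) = I (A x) \<and> A (J x) = J (A x))"

definition qisom :: "('a \<Rightarrow> 'a) \<Rightarrow> bool" where
  "qisom A \<longleftrightarrow> qlin A \<and> (\<forall>x\<in>V. \<forall>y\<in>V. g (A x) (A y) = g x y)"

lemma qlin_K: "qlin A \<Longrightarrow> x \<in> V \<Longrightarrow> A (K x) = K (A x)"
  by (simp add: qlin_def V_in flip: IJ)

definition qframe :: "'a set \<Rightarrow> 'a set \<Rightarrow> bool" where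
  "qframe W C \<longleftrightarrow> finite C \<and> C \<subseteq> W \<and>
     (\<forall>v\<in>C. \<forall>w\<in>C. g v w = (if v = w then 1 else 0) \<and> g v (I w) = 0 \<and> g v (J w) = 0 \<and> g v (K w) = 0) \<and>
     (\<forall>x\<in>W. x = (\<Sum>v\<in>C. g v x *\<^sub>R v + g (I v) x *\<^sub>R I v + g (J v) x *\<^sub>R J v + g (K v) x *\<^sub>R K v))"

end

context quat_space
begin

lemma qisom_eigen:
  assumes A: "qisom A" and W: "subspace W" "W \<subseteq> V" "W \<noteq> {0}"
    and WI: "\<And>x. x \<in> W \<Longrightarrow> I x \<in> W" and WA: "\<And>x. x \<in> W \<Longrightarrow> A x \<in> W"
  obtains v a b where "v \<in> W" "g v v = 1" "A v = a *\<^sub>R v + b *\<^sub>R I v" "a\<^sup>2 + b\<^sup>2 = 1"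
proof -
  have Al: "rlin V A" and AI: "\<And>x. x \<in> V \<Longrightarrow> A (I x) = I (A x)"
    and Ag: "\<And>x y. x \<in> V \<Longrightarrow> y \<in> V \<Longrightarrow> g (A x) (A y) = g x y"
    using A by (auto simp: qisom_def qlin_def)
  have AlW: "rlin W A" using Al W(2) by (auto simp: rlin_def)
  obtain u a b where u: "u \<in> W" "u \<noteq> 0" "A u = a *\<^sub>R u + b *\<^sub>R I u"
    using eigenvector[OF W WI WA AlW] AI W(2) by blast
  have uV: "u \<in> V" using u W by auto
  have pos: "g u u > 0" using g_pos[OF uV u(2)] .
  define r where "r = 1 / sqrt (g u u)"
  define v where "v = r *\<^sub>R u"
  have r2: "r * r * g u u = 1" using pos by (simp add: r_def)
  have v: "v \<in> W" unfolding v_def using u W by (simp add: subspace_scale)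
  have vV: "v \<in> V" using v W by auto
  have g1: "g v v = 1" using r2 uV by (simp add: v_def g_simps V_in)
  have Av: "A v = a *\<^sub>R v + b *\<^sub>R I v"
    using uV u(3) by (simp add: v_def rlin_scale[OF V Al] I_simps algebra_simps)
  have "g (A v) (A v) = a\<^sup>2 + b\<^sup>2"
    unfolding Av using vV g1
    by (simp add: g_simps V_in g_self_skew I_skew II power2_eq_square)
  then have "a\<^sup>2 + b\<^sup>2 = 1" using Ag[OF vV vV] g1 by simp
  then show thesis using that v g1 Av by blast
qed

text \<open>
  The quaternionic line of a unit eigenvector is invariant under \<open>A\<close>, hence so is its orthogonal complement in \<open>W\<close>, to
  which induction on the dimension applies.
\<close>
lemma qframe_exists:
  assumes A: "qisom A" and W: "subspace W" "W \<subseteq> V"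
    and WI: "\<And>x. x \<in> W \<Longrightarrow> I x \<in> W" and WJ: "\<And>x. x \<in> W \<Longrightarrow> J x \<in> W" and WA: "\<And>x. x \<in> W \<Longrightarrow> A x \<in> W"
  shows "\<exists>C. qframe W C \<and> (\<forall>v\<in>C. \<exists>a b. a\<^sup>2 + b\<^sup>2 = 1 \<and> A v = a *\<^sub>R v + b *\<^sub>R I v)"
  using W WI WJ WA
proof (induction "dim W" arbitrary: W rule: less_induct)
  case less
  have AI: "\<And>x. x \<in> V \<Longrightarrow> A (I x) = I (A x)" and AJ: "\<And>x. x \<in> V \<Longrightarrow> A (J x) = J (A x)"
    and Al: "rlin V A" and AV: "\<And>x. x \<in> V \<Longrightarrow> A x \<in> V"
    and Ag: "\<And>x y. x \<in> V \<Longrightarrow> y \<in> V \<Longrightarrow> g (A x) (A y) = g x y"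
    using A by (auto simp: qisom_def qlin_def)
  have AK: "\<And>x. x \<in> V \<Longrightarrow> A (K x) = K (A x)"
    using A by (simp add: qisom_def qlin_K)
  show ?case
  proof (cases "W = {0}")
    case True
    then show ?thesis by (intro exI[of _ "{}"]) (simp add: qframe_def)
  next
    case False
    obtain v a b where v: "v \<in> W" "g v v = 1" "A v = a *\<^sub>R v + b *\<^sub>R I v" "a\<^sup>2 + b\<^sup>2 = 1"
      using qisom_eigen[OF A less.prems(1,2) False less.prems(3,5)] by blast
    have vV: "v \<in> V" using v less.prems by auto
    have WK: "K x \<in> W" if "x \<in> W" for x
    proof -
      have "x \<in> V" using that less.prems(2) by auto
      then have "I (J x) = K x" by (rule IJ)
      then show ?thesis using that less.prems(3,4) by metis
    qed
    define W' where "W' = {x \<in> W. g v x = 0 \<and> g (I v) x = 0 \<and> g (J v) x = 0 \<and> g (K v) x = 0}"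
    have W'V: "x \<in> V" if "x \<in> W'" for x using that less.prems(2) by (auto simp: W'_def)
    have sub: "subspace W'"
      unfolding W'_def using less.prems(1,2) vV
      by (intro subspaceI) (auto simp: subspace_0 subspace_add subspace_scale g_simps V_in
          rlin_0[OF V g_lin2] subset_iff)
    have vW': "v \<notin> W'" using v by (simp add: W'_def)
    have "W' \<subseteq> W" by (auto simp: W'_def)
    then have psub: "W' \<subset> W" using v(1) vW' by blast
    then have "dim W' < dim W"
      using sub less.prems(1) by (intro dim_psubset) (simp add: span_eq_iff[THEN iffD2])
    moreover have "I x \<in> W'" if x: "x \<in> W'" for x
    proof -
      have e: "g u (I x) = - g (I u) x" if "u \<in> V" for u using I_skew[OF that W'V[OF x]] by simp
      show ?thesis using x vV less.prems(3) W'V[OF x]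
        by (simp add: W'_def e V_in II IJ K_mult g_simps)
    qed
    moreover have "J x \<in> W'" if x: "x \<in> W'" for x
    proof -
      have e: "g u (J x) = - g (J u) x" if "u \<in> V" for u using J_skew[OF that W'V[OF x]] by simp
      show ?thesis using x vV less.prems(4) W'V[OF x]
        by (simp add: W'_def e V_in JJ JI K_mult g_simps)
    qed
    moreover have "A x \<in> W'" if x: "x \<in> W'" for x
    proof -
      \<comment> \<open>The preimage of \<open>v\<close>; with it \<open>A\<close> can be moved off the right argument of the metric.\<close>
      let ?u = "a *\<^sub>R v - b *\<^sub>R I v"
      have "A ?u = (a\<^sup>2 + b\<^sup>2) *\<^sub>R v"
        using vV by (simp add: rlin_diff[OF V Al] rlin_scale[OF V Al] AI v(3) V_in I_simps II
            algebra_simps power2_eq_square)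
      then have Au: "A ?u = v" using v(4) by simp
      have uV: "?u \<in> V" using vV by (simp add: V_in)
      have xV: "x \<in> V" using W'V[OF x] .
      have "g v (A x) = g ?u x" using Ag[OF uV xV] Au by simp
      moreover have "g (I v) (A x) = g (I ?u) x"
        using Ag[OF I_in[OF uV] xV] AI[OF uV] Au by simp
      moreover have "g (J v) (A x) = g (J ?u) x"
        using Ag[OF J_in[OF uV] xV] AJ[OF uV] Au by simp
      moreover have "g (K v) (A x) = g (K ?u) x"
        using Ag[OF K_in[OF uV] xV] AK[OF uV] Au by simp
      ultimately show ?thesis using x vV xV less.prems(5)
        by (simp add: W'_def V_in II JI K_mult g_simps I_simps J_simps K_simps)
    qed
    moreover have "W' \<subseteq> V" using W'V by auto
    ultimately obtain C where C: "qframe W' C" "\<forall>v\<in>C. \<exists>a b. a\<^sup>2 + b\<^sup>2 = 1 \<and> A v = a *\<^sub>R v + b *\<^sub>R I v"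
      using less.hyps[OF _ sub] by blast
    have CW: "C \<subseteq> W'" and Cfin: "finite C" using C(1) by (auto simp: qframe_def)
    have vC: "v \<notin> C" using CW vW' by auto
    have CV: "w \<in> V" if "w \<in> C" for w using that CW W'V by auto
    have orth: "g v w = 0" "g (I v) w = 0" "g (J v) w = 0" "g (K v) w = 0" if "w \<in> C" for w
      using that CW by (auto simp: W'_def)
    have orth2: "g w v = 0" "g w (I v) = 0" "g w (J v) = 0" "g w (K v) = 0"
      "g v (I w) = 0" "g v (J w) = 0" "g v (K w) = 0"
      "g (I w) v = 0" "g (J w) v = 0" "g (K w) v = 0" if "w \<in> C" for w
      using orth[OF that] CV[OF that] vV g_sym[of w v] g_sym[of w "I v"] g_sym[of w "J v"] g_sym[of w "K v"]
        I_skew[of v w] J_skew[of v w] K_skew[of v w] I_skew[of w v] J_skew[of w v] K_skew[of w v]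
      by (simp_all add: V_in)
    have aux: "p = q + r" if "p - q = r" for p q r :: 'a using that by auto
    have "qframe W (insert v C)"
      unfolding qframe_def
    proof (intro conjI ballI)
      fix x assume x: "x \<in> W"
      then have xV: "x \<in> V" using less.prems(2) by auto
      let ?p = "g v x *\<^sub>R v + g (I v) x *\<^sub>R I v + g (J v) x *\<^sub>R J v + g (K v) x *\<^sub>R K v"
      have pW: "?p \<in> W" using v(1) less.prems WK by (simp add: subspace_add subspace_scale)
      then have pV: "?p \<in> V" using less.prems(2) by auto
      have gp: "g v ?p = g v x" "g (I v) ?p = g (I v) x" "g (J v) ?p = g (J v) x" "g (K v) ?p = g (K v) x"
        using vV v(2) by (simp_all add: g_simps V_in g_self_skew I_skew J_skew K_skew II JJ IJ JI K_mult)
      have x'W: "x - ?p \<in> W'" using x pW less.prems(1) vV xV pV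
        by (simp only: W'_def) (simp add: subspace_diff g_diff2 V_in gp)
      have "g w ?p = 0 \<and> g (I w) ?p = 0 \<and> g (J w) ?p = 0 \<and> g (K w) ?p = 0" if "w \<in> C" for w
        using orth2[OF that] CV[OF that] vV
        by (simp add: g_simps V_in I_skew J_skew K_skew II JJ IJ JI K_mult)
      then have gw: "g w (x - ?p) = g w x \<and> g (I w) (x - ?p) = g (I w) x \<and> g (J w) (x - ?p) = g (J w) x
          \<and> g (K w) (x - ?p) = g (K w) x" if "w \<in> C" for w
        using that CV[OF that] xV pV by (simp add: g_diff2 V_in)
      have "x - ?p = (\<Sum>w\<in>C. g w (x - ?p) *\<^sub>R w + g (I w) (x - ?p) *\<^sub>R I w + g (J w) (x - ?p) *\<^sub>R J w + g (K w) (x - ?p) *\<^sub>R K w)"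
        using C(1) x'W unfolding qframe_def by blast
      also have "\<dots> = (\<Sum>w\<in>C. g w x *\<^sub>R w + g (I w) x *\<^sub>R I w + g (J w) x *\<^sub>R J w + g (K w) x *\<^sub>R K w)"
        by (intro sum.cong refl) (simp only: gw)
      finally have "x = ?p + (\<Sum>w\<in>C. g w x *\<^sub>R w + g (I w) x *\<^sub>R I w + g (J w) x *\<^sub>R J w + g (K w) x *\<^sub>R K w)"
        by (rule aux)
      then show "x = (\<Sum>w\<in>insert v C. g w x *\<^sub>R w + g (I w) x *\<^sub>R I w + g (J w) x *\<^sub>R J w + g (K w) x *\<^sub>R K w)"
        unfolding sum.insert[OF Cfin vC] .
    next
      fix u w assume "u \<in> insert v C" "w \<in> insert v C"
      then consider "u = v" "w = v" | "u = v" "w \<in> C" | "u \<in> C" "w = v" | "u \<in> C" "w \<in> C" by auto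
      then have "g u w = (if u = w then 1 else 0) \<and> g u (I w) = 0 \<and> g u (J w) = 0 \<and> g u (K w) = 0"
      proof cases
        case 1 then show ?thesis using v(2) vV by (simp add: g_self_skew)
      next
        case 2 then show ?thesis using vC orth[OF 2(2)] orth2[OF 2(2)] by auto
      next
        case 3 then show ?thesis using vC orth2[OF 3(1)] by auto
      next
        case 4 then show ?thesis using C(1) unfolding qframe_def by blast
      qed
      then show "g u w = (if u = w then 1 else 0)" "g u (I w) = 0" "g u (J w) = 0" "g u (K w) = 0"
        by blast+
    qed (use Cfin v(1) CW in \<open>auto simp: W'_def\<close>)
    moreover have "\<forall>w\<in>insert v C. \<exists>a b. a\<^sup>2 + b\<^sup>2 = 1 \<and> A w = a *\<^sub>R w + b *\<^sub>R I w"
      using C(2) v by blast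
    ultimately show ?thesis by blast
  qed
qed

end

context quat_space
begin

definition frame_map :: "'a set \<Rightarrow> ('a \<Rightarrow> 'a) \<Rightarrow> 'a \<Rightarrow> 'a" where
  "frame_map C y x = (\<Sum>v\<in>C. g v x *\<^sub>R y v + g (I v) x *\<^sub>R I (y v) + g (J v) x *\<^sub>R J (y v) + g (K v) x *\<^sub>R K (y v))"

lemma qlin_eq_on_frame:
  assumes C: "qframe V C" and F: "qlin F" and G: "qlin G"
    and eq: "\<And>v. v \<in> C \<Longrightarrow> F v = G v" and x: "x \<in> V"
  shows "F x = G x"
proof -
  have CV: "v \<in> V" if "v \<in> C" for v using C that by (auto simp: qframe_def)
  have ex: "H x = (\<Sum>v\<in>C. g v x *\<^sub>R H v + g (I v) x *\<^sub>R I (H v) + g (J v) x *\<^sub>R J (H v) + g (K v) x *\<^sub>R K (H v))"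
    if H: "qlin H" for H
  proof -
    have Hl: "rlin V H" using H by (simp add: qlin_def)
    have "H x = H (\<Sum>v\<in>C. g v x *\<^sub>R v + g (I v) x *\<^sub>R I v + g (J v) x *\<^sub>R J v + g (K v) x *\<^sub>R K v)"
      using C x by (simp add: qframe_def)
    also have "\<dots> = (\<Sum>v\<in>C. H (g v x *\<^sub>R v + g (I v) x *\<^sub>R I v + g (J v) x *\<^sub>R J v + g (K v) x *\<^sub>R K v))"
      by (rule rlin_sum[OF V Hl]) (simp add: CV V_in)
    also have "\<dots> = (\<Sum>v\<in>C. g v x *\<^sub>R H v + g (I v) x *\<^sub>R I (H v) + g (J v) x *\<^sub>R J (H v) + g (K v) x *\<^sub>R K (H v))"
    proof (intro sum.cong refl)
      fix v assume "v \<in> C"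
      then have v: "v \<in> V" by (rule CV)
      then have "H (I v) = I (H v)" "H (J v) = J (H v)" "H (K v) = K (H v)"
        using H qlin_K[OF H v] by (auto simp: qlin_def)
      then show "H (g v x *\<^sub>R v + g (I v) x *\<^sub>R I v + g (J v) x *\<^sub>R J v + g (K v) x *\<^sub>R K v)
          = g v x *\<^sub>R H v + g (I v) x *\<^sub>R I (H v) + g (J v) x *\<^sub>R J (H v) + g (K v) x *\<^sub>R K (H v)"
        using v by (simp add: rlin_add[OF V Hl] rlin_scale[OF V Hl] V_in)
    qed
    finally show ?thesis .
  qed
  show ?thesis unfolding ex[OF F] ex[OF G] by (intro sum.cong refl) (simp add: eq)
qed

context
  fixes C :: "'a set" and y :: "'a \<Rightarrow> 'a"
  assumes C: "qframe V C" and yV: "\<And>v. v \<in> C \<Longrightarrow> y v \<in> V"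
begin

lemma CV: "v \<in> C \<Longrightarrow> v \<in> V" and Cfin: "finite C"
  using C by (auto simp: qframe_def)

lemma frame_map_in: "frame_map C y x \<in> V"
  unfolding frame_map_def by (intro subspace_sum V) (simp add: V_in yV)

lemma qlin_frame_map: "qlin (frame_map C y)"
  unfolding qlin_def
proof (intro conjI ballI)
  show "rlin V (frame_map C y)"
    unfolding rlin_def frame_map_def
    by (simp add: g_simps V_in CV scaleR_sum_right sum.distrib[symmetric] algebra_simps cong: sum.cong)
next
  fix x assume x: "x \<in> V"
  show "frame_map C y x \<in> V" by (rule frame_map_in)
  have sk: "g v (I x) = - g (I v) x" "g v (J x) = - g (J v) x" if "v \<in> V" for v
    using that x by (simp_all add: I_skew J_skew)
  have "I (frame_map C y x) = (\<Sum>v\<in>C. I (g v x *\<^sub>R y v + g (I v) x *\<^sub>R I (y v) + g (J v) x *\<^sub>R J (y v) + g (K v) x *\<^sub>R K (y v)))"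
    unfolding frame_map_def by (rule rlin_sum[OF V I_lin]) (simp add: V_in yV)
  also have "\<dots> = frame_map C y (I x)"
    unfolding frame_map_def using x
    by (intro sum.cong refl) (simp add: I_simps V_in yV CV sk II IJ K_mult g_simps)
  finally show "frame_map C y (I x) = I (frame_map C y x)" ..
  have "J (frame_map C y x) = (\<Sum>v\<in>C. J (g v x *\<^sub>R y v + g (I v) x *\<^sub>R I (y v) + g (J v) x *\<^sub>R J (y v) + g (K v) x *\<^sub>R K (y v)))"
    unfolding frame_map_def by (rule rlin_sum[OF V J_lin]) (simp add: V_in yV)
  also have "\<dots> = frame_map C y (J x)"
    unfolding frame_map_def using x
    by (intro sum.cong refl) (simp add: J_simps V_in yV CV sk JJ JI K_mult g_simps)
  finally show "frame_map C y (J x) = J (frame_map C y x)" ..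
qed

lemma frame_map_frame:
  assumes v: "v \<in> C" shows "frame_map C y v = y v"
proof -
  have "frame_map C y v = (\<Sum>w\<in>C. (if w = v then y w else 0))"
    unfolding frame_map_def
  proof (intro sum.cong refl)
    fix w assume w: "w \<in> C"
    have "g w v = (if w = v then 1 else 0)" "g w (I v) = 0" "g w (J v) = 0" "g w (K v) = 0"
      using C v w by (simp_all add: qframe_def)
    then show "g w v *\<^sub>R y w + g (I w) v *\<^sub>R I (y w) + g (J w) v *\<^sub>R J (y w) + g (K w) v *\<^sub>R K (y w)
       = (if w = v then y w else 0)"
      using I_skew[OF CV[OF w] CV[OF v]] J_skew[OF CV[OF w] CV[OF v]] K_skew[OF CV[OF w] CV[OF v]] by simp
  qed
  then show ?thesis using v Cfin by simp
qed

lemma qisom_frame_map: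
  assumes orth: "\<And>v w. v \<in> C \<Longrightarrow> w \<in> C \<Longrightarrow> g (y v) (y w) = (if v = w then 1 else 0) \<and>
     g (y v) (I (y w)) = 0 \<and> g (y v) (J (y w)) = 0 \<and> g (y v) (K (y w)) = 0"
  shows "qisom (frame_map C y)"
  unfolding qisom_def
proof (intro conjI ballI qlin_frame_map)
  let ?T = "frame_map C y"
  note q = qlin_frame_map
  have g0: "g (y w) (?T z) = g w z" if w: "w \<in> C" and z: "z \<in> V" for w z
  proof -
    have "g (y w) (?T z) = (\<Sum>v\<in>C. g (y w) (g v z *\<^sub>R y v + g (I v) z *\<^sub>R I (y v) + g (J v) z *\<^sub>R J (y v) + g (K v) z *\<^sub>R K (y v)))"
      unfolding frame_map_def by (rule rlin_sum[OF V g_lin2[OF yV[OF w]]]) (simp add: V_in yV)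
    also have "\<dots> = (\<Sum>v\<in>C. if v = w then g w z else 0)"
      using orth[OF w] w by (intro sum.cong refl) (auto simp: g_simps V_in yV)
    finally show ?thesis using w Cfin by simp
  qed
  have g1: "g (I (y w)) (?T z) = g (I w) z" "g (J (y w)) (?T z) = g (J w) z" "g (K (y w)) (?T z) = g (K w) z"
    if w: "w \<in> C" and z: "z \<in> V" for w z
    using g0[OF w, of "I z"] g0[OF w, of "J z"] g0[OF w, of "K z"] z w q qlin_K[OF q z]
    by (simp_all add: I_skew J_skew K_skew V_in yV CV frame_map_in qlin_def)
  fix x z assume x: "x \<in> V" and z: "z \<in> V"
  have "g (?T x) (?T z) = (\<Sum>v\<in>C. g (g v x *\<^sub>R y v + g (I v) x *\<^sub>R I (y v) + g (J v) x *\<^sub>R J (y v) + g (K v) x *\<^sub>R K (y v)) (?T z))"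
    unfolding frame_map_def[of C y x] by (rule rlin_sum[OF V g_lin[OF frame_map_in]]) (simp add: V_in yV)
  also have "\<dots> = (\<Sum>v\<in>C. g (g v x *\<^sub>R v + g (I v) x *\<^sub>R I v + g (J v) x *\<^sub>R J v + g (K v) x *\<^sub>R K v) z)"
    using z by (intro sum.cong refl) (simp add: g_simps V_in yV CV frame_map_in g0 g1)
  also have "\<dots> = g (\<Sum>v\<in>C. g v x *\<^sub>R v + g (I v) x *\<^sub>R I v + g (J v) x *\<^sub>R J v + g (K v) x *\<^sub>R K v) z"
    by (rule rlin_sum[OF V g_lin[OF z], symmetric]) (simp add: V_in CV)
  also have "(\<Sum>v\<in>C. g v x *\<^sub>R v + g (I v) x *\<^sub>R I v + g (J v) x *\<^sub>R J v + g (K v) x *\<^sub>R K v) = x"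
    using C x by (simp add: qframe_def)
  finally show "g (?T x) (?T z) = g x z" .
qed

end

lemma qlin_comp: "qlin F \<Longrightarrow> qlin G \<Longrightarrow> qlin (\<lambda>x. F (G x))"
  by (simp add: qlin_def rlin_def)

lemma qisom_rotation:
  assumes C: "qframe V C" and ab: "\<And>v. v \<in> C \<Longrightarrow> (a v)\<^sup>2 + (b v)\<^sup>2 = 1"
  shows "qisom (frame_map C (\<lambda>v. a v *\<^sub>R v + b v *\<^sub>R I v))"
proof (rule qisom_frame_map[OF C])
  have CV: "v \<in> V" if "v \<in> C" for v using C that by (auto simp: qframe_def)
  have o: "g v w = (if v = w then 1 else 0)" "g v (I w) = 0" "g v (J w) = 0" "g v (K w) = 0"
    if "v \<in> C" "w \<in> C" for v w using C that by (simp_all add: qframe_def)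
  show "a v *\<^sub>R v + b v *\<^sub>R I v \<in> V" if "v \<in> C" for v using CV[OF that] by (simp add: V_in)
  fix v w assume vw: "v \<in> C" "w \<in> C"
  show "g (a v *\<^sub>R v + b v *\<^sub>R I v) (a w *\<^sub>R w + b w *\<^sub>R I w) = (if v = w then 1 else 0) \<and>
    g (a v *\<^sub>R v + b v *\<^sub>R I v) (I (a w *\<^sub>R w + b w *\<^sub>R I w)) = 0 \<and>
    g (a v *\<^sub>R v + b v *\<^sub>R I v) (J (a w *\<^sub>R w + b w *\<^sub>R I w)) = 0 \<and>
    g (a v *\<^sub>R v + b v *\<^sub>R I v) (K (a w *\<^sub>R w + b w *\<^sub>R I w)) = 0"
    using vw CV[OF vw(1)] CV[OF vw(2)] ab[OF vw(1)] o[OF vw]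
    by (cases "v = w") (simp_all add: g_simps I_simps J_simps K_simps V_in I_skew II JJ IJ JI K_mult power2_eq_square)
qed

lemma qisom_J_frame:
  assumes C: "qframe V C"
  shows "qisom (frame_map C J)"
proof (rule qisom_frame_map[OF C])
  have CV: "v \<in> V" if "v \<in> C" for v using C that by (auto simp: qframe_def)
  have o: "g v w = (if v = w then 1 else 0)" "g v (I w) = 0" "g v (J w) = 0" "g v (K w) = 0"
    if "v \<in> C" "w \<in> C" for v w using C that by (simp_all add: qframe_def)
  show "J v \<in> V" if "v \<in> C" for v using CV[OF that] by (simp add: V_in)
  fix v w assume vw: "v \<in> C" "w \<in> C"
  show "g (J v) (J w) = (if v = w then 1 else 0) \<and> g (J v) (I (J w)) = 0 \<and> g (J v) (J (J w)) = 0 \<and> g (J v) (K (J w)) = 0"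
    using vw CV[OF vw(1)] CV[OF vw(2)] o[OF vw]
    by (simp add: g_simps V_in J_skew JJ IJ JI K_mult J_simps)
qed

lemma qframe_V: assumes "qisom A"
  obtains C a b where "qframe V C" "\<And>v. v \<in> C \<Longrightarrow> (a v)\<^sup>2 + (b v)\<^sup>2 = 1"
    "\<And>v. v \<in> C \<Longrightarrow> A v = a v *\<^sub>R v + b v *\<^sub>R I v"
proof -
  have "\<exists>C. qframe V C \<and> (\<forall>v\<in>C. \<exists>a b. a\<^sup>2 + b\<^sup>2 = 1 \<and> A v = a *\<^sub>R v + b *\<^sub>R I v)"
    using assms by (intro qframe_exists V) (auto simp: qisom_def qlin_def V_in)
  then show thesis using that by metis
qed

lemma qisom_inverse:
  assumes A: "qisom A"
  obtains A' where "qisom A'" "\<And>x. x \<in> V \<Longrightarrow> A (A' x) = x"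
proof -
  obtain C a b where C: "qframe V C" and ab: "\<And>v. v \<in> C \<Longrightarrow> (a v)\<^sup>2 + (b v)\<^sup>2 = 1"
    and Av: "\<And>v. v \<in> C \<Longrightarrow> A v = a v *\<^sub>R v + b v *\<^sub>R I v" using qframe_V[OF A] by metis
  have q: "qlin A" and Al: "rlin V A" and AI: "\<And>x. x \<in> V \<Longrightarrow> A (I x) = I (A x)"
    using A by (auto simp: qisom_def qlin_def)
  let ?A = "frame_map C (\<lambda>v. a v *\<^sub>R v + (- b v) *\<^sub>R I v)"
  have A': "qisom ?A" by (rule qisom_rotation[OF C]) (simp add: ab)
  then have q': "qlin ?A" by (simp add: qisom_def)
  have id: "qlin (\<lambda>x. x)" by (simp add: qlin_def rlin_def)
  have "A (?A x) = x" if x: "x \<in> V" for x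
  proof (rule qlin_eq_on_frame[OF C qlin_comp[OF q q'] id _ x])
    fix v assume v: "v \<in> C"
    then have vV: "v \<in> V" using C by (auto simp: qframe_def)
    have "?A v = a v *\<^sub>R v + (- b v) *\<^sub>R I v"
      using v C by (intro frame_map_frame[OF C]) (auto simp: qframe_def V_in)
    then have "A (?A v) = A (a v *\<^sub>R v - b v *\<^sub>R I v)" by simp
    also have "\<dots> = ((a v)\<^sup>2 + (b v)\<^sup>2) *\<^sub>R v"
      using vV Av[OF v] by (simp add: rlin_diff[OF V Al] rlin_scale[OF V Al] AI V_in I_simps II
            algebra_simps power2_eq_square)
    finally show "A (?A v) = v" using ab[OF v] by simp
  qed
  with A' show thesis using that by blast
qed

text \<open>
  On the quaternionic line of an eigenvector with angle \<open>t\<close>, let \<open>T\<close> be the rotation by \<open>t/2\<close> and \<open>S\<close> the map that sends the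
  eigenvector to its image under \<open>J\<close>. Conjugation by \<open>S\<close> inverts \<open>T\<close>, so \<open>T S T\<^sup>-\<^sup>1 S\<^sup>-\<^sup>1 = T\<^sup>2\<close> is the rotation by \<open>t\<close>.
  This is the half-angle form of writing a unit complex number as a commutator of unit quaternions.
\<close>
lemma qisom_commutator:
  assumes A: "qisom A"
  obtains S T where "qisom S" "qisom T" "\<And>x. x \<in> V \<Longrightarrow> A (S (T x)) = T (S x)"
proof -
  obtain C a b where C: "qframe V C" and ab: "\<And>v. v \<in> C \<Longrightarrow> (a v)\<^sup>2 + (b v)\<^sup>2 = 1"
    and Av: "\<And>v. v \<in> C \<Longrightarrow> A v = a v *\<^sub>R v + b v *\<^sub>R I v" using qframe_V[OF A] by metis
  have CV: "v \<in> V" if "v \<in> C" for v using C that by (auto simp: qframe_def)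
  have "\<exists>t. a v = cos t \<and> b v = sin t" if "v \<in> C" for v
    using sincos_total_2pi_le[OF ab[OF that]] by metis
  then obtain \<theta> where th: "\<And>v. v \<in> C \<Longrightarrow> a v = cos (\<theta> v) \<and> b v = sin (\<theta> v)" by metis
  define c s where "c v = cos (\<theta> v / 2)" and "s v = sin (\<theta> v / 2)" for v
  have cs: "(c v)\<^sup>2 + (s v)\<^sup>2 = 1" for v by (simp add: c_def s_def)
  have a2: "a v = (c v)\<^sup>2 - (s v)\<^sup>2" and b2: "b v = 2 * c v * s v" if "v \<in> C" for v
    using th[OF that] cos_double[of "\<theta> v / 2"] sin_double[of "\<theta> v / 2"] by (simp_all add: c_def s_def)
  let ?T = "frame_map C (\<lambda>v. c v *\<^sub>R v + s v *\<^sub>R I v)" and ?S = "frame_map C J"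
  have T: "qisom ?T" using cs by (rule qisom_rotation[OF C])
  have S: "qisom ?S" by (rule qisom_J_frame[OF C])
  have q: "qlin A" "qlin ?T" "qlin ?S" using A T S by (simp_all add: qisom_def)
  have l: "rlin V A" "rlin V ?T" "rlin V ?S" using q by (simp_all add: qlin_def)
  have "A (?S (?T x)) = ?T (?S x)" if x: "x \<in> V" for x
  proof (rule qlin_eq_on_frame[OF C qlin_comp[OF q(1) qlin_comp[OF q(3,2)]] qlin_comp[OF q(2,3)] _ x])
    fix v assume v: "v \<in> C"
    note vV = CV[OF v]
    have Tv: "?T v = c v *\<^sub>R v + s v *\<^sub>R I v"
      using v by (intro frame_map_frame[OF C]) (auto simp: CV V_in)
    have Sv: "?S v = J v" using v by (intro frame_map_frame[OF C]) (auto simp: CV V_in)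
    have S1: "?S (?T v) = c v *\<^sub>R J v + s v *\<^sub>R K v"
      using vV q(3) unfolding Tv
      by (simp add: rlin_add[OF V l(3)] rlin_scale[OF V l(3)] V_in qlin_def Sv IJ)
    have "A (?S (?T v)) = c v *\<^sub>R J (A v) + s v *\<^sub>R K (A v)"
      unfolding S1 using vV q(1) qlin_K[OF q(1) vV]
      by (simp add: rlin_add[OF V l(1)] rlin_scale[OF V l(1)] V_in qlin_def)
    also have "\<dots> = (c v * a v + s v * b v) *\<^sub>R J v + (s v * a v - c v * b v) *\<^sub>R K v"
      unfolding Av[OF v] using vV
      by (simp add: J_simps K_simps V_in JI K_mult algebra_simps)
    also have "c v * a v + s v * b v = ((c v)\<^sup>2 + (s v)\<^sup>2) * c v"
      unfolding a2[OF v] b2[OF v] by (simp add: algebra_simps power2_eq_square)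
    also have "s v * a v - c v * b v = - ((c v)\<^sup>2 + (s v)\<^sup>2) * s v"
      unfolding a2[OF v] b2[OF v] by (simp add: algebra_simps power2_eq_square)
    also have "(((c v)\<^sup>2 + (s v)\<^sup>2) * c v) *\<^sub>R J v + (- ((c v)\<^sup>2 + (s v)\<^sup>2) * s v) *\<^sub>R K v
       = J (?T v)"
      unfolding Tv cs using vV by (simp add: J_simps V_in JI)
    also have "\<dots> = ?T (?S v)" unfolding Sv using q(2) vV by (simp add: qlin_def)
    finally show "A (?S (?T v)) = ?T (?S v)" .
  qed
  with S T show thesis using that by blast
qed

end

section \<open>Brackets and traces of matrices\<close>
lemma matrix_add_rdistrib: "(B + C) ** A = B ** A + C ** (A :: real^'k^'k)"
  by (simp add: matrix_matrix_mult_def vec_eq_iff sum.distrib distrib_right)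

lemma matrix_diff_ldistrib: "A ** (B - C) = A ** B - A ** (C :: real^'k^'k)"
  and matrix_diff_rdistrib: "(B - C) ** A = B ** A - C ** (A :: real^'k^'k)"
  using matrix_add_ldistrib[of A "B - C" C] matrix_add_rdistrib[of "B - C" C A] by simp_all

lemma lie_bracket_add [simp]: "lie_bracket (X + Y) Z = lie_bracket X Z + lie_bracket Y Z"
    "lie_bracket X (Y + Z) = lie_bracket X Y + lie_bracket X Z"
  and lie_bracket_scale [simp]: "lie_bracket (a *\<^sub>R X) Z = a *\<^sub>R lie_bracket X Z"
    "lie_bracket X (a *\<^sub>R Z) = a *\<^sub>R lie_bracket X Z"
  and lie_bracket_self [simp]: "lie_bracket X X = 0"
  by (simp_all add: lie_bracket_def matrix_add_ldistrib matrix_add_rdistrib matrix_scalar_ac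
      scalar_matrix_assoc[symmetric] algebra_simps)

lemma lie_bracket_0 [simp]: "lie_bracket 0 X = 0" "lie_bracket X 0 = 0"
  by (simp_all add: lie_bracket_def)

lemma lie_bracket_minus [simp]: "lie_bracket (- X) Z = - lie_bracket X Z" "lie_bracket X (- Z) = - lie_bracket X Z"
  using lie_bracket_scale(1)[of "-1" X Z] lie_bracket_scale(2)[of X "-1" Z] by simp_all

lemma lie_bracket_skew: "lie_bracket Y X = - lie_bracket X Y"
  by (simp add: lie_bracket_def)

lemma lie_bracket_jacobi:
  "lie_bracket X (lie_bracket Y Z) = lie_bracket (lie_bracket X Y) Z + lie_bracket Y (lie_bracket X Z)"
  by (simp add: lie_bracket_def matrix_diff_ldistrib matrix_diff_rdistrib matrix_mul_assoc)

lemma rlin_lie_bracket: "rlin S (lie_bracket X)" "rlin S (\<lambda>X. lie_bracket X Y)"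
  by (simp_all add: rlin_def)

lemma trace_on_basis:
  fixes S :: "'a::euclidean_space set"
  assumes S: "subspace S"
  obtains B where "finite B" "independent B" "span B = S"
    "\<And>f. trace_on S f = (\<Sum>b\<in>B. representation B (f b) b)"
proof -
  obtain B0 where "B0 \<subseteq> S" "independent B0" "S \<subseteq> span B0"
    using maximal_independent_subset[of S] by blast
  then have "\<exists>B. independent B \<and> span B = S"
    using S by (metis span_minimal subset_antisym)
  then have B: "independent (SOME B. independent B \<and> span B = S) \<and> span (SOME B. independent B \<and> span B = S) = S"
    by (rule someI_ex)
  define B where "B = (SOME B. independent B \<and> span B = S)"
  show thesis
  proof (rule that[of B])
    show "independent B" "span B = S" using B unfolding B_def by blast+
    then show "finite B" by (intro finiteI_independent)
    show "trace_on S f = (\<Sum>b\<in>B. representation B (f b) b)" for f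
      by (simp add: trace_on_def B_def Let_def)
  qed
qed

lemma trace_on_linear:
  fixes S :: "'a::euclidean_space set"
  assumes S: "subspace S" and "\<And>x. x \<in> S \<Longrightarrow> f x \<in> S" "\<And>x. x \<in> S \<Longrightarrow> h x \<in> S"
  shows "trace_on S (\<lambda>x. a *\<^sub>R f x + b *\<^sub>R h x) = a * trace_on S f + b * trace_on S h"
proof -
  obtain B where B: "finite B" "independent B" "span B = S"
    and tr: "\<And>f. trace_on S f = (\<Sum>b\<in>B. representation B (f b) b)"
    using trace_on_basis[OF S] by metis
  have "representation B (a *\<^sub>R f c + b *\<^sub>R h c) c = a * representation B (f c) c + b * representation B (h c) c"
    if "c \<in> B" for c
  proof -
    have "c \<in> S" using that B(3) span_base by blast
    then have "f c \<in> span B" "h c \<in> span B" using assms by (simp_all add: B(3))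
    then show ?thesis
      using representation_add[OF B(2) span_scale span_scale, of "h c" "f c" a b] representation_scale[OF B(2)]
      by simp
  qed
  then show ?thesis
    unfolding tr sum_distrib_left sum.distrib[symmetric] by (intro sum.cong refl)
qed

lemma trace_on_commute:
  fixes S :: "'a::euclidean_space set"
  assumes S: "subspace S" and f: "rlin S f" "\<And>x. x \<in> S \<Longrightarrow> f x \<in> S" and h: "rlin S h" "\<And>x. x \<in> S \<Longrightarrow> h x \<in> S"
  shows "trace_on S (\<lambda>x. f (h x)) = trace_on S (\<lambda>x. h (f x))"
proof -
  obtain B where B: "finite B" "independent B" "span B = S"
    and tr: "\<And>f. trace_on S f = (\<Sum>b\<in>B. representation B (f b) b)"
    using trace_on_basis[OF S] by metis
  have BS: "c \<in> S" if "c \<in> B" for c using that B(3) span_base by blast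
  have lin: "rlin S (\<lambda>x. representation B x c)" for c
    unfolding rlin_def
  proof (intro ballI allI)
    fix x y a b assume "x \<in> S" "y \<in> S"
    then have "x \<in> span B" "y \<in> span B" by (simp_all add: B(3))
    then show "representation B (a *\<^sub>R x + b *\<^sub>R y) c = a *\<^sub>R representation B x c + b *\<^sub>R representation B y c"
      using representation_add[OF B(2) span_scale span_scale, of y x a b] representation_scale[OF B(2)]
      by simp
  qed
  have ex: "representation B (f (h b)) b = (\<Sum>c\<in>B. representation B (h b) c * representation B (f c) b)"
    if b: "b \<in> B" and f: "rlin S f" "\<And>x. x \<in> S \<Longrightarrow> f x \<in> S" and h: "\<And>x. x \<in> S \<Longrightarrow> h x \<in> S" for f h b
  proof -
    have "h b = (\<Sum>c\<in>B. representation B (h b) c *\<^sub>R c)"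
      using B h[OF BS[OF b]] by (intro sum_representation_eq[symmetric]) auto
    then have "f (h b) = f (\<Sum>c\<in>B. representation B (h b) c *\<^sub>R c)" by simp
    also have "\<dots> = (\<Sum>c\<in>B. representation B (h b) c *\<^sub>R f c)"
      by (rule rlin_scaled_sum[OF S f(1)]) (rule BS)
    finally have "representation B (f (h b)) b = representation B (\<Sum>c\<in>B. representation B (h b) c *\<^sub>R f c) b" by simp
    also have "\<dots> = (\<Sum>c\<in>B. representation B (h b) c *\<^sub>R representation B (f c) b)"
      by (rule rlin_scaled_sum[OF S lin]) (simp add: BS f)
    finally show ?thesis by simp
  qed
  have "trace_on S (\<lambda>x. f (h x)) = (\<Sum>b\<in>B. \<Sum>c\<in>B. representation B (h b) c * representation B (f c) b)"
    unfolding tr by (intro sum.cong refl ex[where f=f and h=h, OF _ f h(2)])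
  also have "\<dots> = (\<Sum>c\<in>B. \<Sum>b\<in>B. representation B (h b) c * representation B (f c) b)" by (rule sum.swap)
  also have "\<dots> = trace_on S (\<lambda>x. h (f x))"
    unfolding tr
  proof (intro sum.cong refl)
    fix c assume "c \<in> B"
    then show "(\<Sum>b\<in>B. representation B (h b) c * representation B (f c) b) = representation B (h (f c)) c"
      using ex[where f=h and h=f and b=c, OF _ h f(2)] by (simp add: mult.commute)
  qed
  finally show ?thesis .
qed

lemma part_eq:
  assumes "subspace A" "subspace B" "A \<inter> B = {0}" "a \<in> A" "b \<in> B"
  shows "part A B (a + b) = a"
  unfolding part_def
proof (rule the_equality)
  fix a' assume a': "a' \<in> A \<and> a + b - a' \<in> B"
  then have "(a + b - a') - b \<in> B" by (rule subspace_diff[OF assms(2) conjunct2 assms(5)])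
  moreover have "(a + b - a') - b = a - a'" by simp
  moreover have "a - a' \<in> A" by (rule subspace_diff[OF assms(1,4) conjunct1[OF a']])
  ultimately have "a - a' \<in> A \<inter> B" by (simp only: Int_iff)
  then show "a' = a" unfolding assms(3) by simp
next
  show "a \<in> A \<and> a + b - a \<in> B" using assms(4,5) by simp
qed

section \<open>The structure on the tangent space\<close>

locale sasaki =
  fixes D :: "(real^'k^'k) homog_data"
  assumes sc: "sc_homogeneous_3_sasakian D"
begin

abbreviation "P \<equiv> odd_part D"
abbreviation "Ve \<equiv> vertical D"
abbreviation "T \<equiv> tangent D"
abbreviation "hh \<equiv> lie_algebra_of (Iso D)"
abbreviation "gg \<equiv> lie_algebra_of (Grp D)"
abbreviation "xi \<equiv> reeb D"
abbreviation "met \<equiv> metric D"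

definition even_part :: "(real^'k^'k) set \<Rightarrow> bool" where
  "even_part \<gg>0 \<longleftrightarrow> direct_sum gg \<gg>0 P \<and>
     (\<forall>X\<in>\<gg>0. \<forall>Y\<in>\<gg>0. lie_bracket X Y \<in> \<gg>0) \<and>
     (\<forall>X\<in>\<gg>0. \<forall>Y\<in>P. lie_bracket X Y \<in> P) \<and>
     (\<forall>X\<in>P. \<forall>Y\<in>P. lie_bracket X Y \<in> \<gg>0) \<and>
     direct_sum \<gg>0 Ve hh \<and>
     (\<forall>X\<in>hh. \<forall>Y\<in>hh. lie_bracket X Y \<in> hh) \<and>
     (\<forall>X\<in>Ve. \<forall>Y\<in>hh. lie_bracket X Y = 0)"

definition g0 :: "(real^'k^'k) set" where
  "g0 = (SOME \<gg>0. even_part \<gg>0)"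

lemma even_part_g0: "even_part g0"
proof -
  have "sp1_grading D" using sc by (simp add: sc_homogeneous_3_sasakian_def)
  then have "\<exists>\<gg>0. even_part \<gg>0" unfolding sp1_grading_def even_part_def by (rule conjunct1)
  then show ?thesis unfolding g0_def by (rule someI_ex)
qed

lemma g0: "direct_sum gg g0 P" "X \<in> g0 \<Longrightarrow> Y \<in> g0 \<Longrightarrow> lie_bracket X Y \<in> g0"
    "X \<in> g0 \<Longrightarrow> Y \<in> P \<Longrightarrow> lie_bracket X Y \<in> P" "X \<in> P \<Longrightarrow> Y \<in> P \<Longrightarrow> lie_bracket X Y \<in> g0"
    "direct_sum g0 Ve hh" "X \<in> Ve \<Longrightarrow> Y \<in> hh \<Longrightarrow> lie_bracket X Y = 0"
  using even_part_g0 unfolding even_part_def by blast+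

lemma subspaces: "subspace P" "subspace Ve" "subspace hh" "subspace g0" "subspace gg" "subspace T"
proof -
  show P: "subspace P" and s0: "subspace g0" using g0(1) by (auto simp: direct_sum_def)
  show Ve: "subspace Ve" and "subspace hh" using g0(5) by (auto simp: direct_sum_def)
  have "gg = {x + y | x y. x \<in> g0 \<and> y \<in> P}" using g0(1) by (simp add: direct_sum_def)
  then show "subspace gg" using subspace_sums[OF s0 P] by simp
  show "subspace T" using subspace_sums[OF Ve P] by (simp add: tangent_def)
qed

lemma Ve_g0: "X \<in> Ve \<Longrightarrow> X \<in> g0" and hh_g0: "X \<in> hh \<Longrightarrow> X \<in> g0"
  and P_gg: "X \<in> P \<Longrightarrow> X \<in> gg" and g0_gg: "X \<in> g0 \<Longrightarrow> X \<in> gg"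
proof -
  have 1: "g0 = {x + y | x y. x \<in> Ve \<and> y \<in> hh}" using g0(5) by (simp add: direct_sum_def)
  have 2: "gg = {x + y | x y. x \<in> g0 \<and> y \<in> P}" using g0(1) by (simp add: direct_sum_def)
  have z: "0 \<in> P" "0 \<in> Ve" "0 \<in> hh" "0 \<in> g0" using subspaces subspace_0 by blast+
  show "X \<in> Ve \<Longrightarrow> X \<in> g0" "X \<in> hh \<Longrightarrow> X \<in> g0"
    unfolding 1 using z by force+
  show "X \<in> P \<Longrightarrow> X \<in> gg" "X \<in> g0 \<Longrightarrow> X \<in> gg"
    unfolding 2 using z by force+
qed

lemma gg_bracket: assumes "X \<in> gg" "Y \<in> gg" shows "lie_bracket X Y \<in> gg"
proof -
  have 2: "gg = {x + y | x y. x \<in> g0 \<and> y \<in> P}" using g0(1) by (simp add: direct_sum_def)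
  obtain a b where X: "X = a + b" "a \<in> g0" "b \<in> P" using assms(1) 2 by blast
  obtain c d where Y: "Y = c + d" "c \<in> g0" "d \<in> P" using assms(2) 2 by blast
  have "lie_bracket a c \<in> gg" "lie_bracket a d \<in> gg" "lie_bracket b d \<in> gg"
    using g0(2)[OF X(2) Y(2)] g0(3)[OF X(2) Y(3)] g0(4)[OF X(3) Y(3)] g0_gg P_gg by simp_all
  moreover have "- lie_bracket c b \<in> gg"
    by (rule subspace_neg[OF subspaces(5) P_gg[OF g0(3)[OF Y(2) X(3)]]])
  then have "lie_bracket b c \<in> gg" by (simp only: lie_bracket_skew[of b c])
  ultimately show ?thesis using subspaces(5) by (simp add: X(1) Y(1) subspace_add)
qed

lemma Ve_P: "Ve \<inter> P = {0}" and g0_P: "g0 \<inter> P = {0}" and Ve_hh: "Ve \<inter> hh = {0}"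
proof -
  show 1: "g0 \<inter> P = {0}" using g0(1) by (simp add: direct_sum_def)
  show "Ve \<inter> hh = {0}" using g0(5) by (simp add: direct_sum_def)
  have "0 \<in> Ve" "0 \<in> P" using subspaces subspace_0 by blast+
  then show "Ve \<inter> P = {0}" using 1 Ve_g0 by blast
qed

lemma T_hh: "T \<inter> hh = {0}"
proof
  show "T \<inter> hh \<subseteq> {0}"
  proof
    fix x assume x: "x \<in> T \<inter> hh"
    then obtain v p where vp: "x = v + p" "v \<in> Ve" "p \<in> P" unfolding tangent_def by blast
    have "p = x - v" using vp by simp
    moreover have "x - v \<in> g0"
      using x vp(2) by (intro subspace_diff[OF subspaces(4)] Ve_g0 hh_g0) auto
    ultimately have "p \<in> g0" by simp
    then have "p = 0" using vp g0_P by blast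
    then show "x \<in> {0}" using vp x Ve_hh by auto
  qed
qed (use subspaces subspace_0 in auto)

lemma xi_Ve: "i \<in> {1,2,3} \<Longrightarrow> xi i \<in> Ve"
  unfolding vertical_def by (auto intro: span_base)

lemma Ve_T: "X \<in> Ve \<Longrightarrow> X \<in> T" and P_T: "X \<in> P \<Longrightarrow> X \<in> T"
proof -
  have z: "0 \<in> P" "0 \<in> Ve" using subspaces subspace_0 by blast+
  show "X \<in> Ve \<Longrightarrow> X \<in> T" "X \<in> P \<Longrightarrow> X \<in> T"
    unfolding tangent_def using z by force+
qed

lemma ver_eq: "v \<in> Ve \<Longrightarrow> p \<in> P \<Longrightarrow> ver D (v + p) = v"
  and hor_eq: "v \<in> Ve \<Longrightarrow> p \<in> P \<Longrightarrow> hor D (v + p) = p"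
  unfolding ver_def hor_def using part_eq[OF subspaces(2,1) Ve_P, of v p]
    part_eq[OF subspaces(1,2), of p v] Ve_P by (simp_all add: Int_commute add.commute)

lemma ver_hor: assumes "X \<in> T" shows "ver D X \<in> Ve" "hor D X \<in> P" "ver D X + hor D X = X"
  using assms unfolding tangent_def by (auto simp: ver_eq hor_eq)

lemma ver_Ve [simp]: "X \<in> Ve \<Longrightarrow> ver D X = X" and hor_Ve [simp]: "X \<in> Ve \<Longrightarrow> hor D X = 0"
  and ver_P [simp]: "X \<in> P \<Longrightarrow> ver D X = 0" and hor_P [simp]: "X \<in> P \<Longrightarrow> hor D X = X"
  using ver_eq[of X 0] hor_eq[of X 0] ver_eq[of 0 X] hor_eq[of 0 X] subspaces subspace_0 by auto

lemma rlin_ver: "rlin T (ver D)" and rlin_hor: "rlin T (hor D)"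
proof -
  have *: "ver D (a *\<^sub>R x + b *\<^sub>R y) = a *\<^sub>R ver D x + b *\<^sub>R ver D y \<and>
     hor D (a *\<^sub>R x + b *\<^sub>R y) = a *\<^sub>R hor D x + b *\<^sub>R hor D y"
    if x: "x \<in> T" and y: "y \<in> T" for x y a b
  proof -
    have 1: "a *\<^sub>R x + b *\<^sub>R y = (a *\<^sub>R ver D x + b *\<^sub>R ver D y) + (a *\<^sub>R hor D x + b *\<^sub>R hor D y)"
      using ver_hor(3)[OF x] ver_hor(3)[OF y] by (metis (no_types, lifting) add.assoc add.left_commute scaleR_right_distrib)
    have 2: "a *\<^sub>R ver D x + b *\<^sub>R ver D y \<in> Ve" "a *\<^sub>R hor D x + b *\<^sub>R hor D y \<in> P"
      using ver_hor[OF x] ver_hor[OF y] subspaces by (auto intro!: subspace_add subspace_scale)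
    show ?thesis unfolding 1 using ver_eq[OF 2] hor_eq[OF 2] by simp
  qed
  show "rlin T (ver D)" "rlin T (hor D)" unfolding rlin_def using * by blast+
qed

lemma killing_sym: assumes "X \<in> gg" "Y \<in> gg" shows "killing_form gg X Y = killing_form gg Y X"
  unfolding killing_form_def
  using assms subspaces(5) gg_bracket by (intro trace_on_commute rlin_lie_bracket) auto

lemma killing_lin: assumes "Y \<in> gg" shows "rlin gg (\<lambda>X. killing_form gg X Y)"
  unfolding rlin_def
proof (intro ballI allI)
  fix X Z a b assume "X \<in> gg" "Z \<in> gg"
  then show "killing_form gg (a *\<^sub>R X + b *\<^sub>R Z) Y = a *\<^sub>R killing_form gg X Y + b *\<^sub>R killing_form gg Z Y"
    unfolding killing_form_def
    using trace_on_linear[OF subspaces(5), of "\<lambda>W. lie_bracket X (lie_bracket Y W)" "\<lambda>W. lie_bracket Z (lie_bracket Y W)" a b]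
      gg_bracket assms by simp
qed

lemma ver_gg: "X \<in> T \<Longrightarrow> ver D X \<in> gg" and hor_gg: "X \<in> T \<Longrightarrow> hor D X \<in> gg"
  using ver_hor Ve_g0 g0_gg P_gg by blast+

lemma met_sym: "X \<in> T \<Longrightarrow> Y \<in> T \<Longrightarrow> met X Y = met Y X"
  unfolding metric_def by (simp add: killing_sym ver_gg hor_gg)

lemma met_lin: assumes Y: "Y \<in> T" shows "rlin T (\<lambda>X. met X Y)"
proof -
  have "rlin T (\<lambda>X. killing_form gg (ver D X) (ver D Y))"
    using rlin_ver killing_lin[OF ver_gg[OF Y]] ver_gg by (simp add: rlin_def)
  moreover have "rlin T (\<lambda>X. killing_form gg (hor D X) (hor D Y))"
    using rlin_hor killing_lin[OF hor_gg[OF Y]] hor_gg by (simp add: rlin_def)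
  ultimately show ?thesis
    unfolding rlin_def metric_def by (simp add: add_divide_distrib diff_divide_distrib algebra_simps)
qed

lemma met_lin2: assumes Y: "Y \<in> T" shows "rlin T (met Y)"
  unfolding rlin_def
proof (intro ballI allI)
  fix x z a b assume xz: "x \<in> T" "z \<in> T"
  then have "a *\<^sub>R x + b *\<^sub>R z \<in> T" using subspaces(6) by (simp add: subspace_add subspace_scale)
  then show "met Y (a *\<^sub>R x + b *\<^sub>R z) = a *\<^sub>R met Y x + b *\<^sub>R met Y z"
    using xz Y rlinD[OF met_lin[OF Y], of x z a b] by (simp add: met_sym[OF Y])
qed

lemma met_pos: "X \<in> T \<Longrightarrow> X \<noteq> 0 \<Longrightarrow> met X X > 0"
  using sc by (simp add: sc_homogeneous_3_sasakian_def three_sasakian_def)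

lemma met_Ve_P: assumes "X \<in> Ve" "Y \<in> P" shows "met X Y = 0" "met Y X = 0"
proof -
  have z: "0 \<in> gg" using subspace_0[OF subspaces(5)] .
  have k2: "killing_form gg 0 Z = 0" if "Z \<in> gg" for Z
    using rlin_0[OF subspaces(5) killing_lin[OF that]] .
  have k1: "killing_form gg Z 0 = 0" if "Z \<in> gg" for Z
    using k2[OF that] killing_sym[OF that z] by simp
  have "X \<in> gg" "Y \<in> gg" using assms Ve_g0 g0_gg P_gg by blast+
  then show "met X Y = 0" using assms unfolding metric_def by (simp add: k1 k2)
  then show "met Y X = 0" using assms met_sym Ve_T P_T by simp
qed

section \<open>Reeb fields\<close>

definition lc :: "real^'k^'k \<Rightarrow> real^'k^'k \<Rightarrow> real^'k^'k" where
  "lc = (SOME L. levi_civita D L \<and> (\<forall>i\<in>{1,2,3}. sasakian D L i))"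

lemma lc: "levi_civita D lc" "i \<in> {1,2,3} \<Longrightarrow> sasakian D lc i"
proof -
  have "\<exists>L. levi_civita D L \<and> (\<forall>i\<in>{1,2,3}. sasakian D L i)"
    using sc by (simp add: sc_homogeneous_3_sasakian_def three_sasakian_def)
  then have "levi_civita D lc \<and> (\<forall>i\<in>{1,2,3}. sasakian D lc i)"
    unfolding lc_def by (rule someI_ex[where P="\<lambda>L. levi_civita D L \<and> (\<forall>i\<in>{1,2,3}. sasakian D L i)"])
  then show "levi_civita D lc" "i \<in> {1,2,3} \<Longrightarrow> sasakian D lc i" by blast+
qed

lemma xi_T: "i \<in> {1,2,3} \<Longrightarrow> xi i \<in> T" using xi_Ve Ve_T by blast

lemma xi_T' [simp]: "xi 1 \<in> T" "xi (Suc 0) \<in> T" "xi 2 \<in> T" "xi 3 \<in> T"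
  "xi 1 \<in> Ve" "xi (Suc 0) \<in> Ve" "xi 2 \<in> Ve" "xi 3 \<in> Ve"
  using xi_T[of 1] xi_T[of 2] xi_T[of 3] xi_Ve[of 1] xi_Ve[of 2] xi_Ve[of 3] by simp_all

lemma xi_bracket: "lie_bracket (xi 1) (xi 2) = 2 *\<^sub>R xi 3" "lie_bracket (xi 2) (xi 3) = 2 *\<^sub>R xi 1"
    "lie_bracket (xi 3) (xi 1) = 2 *\<^sub>R xi 2"
  and xi_orth: "met (xi 1) (xi 2) = 0" "met (xi 2) (xi 3) = 0" "met (xi 3) (xi 1) = 0"
  using sc by (simp_all add: sc_homogeneous_3_sasakian_def three_sasakian_def even_perms_def)

lemma xi_met: "met (xi 1) (xi 1) = 1" "met (xi 2) (xi 2) = 1" "met (xi 3) (xi 3) = 1"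
    "met (xi 1) (xi 2) = 0" "met (xi 2) (xi 3) = 0" "met (xi 3) (xi 1) = 0"
    "met (xi 2) (xi 1) = 0" "met (xi 3) (xi 2) = 0" "met (xi 1) (xi 3) = 0"
  using lc(2)[of 1] lc(2)[of 2] lc(2)[of 3] xi_orth
    met_sym[of "xi 1" "xi 2"] met_sym[of "xi 2" "xi 3"] met_sym[of "xi 3" "xi 1"]
  by (auto simp: sasakian_def)

lemma Ve_expand:
  assumes v: "v \<in> Ve"
  shows "v = met (xi 1) v *\<^sub>R xi 1 + met (xi 2) v *\<^sub>R xi 2 + met (xi 3) v *\<^sub>R xi 3"
proof -
  obtain a where "v - a *\<^sub>R xi 1 \<in> span {xi 2, xi 3}"
    using v unfolding vertical_def span_breakdown_eq[of v "xi 1"] by blast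
  then obtain b where "v - a *\<^sub>R xi 1 - b *\<^sub>R xi 2 \<in> span {xi 3}"
    unfolding span_breakdown_eq[of _ "xi 2"] by blast
  then obtain c where "v - a *\<^sub>R xi 1 - b *\<^sub>R xi 2 = c *\<^sub>R xi 3"
    by (auto simp: span_singleton)
  then have v: "v = a *\<^sub>R xi 1 + b *\<^sub>R xi 2 + c *\<^sub>R xi 3" by (simp add: algebra_simps)
  have "met (xi i) v = a * met (xi i) (xi 1) + b * met (xi i) (xi 2) + c * met (xi i) (xi 3)"
    if "i \<in> {1,2,3}" for i
    unfolding v using rlin_add[OF subspaces(6) met_lin2[OF xi_T[OF that]]]
      rlin_scale[OF subspaces(6) met_lin2[OF xi_T[OF that]]] subspaces(6)
    by (simp add: subspace_add subspace_scale)
  from this[of 1] this[of 2] this[of 3] have "met (xi 1) v = a" "met (xi 2) v = b" "met (xi 3) v = c"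
    by (simp_all add: xi_met del: One_nat_def)
  then show ?thesis using v by simp
qed

lemma xi_bracket': "lie_bracket (xi 2) (xi 1) = - 2 *\<^sub>R xi 3" "lie_bracket (xi 3) (xi 2) = - 2 *\<^sub>R xi 1"
    "lie_bracket (xi 1) (xi 3) = - 2 *\<^sub>R xi 2"
  using xi_bracket lie_bracket_skew[of "xi 2" "xi 1"] lie_bracket_skew[of "xi 3" "xi 2"] lie_bracket_skew[of "xi 1" "xi 3"]
  by simp_all

lemma Ve_bracket: assumes v: "v \<in> Ve" and i: "i \<in> {1,2,3}" shows "lie_bracket (xi i) v \<in> Ve"
proof -
  have "lie_bracket (xi i) (xi j) \<in> Ve" if "j \<in> {1,2,3}" for j
    using i that subspaces(2)
    by (auto simp: xi_bracket xi_bracket' subspace_scale subspace_0 subspace_neg simp del: One_nat_def)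
  then have "lie_bracket (xi i) (met (xi 1) v *\<^sub>R xi 1 + met (xi 2) v *\<^sub>R xi 2 + met (xi 3) v *\<^sub>R xi 3) \<in> Ve"
    using subspaces(2) by (simp add: subspace_add subspace_scale)
  then show ?thesis by (simp only: Ve_expand[OF v, symmetric])
qed

lemma phi_P: "X \<in> P \<Longrightarrow> phi D i X = lie_bracket (xi i) X"
  by (simp add: phi_def)

lemma phi_Ve: "X \<in> Ve \<Longrightarrow> phi D i X = (1/2) *\<^sub>R lie_bracket (xi i) X"
  by (simp add: phi_def)

lemma phi_in_P: "X \<in> P \<Longrightarrow> i \<in> {1,2,3} \<Longrightarrow> phi D i X \<in> P"
  using g0(3) Ve_g0 xi_Ve by (simp add: phi_P)

lemma phi_in_T: assumes "X \<in> T" "i \<in> {1,2,3}" shows "phi D i X \<in> T"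
  unfolding phi_def tangent_def
  using ver_hor[OF assms(1)] Ve_bracket[OF _ assms(2)] subspaces(2) g0(3)[OF Ve_g0[OF xi_Ve[OF assms(2)]]]
  by (auto simp: subspace_scale intro!: exI)

lemma phi_lin: "rlin T (phi D i)"
  using rlin_ver rlin_hor by (simp add: rlin_def phi_def algebra_simps)

lemma phi_xi: "phi D 1 (xi 1) = 0" "phi D 1 (xi 2) = xi 3" "phi D 1 (xi 3) = - xi 2"
  by (simp_all add: phi_Ve xi_bracket xi_bracket' del: One_nat_def)

lemma phi_skew: assumes "X \<in> T" "Y \<in> T" "i \<in> {1,2,3}" shows "met (phi D i X) Y = - met X (phi D i Y)"
proof -
  have s: "phi D i Z = - lc Z (xi i)" if "Z \<in> T" for Z
    using lc(2)[OF assms(3)] that by (simp add: sasakian_def)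
  have "met (lc X (xi i)) Y + met X (lc Y (xi i)) = 0"
    using lc(2)[OF assms(3)] assms by (simp add: sasakian_def)
  moreover have "met (lc X (xi i)) Y = - met (phi D i X) Y" "met X (lc Y (xi i)) = - met X (phi D i Y)"
    using assms s rlin_minus[OF subspaces(6) met_lin[OF assms(2)] phi_in_T[OF assms(1,3)]]
      rlin_minus[OF subspaces(6) met_lin2[OF assms(1)] phi_in_T[OF assms(2,3)]] by simp_all
  ultimately show ?thesis by simp
qed

text \<open>
  On \<open>\<complex>\<^sup>2 \<otimes> U\<close> the Reeb vectors act through the standard matrices on the first factor, where these are
  the quaternion relations.
\<close>
lemma phi_mult:
  assumes X: "X \<in> P"
  shows "lie_bracket (xi 1) (lie_bracket (xi 1) X) = - X" "lie_bracket (xi 2) (lie_bracket (xi 2) X) = - X"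
    "lie_bracket (xi 1) (lie_bracket (xi 2) X) = lie_bracket (xi 3) X"
    "lie_bracket (xi 2) (lie_bracket (xi 1) X) = - lie_bracket (xi 3) X"
proof -
  define N where "N = 2 * (quat_dim D - 1)"
  have "odd_part_tensor D" using sc by (simp add: sc_homogeneous_3_sasakian_def sp1_grading_def)
  then obtain \<Theta> where bij: "bij_betw \<Theta> (P \<times> P) (C2_tensor N)"
    and scl': "\<forall>v\<in>P \<times> P. \<forall>z a k. \<Theta> (cscale z v) a k = z * \<Theta> v a k"
    and act': "\<forall>j\<in>{1,2,3}. \<forall>v\<in>P \<times> P. \<forall>a<2. \<forall>k<N.
          \<Theta> (map_prod (lie_bracket (xi j)) (lie_bracket (xi j)) v) a k = (\<Sum>b<2. std_sp1 j a b * \<Theta> v b k)"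
    unfolding odd_part_tensor_def Let_def N_def[symmetric] by (elim exE conjE) (rule that)
  have scl: "\<Theta> (cscale z v) a k = z * \<Theta> v a k" if "v \<in> P \<times> P" for v z a k
    using scl' that by blast
  have act: "\<Theta> (map_prod (lie_bracket (xi j)) (lie_bracket (xi j)) v) a k = (\<Sum>b<2. std_sp1 j a b * \<Theta> v b k)"
    if "j \<in> {1,2,3}" "v \<in> P \<times> P" "a < 2" "k < N" for j v a k
    using act' that by blast
  define th where "th X = \<Theta> (X, 0::real^'k^'k)" for X
  have z: "0 \<in> P" using subspaces(1) subspace_0 by blast
  have brP: "lie_bracket (xi j) Y \<in> P" if "j \<in> {1,2,3}" "Y \<in> P" for j Y
    using that g0(3) Ve_g0 xi_Ve by blast
  have tact: "th (lie_bracket (xi j) Y) a k = std_sp1 j a 0 * th Y 0 k + std_sp1 j a 1 * th Y 1 k"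
    if "j \<in> {1,2,3}" "Y \<in> P" "a < 2" "k < N" for j Y a k
    using act[of j "(Y, 0)" a k] that z by (simp add: th_def numeral_2_eq_2)
  have tmin: "th (- Y) a k = - th Y a k" if "Y \<in> P" for Y a k
    using scl[of "(Y, 0)" "-1" a k] that z by (simp add: th_def cscale_def)
  have eqI: "Y = Z" if "Y \<in> P" "Z \<in> P" "\<And>a k. a < 2 \<Longrightarrow> k < N \<Longrightarrow> th Y a k = th Z a k" for Y Z
  proof -
    have "th Y \<in> C2_tensor N" "th Z \<in> C2_tensor N"
      using bij that z by (auto simp: th_def bij_betw_def)
    then have "th Y a k = th Z a k" for a k
      using that(3)[of a k] by (cases "a < 2 \<and> k < N") (auto simp: C2_tensor_def)
    then have "th Y = th Z" by blast
    then show ?thesis using bij that z by (auto simp: th_def bij_betw_def inj_on_def)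
  qed
  have a: "a = 0 \<or> a = 1" if "a < 2" for a :: nat using that by auto
  note s = tact std_sp1_def tmin brP X subspace_neg[OF subspaces(1)]
  show "lie_bracket (xi 1) (lie_bracket (xi 1) X) = - X"
    by (rule eqI) (use a in \<open>auto simp: s simp del: One_nat_def\<close>)
  show "lie_bracket (xi 2) (lie_bracket (xi 2) X) = - X"
    by (rule eqI) (use a in \<open>auto simp: s simp del: One_nat_def\<close>)
  show "lie_bracket (xi 1) (lie_bracket (xi 2) X) = lie_bracket (xi 3) X"
    by (rule eqI) (use a in \<open>auto simp: s simp del: One_nat_def\<close>)
  show "lie_bracket (xi 2) (lie_bracket (xi 1) X) = - lie_bracket (xi 3) X"
    by (rule eqI) (use a in \<open>auto simp: s simp del: One_nat_def\<close>)
qed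

sublocale Q: quat_space P "metric D" "phi D 1" "phi D 2" "phi D 3"
proof
  fix x y assume x: "x \<in> P" and y: "y \<in> P"
  show "met x y = met y x" using met_sym x y P_T by blast
  show "x \<noteq> 0 \<Longrightarrow> met x x > 0" using met_pos x P_T by blast
  show "phi D 1 x \<in> P" "phi D 2 x \<in> P" using phi_in_P x by auto
  show "met (phi D 1 x) y = - met x (phi D 1 y)" "met (phi D 2 x) y = - met x (phi D 2 y)"
    using phi_skew x y P_T by auto
  show "phi D 1 (phi D 1 x) = - x" "phi D 2 (phi D 2 x) = - x" "phi D 1 (phi D 2 x) = phi D 3 x"
     "phi D 2 (phi D 1 x) = - phi D 3 x"
    using phi_mult[OF x] phi_in_P[OF x, of 1] phi_in_P[OF x, of 2] x by (simp_all add: phi_P)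
  show "rlin P (\<lambda>x. met x y)" using met_lin[OF P_T[OF y]] P_T by (auto simp: rlin_def)
next
  show "rlin P (phi D 1)" "rlin P (phi D 2)" using phi_lin P_T by (auto simp: rlin_def)
qed (rule subspaces)

section \<open>The curvature\<close>

text \<open>
  The isotropy component of \<open>[X,Y]\<close>.
\<close>
definition hpart :: "real^'k^'k \<Rightarrow> real^'k^'k \<Rightarrow> real^'k^'k" where
  "hpart X Y = lie_bracket X Y + 2 *\<^sub>R (met X (phi D 1 Y) *\<^sub>R xi 1 + met X (phi D 2 Y) *\<^sub>R xi 2 + met X (phi D 3 Y) *\<^sub>R xi 3)"

text \<open>
  The vertical component of \<open>[X,Y]\<close> is found without the Killing form: the connection is metric and torsion-free, and
  \<open>\<phi>\<^sub>i\<close> is minus the derivative of \<open>\<xi>\<^sub>i\<close>, so its product with \<open>\<xi>\<^sub>i\<close> is \<open>-2 g(X, \<phi>\<^sub>i Y)\<close>.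
\<close>
lemma hpart_hh: assumes X: "X \<in> P" and Y: "Y \<in> P" shows "hpart X Y \<in> hh"
proof -
  have "lie_bracket X Y \<in> g0" using g0(4) X Y .
  then obtain v z where vz: "lie_bracket X Y = v + z" "v \<in> Ve" "z \<in> hh"
    using g0(5) unfolding direct_sum_def by blast
  have XT: "X \<in> T" and YT: "Y \<in> T" using X Y P_T by auto
  have lcT: "lc A B \<in> T" if "A \<in> T" "B \<in> T" for A B using lc(1) that by (simp add: levi_civita_def)
  have "lc X Y - lc Y X = part T hh (v + z)" using lc(1) XT YT vz(1) by (simp add: levi_civita_def)
  also have "\<dots> = v" by (rule part_eq[OF subspaces(6,3) T_hh Ve_T[OF vz(2)] vz(3)])
  finally have v: "v = lc X Y - lc Y X" ..
  have lcm: "met (xi i) (lc A B) = met B (phi D i A)" if "A \<in> T" "B \<in> T" "i \<in> {1,2,3}" for A B i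
  proof -
    have "met (lc A B) (xi i) + met B (lc A (xi i)) = 0"
      using lc(1) that xi_T by (simp add: levi_civita_def)
    moreover have "phi D i A = - lc A (xi i)" using lc(2)[OF that(3)] that by (simp add: sasakian_def)
    ultimately show ?thesis
      using rlin_minus[OF subspaces(6) met_lin2[OF that(2)] lcT[OF that(1) xi_T[OF that(3)]]]
        met_sym[OF lcT[OF that(1,2)] xi_T[OF that(3)]] by simp
  qed
  have c: "met (xi i) v = - 2 * met X (phi D i Y)" if i: "i \<in> {1,2,3}" for i
  proof -
    have "met (xi i) v = met Y (phi D i X) - met X (phi D i Y)"
      unfolding v using rlin_diff[OF subspaces(6) met_lin2[OF xi_T[OF i]] lcT[OF XT YT] lcT[OF YT XT]]
      by (simp add: lcm[OF XT YT i] lcm[OF YT XT i])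
    also have "met Y (phi D i X) = - met X (phi D i Y)"
      using phi_skew[OF XT YT i] met_sym[OF YT phi_in_T[OF XT i]] by simp
    finally show ?thesis by simp
  qed
  have c': "met (xi 1) v = - 2 * met X (phi D 1 Y)" "met (xi 2) v = - 2 * met X (phi D 2 Y)"
    "met (xi 3) v = - 2 * met X (phi D 3 Y)" by (rule c, simp)+
  have "v = (- 2 * met X (phi D 1 Y)) *\<^sub>R xi 1 + (- 2 * met X (phi D 2 Y)) *\<^sub>R xi 2 + (- 2 * met X (phi D 3 Y)) *\<^sub>R xi 3"
    using Ve_expand[OF vz(2)] unfolding c' .
  then have "v = - (2 *\<^sub>R (met X (phi D 1 Y) *\<^sub>R xi 1 + met X (phi D 2 Y) *\<^sub>R xi 2 + met X (phi D 3 Y) *\<^sub>R xi 3))"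
    by (simp add: scaleR_add_right del: One_nat_def)
  then have "hpart X Y = z" unfolding hpart_def vz(1) by simp
  then show ?thesis using vz by simp
qed

definition curv :: "real^'k^'k \<Rightarrow> real^'k^'k \<Rightarrow> real^'k^'k \<Rightarrow> real^'k^'k" where
  "curv X Y Z = lie_bracket (hpart X Y) Z"

lemma hpart_skew: "X \<in> P \<Longrightarrow> Y \<in> P \<Longrightarrow> hpart X Y = - hpart Y X"
proof -
  assume X: "X \<in> P" and Y: "Y \<in> P"
  have "met Y (phi D i X) = - met X (phi D i Y)" if "i \<in> {1,2,3}" for i
    using phi_skew[OF P_T[OF X] P_T[OF Y] that] met_sym[OF P_T[OF Y] phi_in_T[OF P_T[OF X] that]] by simp
  from this[of 1] this[of 2] this[of 3] show ?thesis
    using lie_bracket_skew[of X Y] by (simp add: hpart_def algebra_simps)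
qed

text \<open>
  Bracketing \<open>[X,Y]\<close> with \<open>\<xi>\<^sub>i\<close> kills its isotropy component and leaves a vertical vector, so the sum of the two sides
  is vertical as well as in the isotropy algebra.
\<close>
lemma hpart_phi: assumes X: "X \<in> P" and Y: "Y \<in> P" and i: "i \<in> {1,2,3}"
  shows "hpart (phi D i X) Y = - hpart X (phi D i Y)"
proof -
  have pX: "phi D i X \<in> P" and pY: "phi D i Y \<in> P" using phi_in_P X Y i by auto
  have v: "2 *\<^sub>R (a *\<^sub>R xi 1 + b *\<^sub>R xi 2 + c *\<^sub>R xi 3) \<in> Ve" for a b c
    using subspaces(2) by (intro subspace_add subspace_scale) auto
  have "lie_bracket (xi i) (lie_bracket X Y) \<in> Ve"
  proof -
    have "lie_bracket (xi i) (hpart X Y) = 0" using g0(6) xi_Ve[OF i] hpart_hh[OF X Y] by blast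
    then have "lie_bracket (xi i) (lie_bracket X Y)
      = - lie_bracket (xi i) (2 *\<^sub>R (met X (phi D 1 Y) *\<^sub>R xi 1 + met X (phi D 2 Y) *\<^sub>R xi 2 + met X (phi D 3 Y) *\<^sub>R xi 3))"
      unfolding hpart_def by (simp only: lie_bracket_add eq_neg_iff_add_eq_0)
    then show ?thesis using Ve_bracket[OF v i] subspaces(2) by (simp only: subspace_neg)
  qed
  moreover have "lie_bracket (xi i) (lie_bracket X Y) = lie_bracket (phi D i X) Y + lie_bracket X (phi D i Y)"
    using X Y by (simp add: phi_P lie_bracket_jacobi[of "xi i" X Y])
  ultimately have "hpart (phi D i X) Y + hpart X (phi D i Y) \<in> Ve"
    unfolding hpart_def using v subspaces(2)
    by (simp only: add.assoc add.left_commute[of "2 *\<^sub>R _"] ) (simp only: add.assoc[symmetric] subspace_add)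
  moreover have "hpart (phi D i X) Y + hpart X (phi D i Y) \<in> hh"
    using hpart_hh[OF pX Y] hpart_hh[OF X pY] subspaces(3) by (simp add: subspace_add)
  ultimately have "hpart (phi D i X) Y + hpart X (phi D i Y) = 0" using Ve_hh by blast
  then show ?thesis by (simp add: add_eq_0_iff2)
qed

lemma quat_curv:
  assumes "quat_basis P (metric D) (phi D 1) (phi D 2) (phi D 3) B"
  shows "quat_curv P (metric D) (phi D 1) (phi D 2) (phi D 3) B curv"
proof -
  interpret quat_basis P "metric D" "phi D 1" "phi D 2" "phi D 3" B by fact
  show ?thesis
  proof
    fix x y z assume x: "x \<in> P" and y: "y \<in> P" and z: "z \<in> P"
    show "curv x y z \<in> P" using g0(3) hh_g0 hpart_hh x y z by (simp add: curv_def)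
    show "curv x y z = - curv y x z" using hpart_skew[OF x y] by (simp add: curv_def)
    show "curv (phi D 1 x) y z = - curv x (phi D 1 y) z" using hpart_phi[OF x y, of 1] by (simp add: curv_def)
    show "curv (phi D 2 x) y z = - curv x (phi D 2 y) z" using hpart_phi[OF x y, of 2] by (simp add: curv_def)
    show "curv x y (phi D 1 z) = phi D 1 (curv x y z)"
    proof -
      have "lie_bracket (hpart x y) (xi 1) = 0"
        using g0(6)[OF xi_T'(5) hpart_hh[OF x y]] lie_bracket_skew[of "xi 1" "hpart x y"] by simp
      moreover have "lie_bracket (hpart x y) z \<in> P" using g0(3) hh_g0 hpart_hh x y z by blast
      ultimately show ?thesis using z lie_bracket_jacobi[of "hpart x y" "xi 1" z] by (simp add: curv_def phi_P)
    qed
    have j: "lie_bracket (lie_bracket x y) z + lie_bracket (lie_bracket y z) x + lie_bracket (lie_bracket z x) y = 0"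
      by (simp add: lie_bracket_def matrix_diff_ldistrib matrix_diff_rdistrib matrix_mul_assoc)
    have c: "curv a b c = lie_bracket (lie_bracket a b) c + 2 *\<^sub>R (met a (phi D 1 b) *\<^sub>R phi D 1 c
         + met a (phi D 2 b) *\<^sub>R phi D 2 c + met a (phi D 3 b) *\<^sub>R phi D 3 c)" if "c \<in> P" for a b c
      using that by (simp add: curv_def hpart_def phi_P)
    have aux: "a + s + (b + t) + (c + u) = s + t + u" if "a + b + c = 0" for a b c s t u :: "real^'k^'k"
    proof -
      have "a + s + (b + t) + (c + u) = (a + b + c) + (s + t + u)" by (simp add: algebra_simps)
      then show ?thesis using that by simp
    qed
    show "curv x y z + curv y z x + curv z x y
      = 2 *\<^sub>R (met x (phi D 1 y) *\<^sub>R phi D 1 z + met x (phi D 2 y) *\<^sub>R phi D 2 z + met x (phi D 3 y) *\<^sub>R phi D 3 z)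
      + 2 *\<^sub>R (met y (phi D 1 z) *\<^sub>R phi D 1 x + met y (phi D 2 z) *\<^sub>R phi D 2 x + met y (phi D 3 z) *\<^sub>R phi D 3 x)
      + 2 *\<^sub>R (met z (phi D 1 x) *\<^sub>R phi D 1 y + met z (phi D 2 x) *\<^sub>R phi D 2 y + met z (phi D 3 x) *\<^sub>R phi D 3 y)"
      unfolding c[OF x] c[OF y] c[OF z] by (rule aux[OF j])
  next
    fix y z assume y: "y \<in> P" and z: "z \<in> P"
    show "rlin P (\<lambda>x. curv x y z)"
      unfolding rlin_def
    proof (intro ballI allI)
      fix u v a b assume u: "u \<in> P" and v: "v \<in> P"
      have "met (a *\<^sub>R u + b *\<^sub>R v) (phi D i y) = a * met u (phi D i y) + b * met v (phi D i y)" if "i \<in> {1,2,3}" for i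
        using rlinD[OF Q.g_lin[OF phi_in_P[OF y that]] u v, of a b] by simp
      from this[of 1] this[of 2] this[of 3]
      have "hpart (a *\<^sub>R u + b *\<^sub>R v) y = a *\<^sub>R hpart u y + b *\<^sub>R hpart v y"
        by (simp add: hpart_def algebra_simps)
      then show "curv (a *\<^sub>R u + b *\<^sub>R v) y z = a *\<^sub>R curv u y z + b *\<^sub>R curv v y z" by (simp add: curv_def)
    qed
  next
    fix x y show "rlin P (curv x y)" by (simp add: rlin_def curv_def)
  qed
qed

end

text \<open>
  Keeps \<open>phi D 1\<close> and \<open>reeb D 1\<close> in the form in which the rules about them are stated.
\<close>
declare One_nat_def [simp del]

section \<open>An orthonormal basis from a quaternionic frame\<close>

text \<open>
  A quaternionic frame yields a real orthonormal basis, and a basis of half the size over the complex numbers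
  with \<open>I\<close> as imaginary unit.
\<close>
lemma (in quat_space) frame_basis:
  assumes C: "qframe V C"
  defines "B \<equiv> (C \<union> I ` C) \<union> (J ` C \<union> K ` C)"
  shows "quat_basis V g I J K B" and "card B = 2 * card (C \<union> J ` C)"
    and "finite (C \<union> J ` C)" and "C \<union> J ` C \<subseteq> V"
    and "x \<in> V \<Longrightarrow> \<exists>c d. x = (\<Sum>e\<in>C \<union> J ` C. c e *\<^sub>R e + d e *\<^sub>R I e)"
proof -
  have CV: "v \<in> V" if "v \<in> C" for v using C that by (auto simp: qframe_def)
  have fin: "finite C" using C by (simp add: qframe_def)
  have o: "g v w = (if v = w then 1 else 0)" "g v (I w) = 0" "g v (J w) = 0" "g v (K w) = 0"
    if "v \<in> C" "w \<in> C" for v w using C that by (simp_all add: qframe_def)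
  have ne: "v \<noteq> I w" "v \<noteq> J w" "v \<noteq> K w" "v \<noteq> - I w" "v \<noteq> - J w" "v \<noteq> - K w"
    if "v \<in> C" "w \<in> C" for v w
    using o[OF that] o(1)[OF that(1) that(1)] CV that by (auto simp: g_minus2 V_in)
  have "inj_on I C" by (rule inj_onI) (metis CV II neg_equal_iff_equal)
  moreover have "inj_on J C" by (rule inj_onI) (metis CV JJ neg_equal_iff_equal)
  moreover have "inj_on K C" by (rule inj_onI) (metis CV K_mult(1) neg_equal_iff_equal)
  ultimately have inj: "inj_on I C" "inj_on J C" "inj_on K C" .
  have d1: "C \<inter> I ` C = {}" "C \<inter> J ` C = {}" using ne by blast+
  have eq1: "I v = J w \<Longrightarrow> v = - K w" "I v = K w \<Longrightarrow> v = J w" "J v = K w \<Longrightarrow> v = - I w"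
    if "v \<in> C" "w \<in> C" for v w
  proof -
    have v: "v = - I (I v)" "v = - J (J v)" using CV[OF that(1)] by (simp_all add: II JJ)
    show "v = - K w" if "I v = J w" using v(1) unfolding that IJ[OF CV[OF \<open>w \<in> C\<close>]] .
    show "v = J w" if "I v = K w" using v(1) unfolding that K_mult(2)[OF CV[OF \<open>w \<in> C\<close>]] by simp
    show "v = - I w" if "J v = K w" using v(2) unfolding that K_mult(4)[OF CV[OF \<open>w \<in> C\<close>]] .
  qed
  have ne2: "I v \<noteq> J w" "I v \<noteq> K w" "J v \<noteq> K w" if "v \<in> C" "w \<in> C" for v w
    using eq1[OF that] ne(2,4,6)[OF that] by blast+
  have d2: "J ` C \<inter> K ` C = {}" "(C \<union> I ` C) \<inter> (J ` C \<union> K ` C) = {}"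
    using ne(2,3) ne2 by blast+
  have sumB: "(\<Sum>e\<in>B. f e) = (\<Sum>v\<in>C. f v + f (I v) + f (J v) + f (K v))" for f :: "'a \<Rightarrow> 'b::comm_monoid_add"
    unfolding B_def using fin d1 d2 inj
    by (simp add: sum.union_disjoint sum.reindex sum.distrib add.assoc)
  have sumC: "(\<Sum>e\<in>C \<union> J ` C. f e) = (\<Sum>v\<in>C. f v + f (J v))" for f :: "'a \<Rightarrow> 'b::comm_monoid_add"
    using fin d1 inj by (simp add: sum.union_disjoint sum.reindex sum.distrib)
  have ex: "x = (\<Sum>v\<in>C. g v x *\<^sub>R v + g (I v) x *\<^sub>R I v + g (J v) x *\<^sub>R J v + g (K v) x *\<^sub>R K v)" if "x \<in> V" for x
    using C that by (simp add: qframe_def)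
  show "finite (C \<union> J ` C)" "C \<union> J ` C \<subseteq> V" using fin CV V_in by auto
  show "card B = 2 * card (C \<union> J ` C)"
    unfolding B_def using fin d1 d2 inj by (simp add: card_Un_disjoint card_image)
  show "quat_basis V g I J K B"
  proof
    show "finite B" using fin by (simp add: B_def)
    show "e \<in> V" if "e \<in> B" for e using that CV V_in by (auto simp: B_def)
    show "g e e = 1" if "e \<in> B" for e
      using that CV o(1) by (auto simp: B_def I_skew J_skew K_skew V_in II JJ K_mult g_minus2)
    show "x = (\<Sum>e\<in>B. g e x *\<^sub>R e)" if "x \<in> V" for x
      unfolding sumB using ex[OF that] .
  qed
  show "\<exists>c d. x = (\<Sum>e\<in>C \<union> J ` C. c e *\<^sub>R e + d e *\<^sub>R I e)" if "x \<in> V"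
  proof (intro exI)
    show "x = (\<Sum>e\<in>C \<union> J ` C. g e x *\<^sub>R e + g (I e) x *\<^sub>R I e)"
      unfolding sumC using ex[OF that] by (simp add: IJ CV add.assoc cong: sum.cong)
  qed
qed

section \<open>Differentiating the isotropy action\<close>

lemma has_vector_derivative_at_0I:
  fixes f :: "real \<Rightarrow> 'a::real_normed_vector"
  assumes "((\<lambda>t. (1/t) *\<^sub>R (f t - f 0)) \<longlongrightarrow> d) (at 0)"
  shows "(f has_vector_derivative d) (at 0)"
  unfolding has_vector_derivative_def has_derivative_iff_norm
proof
  show "bounded_linear (\<lambda>t. t *\<^sub>R d)" by (rule bounded_linear_scaleR_left)
  have 1: "((\<lambda>t. norm ((1/t) *\<^sub>R (f t - f 0) - d)) \<longlongrightarrow> 0) (at 0)"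
    using assms by (simp only: tendsto_norm_zero_iff LIM_zero_iff)
  have 2: "norm ((1/t) *\<^sub>R (f t - f 0) - d) = norm (f t - f 0 - (t - 0) *\<^sub>R d) / norm (t - 0)"
    if "t \<noteq> 0" for t
  proof -
    have "f t - f 0 - t *\<^sub>R d = t *\<^sub>R ((1/t) *\<^sub>R (f t - f 0) - d)" using that by (simp add: algebra_simps)
    then show ?thesis using that by simp
  qed
  show "((\<lambda>t. norm (f t - f 0 - (t - 0) *\<^sub>R d) / norm (t - 0)) \<longlongrightarrow> 0) (at 0)"
    by (rule Lim_transform_eventually[OF 1]) (simp only: eventually_at_filter, rule always_eventually, use 2 in blast)
qed

lemma rlin_extend:
  fixes V :: "'a::euclidean_space set" and f :: "'a \<Rightarrow> 'b::real_normed_vector"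
  assumes V: "subspace V" and f: "rlin V f"
  obtains l where "bounded_linear l" "\<And>x. x \<in> V \<Longrightarrow> l x = f x"
proof -
  obtain B where B: "B \<subseteq> V" "independent B" "V \<subseteq> span B" "finite B"
    using maximal_independent_subset[of V] finiteI_independent by metis
  obtain l where l: "linear l" "\<forall>x\<in>B. l x = f x" using linear_independent_extend[OF B(2)] by blast
  have "l x = f x" if "x \<in> V" for x
  proof -
    let ?r = "representation B x"
    have x: "x = (\<Sum>b\<in>B. ?r b *\<^sub>R b)"
      using B that by (intro sum_representation_eq[symmetric]) auto
    have "f x = f (\<Sum>b\<in>B. ?r b *\<^sub>R b)" using x by simp
    also have "\<dots> = (\<Sum>b\<in>B. ?r b *\<^sub>R f b)" using B by (intro rlin_scaled_sum[OF V f]) auto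
    also have "\<dots> = (\<Sum>b\<in>B. ?r b *\<^sub>R l b)" using l by (intro sum.cong) auto
    also have "\<dots> = l (\<Sum>b\<in>B. ?r b *\<^sub>R b)" using l(1) by (simp add: linear_sum linear_scale)
    finally show ?thesis using x by simp
  qed
  then show thesis using that l(1) linear_conv_bounded_linear by blast
qed

lemma bounded_bilinear_matrix_mult: "bounded_bilinear ((**) :: real^'k^'k \<Rightarrow> real^'k^'k \<Rightarrow> real^'k^'k)"
  unfolding bilinear_conv_bounded_bilinear[symmetric] bilinear_def
  by (auto intro!: linearI simp: matrix_add_ldistrib matrix_add_rdistrib matrix_scalar_ac scalar_matrix_assoc)

lemma mexp_scaleR:
  "mexp (t *\<^sub>R X) = (\<Sum>j. (t ^ j / fact j) *\<^sub>R (((**) X ^^ j) (mat 1)))"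
proof -
  have "((**) (t *\<^sub>R X) ^^ j) (mat 1) = t ^ j *\<^sub>R ((**) X ^^ j) (mat 1)" for j
    by (induction j) (simp_all add: matrix_scalar_ac scalar_matrix_assoc[symmetric] mult.commute)
  then show ?thesis by (simp add: mexp_def)
qed

lemma mexp_0: "mexp (0 *\<^sub>R X) = mat 1"
  using powser_zero[of "\<lambda>j. 1"] suminf_finite[of "{0::nat}" "\<lambda>j. (0 ^ j / fact j) *\<^sub>R (((**) X ^^ j) (mat 1))"]
  unfolding mexp_scaleR by simp

lemma mexp_derivative:
  fixes X :: "real^'k^'k"
  shows "((\<lambda>t. (1/t) *\<^sub>R (mexp (t *\<^sub>R X) - mexp (0 *\<^sub>R X))) \<longlongrightarrow> X) (at 0)"
proof (intro vec_tendstoI)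
  fix i j :: 'k
  define p where "p n = ((**) X ^^ n) (mat 1)" for n
  define c where "c n = p n $ i $ j / fact n" for n
  obtain K where K: "K > 0" "\<And>Y :: real^'k^'k. norm (X ** Y) \<le> norm Y * K"
    using bounded_linear.pos_bounded[OF bounded_bilinear.bounded_linear_right[OF bounded_bilinear_matrix_mult, of X]] by blast
  have pb: "norm (p n) \<le> K ^ n * norm (mat 1 :: real^'k^'k)" for n
  proof (induction n)
    case (Suc n)
    have "norm (p (Suc n)) \<le> norm (p n) * K" using K(2)[of "p n"] by (simp add: p_def)
    also have "\<dots> \<le> (K ^ n * norm (mat 1 :: real^'k^'k)) * K" using Suc K(1) by (intro mult_right_mono) auto
    finally show ?case by (simp add: mult_ac)
  qed (simp add: p_def)
  have sm: "summable (\<lambda>n. (t ^ n / fact n) *\<^sub>R p n)" for t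
  proof (rule summable_comparison_test')
    show "summable (\<lambda>n. inverse (fact n) * (\<bar>t\<bar> * K) ^ n * norm (mat 1 :: real^'k^'k))"
      by (intro summable_mult2 summable_exp)
    fix n
    have "norm ((t ^ n / fact n) *\<^sub>R p n) = (\<bar>t\<bar> ^ n / fact n) * norm (p n)" by (simp add: power_abs)
    also have "\<dots> \<le> (\<bar>t\<bar> ^ n / fact n) * (K ^ n * norm (mat 1 :: real^'k^'k))"
      by (intro mult_left_mono pb) simp
    finally show "norm ((t ^ n / fact n) *\<^sub>R p n) \<le> inverse (fact n) * (\<bar>t\<bar> * K) ^ n * norm (mat 1 :: real^'k^'k)"
      by (simp add: field_simps power_mult_distrib)
  qed
  have bl: "bounded_linear (\<lambda>M :: real^'k^'k. M $ i $ j)"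
    by (rule bounded_linear_compose[OF bounded_linear_vec_nth bounded_linear_vec_nth])
  have ent: "mexp (t *\<^sub>R X) $ i $ j = (\<Sum>n. c n * t ^ n)" for t
    using bounded_linear.suminf[OF bl sm, of t] unfolding mexp_scaleR p_def[symmetric]
    by (simp add: c_def mult_ac)
  have sc: "summable (\<lambda>n. c n * t ^ n)" for t
    using bounded_linear.summable[OF bl sm, of t] by (simp add: c_def mult_ac)
  have "((\<lambda>t. \<Sum>n. c n * t ^ n) has_field_derivative (\<Sum>n. diffs c n * 0 ^ n)) (at 0)"
    by (rule termdiffs_strong_converges_everywhere[OF sc])
  then have "((\<lambda>t. mexp (t *\<^sub>R X) $ i $ j) has_field_derivative X $ i $ j) (at 0)"
    unfolding ent powser_zero by (simp add: diffs_def c_def p_def)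
  then show "((\<lambda>t. ((1 / t) *\<^sub>R (mexp (t *\<^sub>R X) - mexp (0 *\<^sub>R X))) $ i $ j) \<longlongrightarrow> X $ i $ j) (at 0)"
    by (simp add: DERIV_def)
qed

lemma matrix_inv_mult:
  fixes A :: "real^'k^'k"
  assumes "invertible A"
  shows "A ** matrix_inv A = mat 1" "matrix_inv A ** A = mat 1"
proof -
  have "\<exists>B. A ** B = mat 1 \<and> B ** A = mat 1" using assms by (simp add: invertible_def)
  then have "A ** matrix_inv A = mat 1 \<and> matrix_inv A ** A = mat 1"
    unfolding matrix_inv_def by (rule someI_ex[where P="\<lambda>B. A ** B = mat 1 \<and> B ** A = mat 1"])
  then show "A ** matrix_inv A = mat 1" "matrix_inv A ** A = mat 1" by blast+
qed

text \<open>
  The curve \<open>Z\<close> of conjugates of \<open>Y\<close> by \<open>E\<close> is characterised by \<open>Z E = E Y\<close>. Working with this equation instead of the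
  inverse of \<open>E\<close> requires only the difference quotient of \<open>E\<close> at \<open>0\<close>, from which boundedness and then continuity of
  \<open>Z\<close> at \<open>0\<close> follow.
\<close>
lemma Ad_mexp_derivative:
  fixes X Y :: "real^'k^'k"
  assumes inv: "\<And>t. invertible (mexp (t *\<^sub>R X))"
  shows "((\<lambda>t. Ad (mexp (t *\<^sub>R X)) Y) has_vector_derivative lie_bracket X Y) (at 0)"
proof (rule has_vector_derivative_at_0I)
  define E where "E t = mexp (t *\<^sub>R X)" for t
  define Z where "Z t = Ad (E t) Y" for t
  define Q where "Q t = (1/t) *\<^sub>R (E t - mat 1)" for t
  have E0: "E 0 = mat 1" by (simp only: E_def mexp_0)
  have ZE: "Z t ** E t = E t ** Y" for t
  proof -
    have "matrix_inv (E t) ** E t = mat 1" unfolding E_def by (rule matrix_inv_mult[OF inv])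
    then show ?thesis by (simp add: Z_def Ad_def flip: matrix_mul_assoc)
  qed
  have Z0: "Z 0 = Y" using ZE[of 0] by (simp add: E0)
  have Q: "(Q \<longlongrightarrow> X) (at 0)"
    using mexp_derivative[of X] unfolding Q_def E_def mexp_0 .
  have "\<exists>c>0. \<forall>(A::real^'k^'k) (B::real^'k^'k). norm (A ** B) \<le> norm A * norm B * c"
    by (rule bounded_bilinear.pos_bounded[OF bounded_bilinear_matrix_mult])
  then obtain c where c0: "c > 0" and c1: "\<forall>(A::real^'k^'k) (B::real^'k^'k). norm (A ** B) \<le> norm A * norm B * c"
    by (elim exE conjE)
  note c = c0 c1[rule_format]
  have key: "Z t - Y = t *\<^sub>R (Q t ** Y - Z t ** Q t)" if "t \<noteq> 0" for t
  proof -
    have "E t = mat 1 + t *\<^sub>R Q t" using that by (simp add: Q_def)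
    then have "Z t ** (mat 1 + t *\<^sub>R Q t) = (mat 1 + t *\<^sub>R Q t) ** Y" using ZE[of t] by simp
    then have "Z t + t *\<^sub>R (Z t ** Q t) = Y + t *\<^sub>R (Q t ** Y)"
      by (simp add: matrix_add_ldistrib matrix_add_rdistrib matrix_scalar_ac scalar_matrix_assoc[symmetric])
    then show ?thesis by (simp add: algebra_simps)
  qed
  have small: "((\<lambda>t. \<bar>t\<bar> * (norm (Q t) * c)) \<longlongrightarrow> 0) (at 0)"
    by (rule tendsto_eq_intros Q refl | simp)+
  have ZY: "((\<lambda>t. Z t - Y) \<longlongrightarrow> 0) (at 0)"
  proof (rule Lim_null_comparison)
    have "\<forall>\<^sub>F t in at 0. \<bar>t\<bar> * (norm (Q t) * c) < 1/2"
      using small by (rule order_tendstoD) simp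
    moreover have "\<forall>\<^sub>F t in at (0::real). t \<noteq> 0" by (simp add: eventually_at_filter)
    ultimately show "\<forall>\<^sub>F t in at 0. norm (Z t - Y) \<le> \<bar>t\<bar> * (norm (Q t) * c) * (4 * norm Y)"
    proof eventually_elim
      case (elim t)
      let ?q = "\<bar>t\<bar> * (norm (Q t) * c)"
      have q0: "?q \<ge> 0" using c by simp
      have "norm (Z t - Y) \<le> \<bar>t\<bar> * (norm (Q t ** Y) + norm (Z t ** Q t))"
        unfolding key[OF elim(2)] by (simp add: mult_left_mono norm_triangle_ineq4)
      also have "\<dots> \<le> \<bar>t\<bar> * (norm (Q t) * norm Y * c + norm (Z t) * norm (Q t) * c)"
        using c(2)[of "Q t" Y] c(2)[of "Z t" "Q t"] by (intro mult_left_mono add_mono) auto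
      finally have 1: "norm (Z t - Y) \<le> ?q * (norm Y + norm (Z t))" by (simp add: algebra_simps)
      have "norm (Z t) \<le> norm Y + norm (Z t - Y)" using norm_triangle_ineq[of Y "Z t - Y"] by simp
      also have "\<dots> \<le> norm Y + ?q * (norm Y + norm (Z t))" using 1 by simp
      also have "\<dots> \<le> norm Y + (1/2) * (norm Y + norm (Z t))"
        using elim(1) by (intro add_left_mono mult_right_mono) auto
      finally have "norm (Z t) \<le> 3 * norm Y" by (simp add: field_simps)
      then have "?q * (norm Y + norm (Z t)) \<le> ?q * (4 * norm Y)"
        using q0 by (intro mult_left_mono) auto
      with 1 show ?case by simp
    qed
    show "((\<lambda>t. \<bar>t\<bar> * (norm (Q t) * c) * (4 * norm Y)) \<longlongrightarrow> 0) (at 0)"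
      by (rule tendsto_eq_intros small refl | simp)+
  qed
  then have Z: "(Z \<longlongrightarrow> Y) (at 0)" by (simp add: LIM_zero_iff)
  have "((\<lambda>t. Q t ** Y - Z t ** Q t) \<longlongrightarrow> X ** Y - Y ** X) (at 0)"
    by (intro tendsto_diff bounded_bilinear.tendsto[OF bounded_bilinear_matrix_mult] tendsto_const Q Z)
  then have "((\<lambda>t. (1/t) *\<^sub>R (Z t - Z 0)) \<longlongrightarrow> X ** Y - Y ** X) (at 0)"
    by (rule Lim_transform_eventually) (auto simp: eventually_at_filter key Z0)
  then show "((\<lambda>t. (1/t) *\<^sub>R (Ad (mexp (t *\<^sub>R X)) Y - Ad (mexp (0 *\<^sub>R X)) Y)) \<longlongrightarrow> lie_bracket X Y) (at 0)"
    by (simp add: Z_def E_def lie_bracket_def)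
qed

lemma (in quat_basis) form_derivative:
  assumes A: "\<And>v. v \<in> V \<Longrightarrow> ((\<lambda>t. A t v) has_vector_derivative X v) (at 0)"
    and AV: "\<And>t v. v \<in> V \<Longrightarrow> A t v \<in> V" and XV: "\<And>v. v \<in> V \<Longrightarrow> X v \<in> V"
    and A0: "\<And>v. v \<in> V \<Longrightarrow> A 0 v = v"
    and "antihol_on V I \<alpha>" "set vs \<subseteq> V"
  shows "((\<lambda>t. \<alpha> (map (A t) vs)) has_vector_derivative form_deriv X \<alpha> vs) (at 0)"
  using assms(5,6)
proof (induction vs arbitrary: \<alpha>)
  case (Cons v vs)
  have v: "v \<in> V" and vs: "set vs \<subseteq> V" using Cons.prems by auto
  have Avs: "set (map (A t) vs) \<subseteq> V" for t using vs AV by auto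
  have A0vs: "map (A 0) vs = vs" using vs A0 by (simp add: map_idI subset_iff)
  note a = Cons.prems(1)
  note ai = antihol_on_int_prod[OF a B_in V I_in]
  have ge: "((\<lambda>t. g e (A t v)) has_vector_derivative g e (X v)) (at 0)" if e: "e \<in> B" for e
  proof -
    obtain l where l: "bounded_linear l" "\<And>x. x \<in> V \<Longrightarrow> l x = g e x"
      using rlin_extend[OF V g_lin2[OF B_in[OF e]]] by blast
    show ?thesis
      using bounded_linear.has_vector_derivative[OF l(1) A[OF v]] by (simp add: l(2) AV XV v)
  qed
  have "((\<lambda>t. \<Sum>e\<in>B. of_real (g e (A t v)) * int_prod e \<alpha> (map (A t) vs)) has_vector_derivative
      (\<Sum>e\<in>B. of_real (g e (A 0 v)) * form_deriv X (int_prod e \<alpha>) vs + of_real (g e (X v)) * int_prod e \<alpha> (map (A 0) vs))) (at 0)"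
    by (intro has_vector_derivative_sum has_vector_derivative_mult Cons.IH ai vs
        bounded_linear.has_vector_derivative[OF bounded_linear_of_real] ge) auto
  moreover have "(\<Sum>e\<in>B. of_real (g e (A t v)) * int_prod e \<alpha> (map (A t) vs)) = \<alpha> (map (A t) (v # vs))" for t
    using clin_expand[OF antihol_on_clin[OF V I_in a Avs] AV[OF v]] by (simp add: int_prod_def)
  moreover have "(\<Sum>e\<in>B. of_real (g e (A 0 v)) * form_deriv X (int_prod e \<alpha>) vs + of_real (g e (X v)) * int_prod e \<alpha> (map (A 0) vs))
     = form_deriv X \<alpha> (v # vs)"
  proof -
    have "(\<Sum>e\<in>B. of_real (g e v) * form_deriv X (int_prod e \<alpha>) vs) = form_deriv X (int_prod v \<alpha>) vs"
    proof (rule clin_expand[OF _ v])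
      show "clin V (\<lambda>e. form_deriv X (int_prod e \<alpha>) vs)"
        unfolding clin_def
      proof (intro ballI allI)
        fix x y a b assume x: "x \<in> V" and y: "y \<in> V"
        have sc: "form_deriv X (\<lambda>us. c * \<beta> us) ws = c * form_deriv X \<beta> ws" for c \<beta> ws
          by (induction ws arbitrary: \<beta>) (simp_all add: int_prod_def algebra_simps)
        have ad: "form_deriv X (\<lambda>us. \<beta> us + \<gamma> us) ws = form_deriv X \<beta> ws + form_deriv X \<gamma> ws" for \<beta> \<gamma> ws
          by (induction ws arbitrary: \<beta> \<gamma>) (simp_all add: int_prod_def algebra_simps)
        have "form_deriv X (int_prod (a *\<^sub>R x + b *\<^sub>R y) \<alpha>) vs = form_deriv X (\<lambda>us. of_real a * int_prod x \<alpha> us + of_real b * int_prod y \<alpha> us) vs"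
          by (rule form_deriv_cong[OF vs XV]) (simp_all add: int_prod_def antihol_on_lin[OF a x y])
        then show "form_deriv X (int_prod (a *\<^sub>R x + b *\<^sub>R y) \<alpha>) vs = of_real a * form_deriv X (int_prod x \<alpha>) vs + of_real b * form_deriv X (int_prod y \<alpha>) vs"
          by (simp add: ad sc)
      qed
    qed
    moreover have "(\<Sum>e\<in>B. of_real (g e (X v)) * int_prod e \<alpha> vs) = \<alpha> (X v # vs)"
      using clin_expand[OF antihol_on_clin[OF V I_in a vs] XV[OF v]] by (simp add: int_prod_def)
    ultimately show ?thesis using A0[OF v] A0vs by (simp add: sum.distrib)
  qed
  ultimately show ?case by simp
qed simp

section \<open>Support and degree of wedge products\<close>
lemma wedge_eq_0_support:
  assumes "\<And>us. x \<in> set us \<Longrightarrow> \<alpha> us = 0" "\<And>us. x \<in> set us \<Longrightarrow> \<beta> us = 0" "x \<in> set vs"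
  shows "wedge \<alpha> \<beta> vs = 0"
proof -
  obtain i where i: "i < length vs" "vs ! i = x" using assms(3) by (auto simp: in_set_conv_nth)
  have "\<alpha> (nths vs S) * \<beta> (nths vs (- S)) = 0" for S
  proof (cases "i \<in> S")
    case True
    then have "x \<in> set (nths vs S)" using i by (auto simp: set_nths)
    then show ?thesis using assms(1) by simp
  next
    case False
    then have "x \<in> set (nths vs (- S))" using i by (auto simp: set_nths)
    then show ?thesis using assms(2) by simp
  qed
  then show ?thesis unfolding wedge_def by (intro sum.neutral) (simp add: mult.assoc)
qed

lemma length_nths_add: "length (nths xs S) + length (nths xs (- S)) = length xs"
proof (induction xs arbitrary: S)
  case (Cons x xs)
  have "{j. Suc j \<in> - S} = - {j. Suc j \<in> S}" by auto
  then show ?case using Cons[of "{j. Suc j \<in> S}"] by (auto simp: nths_Cons)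
qed simp

definition bounded_degree :: "'a form \<Rightarrow> bool" where
  "bounded_degree \<alpha> \<longleftrightarrow> (\<exists>n. \<forall>vs. length vs > n \<longrightarrow> \<alpha> vs = 0)"

lemma bounded_degree_wedge:
  assumes "bounded_degree \<alpha>" "bounded_degree \<beta>" shows "bounded_degree (wedge \<alpha> \<beta>)"
proof -
  obtain m n where m: "\<And>vs. length vs > m \<Longrightarrow> \<alpha> vs = 0" and n: "\<And>vs. length vs > n \<Longrightarrow> \<beta> vs = 0"
    using assms unfolding bounded_degree_def by blast
  have "wedge \<alpha> \<beta> vs = 0" if "length vs > m + n" for vs
    unfolding wedge_def
  proof (intro sum.neutral ballI)
    fix S
    have "length (nths vs S) > m \<or> length (nths vs (- S)) > n"
      using length_nths_add[of vs S] that by linarith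
    then have "\<alpha> (nths vs S) = 0 \<or> \<beta> (nths vs (- S)) = 0" using m n by blast
    then show "(- 1) ^ card {(i, j). i \<in> S \<and> j \<in> {..<length vs} - S \<and> j < i} * \<alpha> (nths vs S) * \<beta> (nths vs (- S)) = 0"
      by auto
  qed
  then show ?thesis unfolding bounded_degree_def by blast
qed

lemma bounded_degree_wedge_generated:
  assumes "\<alpha> \<in> wedge_generated S" "\<And>\<beta>. \<beta> \<in> S \<Longrightarrow> bounded_degree \<beta>"
  shows "bounded_degree \<alpha>"
  using assms(1)
proof induction
  case one show ?case unfolding bounded_degree_def fone_def by (intro exI[of _ 0]) auto
next
  case (add \<alpha> \<beta>)
  then obtain m n where "\<forall>vs. length vs > m \<longrightarrow> \<alpha> vs = 0" "\<forall>vs. length vs > n \<longrightarrow> \<beta> vs = 0"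
    unfolding bounded_degree_def by blast
  then show ?case unfolding bounded_degree_def fadd_def by (intro exI[of _ "max m n"]) auto
next
  case (scale \<alpha> z)
  then show ?case unfolding bounded_degree_def fscale_def by auto
qed (use assms(2) bounded_degree_wedge in auto)

lemma wedge_generated_fzero: "(\<lambda>vs. 0) \<in> wedge_generated S"
  using wedge_generated.scale[OF wedge_generated.one, where z=0] by (simp add: fscale_def)

lemma wedge_generated_sum:
  "(\<And>i. i \<in> A \<Longrightarrow> f i \<in> wedge_generated S) \<Longrightarrow> (\<lambda>vs. \<Sum>i\<in>A. f i vs) \<in> wedge_generated S"
proof (induction A rule: infinite_finite_induct)
  case (insert i A)
  then show ?case using wedge_generated.add[of "f i" S "\<lambda>vs. \<Sum>i\<in>A. f i vs"] by (simp add: fadd_def)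
qed (simp_all add: wedge_generated_fzero)

context sasaki
begin

section \<open>Isometries preserving the structure\<close>

context
  fixes A assumes A: "A \<in> Sp_hor D"
begin

lemma Sp_T: "X \<in> T \<Longrightarrow> A X \<in> T"
  using A by (auto simp: Sp_hor_def)

lemma Sp_lin: "rlin T A"
  using A by (simp add: Sp_hor_def rlin_def)

lemma Sp_met: "X \<in> T \<Longrightarrow> Y \<in> T \<Longrightarrow> met (A X) (A Y) = met X Y"
  using A by (simp add: Sp_hor_def)

lemma Sp_xi: "i \<in> {1,2,3} \<Longrightarrow> A (xi i) = xi i"
  using A unfolding Sp_hor_def by blast

lemma Sp_phi: "X \<in> T \<Longrightarrow> i \<in> {1,2,3} \<Longrightarrow> A (phi D i X) = phi D i (A X)"
  using A unfolding Sp_hor_def by blast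

lemma Sp_Ve: assumes "v \<in> Ve" shows "A v = v"
proof -
  have "A v = A (met (xi 1) v *\<^sub>R xi 1 + met (xi 2) v *\<^sub>R xi 2 + met (xi 3) v *\<^sub>R xi 3)"
    using Ve_expand[OF assms] by simp
  also have "\<dots> = met (xi 1) v *\<^sub>R xi 1 + met (xi 2) v *\<^sub>R xi 2 + met (xi 3) v *\<^sub>R xi 3"
    using subspaces(6) Sp_xi[of 1] Sp_xi[of 2] Sp_xi[of 3]
    by (simp add: rlin_add[OF subspaces(6) Sp_lin] rlin_scale[OF subspaces(6) Sp_lin] subspace_add subspace_scale)
  finally show ?thesis using Ve_expand[OF assms] by simp
qed

lemma Sp_P: assumes p: "p \<in> P" shows "A p \<in> P"
proof -
  note Ap = Sp_T[OF P_T[OF p]]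
  have "met (xi i) (ver D (A p)) = 0" if i: "i \<in> {1,2,3}" for i
  proof -
    have "met (xi i) (ver D (A p)) = met (xi i) (ver D (A p)) + met (xi i) (hor D (A p))"
      using met_Ve_P(1)[OF xi_Ve[OF i] ver_hor(2)[OF Ap]] by simp
    also have "\<dots> = met (xi i) (A p)"
      using rlin_add[OF subspaces(6) met_lin2[OF xi_T[OF i]] Ve_T[OF ver_hor(1)[OF Ap]] P_T[OF ver_hor(2)[OF Ap]]]
        ver_hor(3)[OF Ap] by simp
    also have "\<dots> = met (A (xi i)) (A p)" using Sp_xi[OF i] by simp
    also have "\<dots> = 0" using Sp_met[OF xi_T[OF i] P_T[OF p]] met_Ve_P(1)[OF xi_Ve[OF i] p] by simp
    finally show ?thesis .
  qed
  from this[of 1] this[of 2] this[of 3] have "ver D (A p) = 0" using Ve_expand[OF ver_hor(1)[OF Ap]] by simp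
  then show ?thesis using ver_hor(2,3)[OF Ap] by simp
qed

lemma Sp_hor: assumes X: "X \<in> T" shows "hor D (A X) = A (hor D X)"
proof -
  have "A X = A (ver D X + hor D X)" using ver_hor(3)[OF X] by simp
  also have "\<dots> = ver D X + A (hor D X)"
    using rlin_add[OF subspaces(6) Sp_lin Ve_T[OF ver_hor(1)[OF X]] P_T[OF ver_hor(2)[OF X]]]
      Sp_Ve[OF ver_hor(1)[OF X]] by simp
  finally show ?thesis using hor_eq[OF ver_hor(1)[OF X] Sp_P[OF ver_hor(2)[OF X]]] by simp
qed

lemma Sp_qisom: "Q.qisom A"
  unfolding Q.qisom_def Q.qlin_def
  using Sp_lin Sp_P P_T Sp_met Sp_phi by (auto simp: rlin_def)

end

lemma isotropy_Sp: "h \<in> Iso D \<Longrightarrow> isotropy D h \<in> Sp_hor D"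
  using sc by (simp add: sc_homogeneous_3_sasakian_def)

lemma isotropy_eq: "X \<in> T \<Longrightarrow> isotropy D h X = Ad h X"
  by (simp add: isotropy_def)

lemma Iso_group: "h \<in> Iso D \<Longrightarrow> invertible h \<and> matrix_inv h \<in> Iso D"
  using sc by (simp add: sc_homogeneous_3_sasakian_def matrix_group_def)

lemma isotropy_inverse:
  assumes h: "h \<in> Iso D" and X: "X \<in> T"
  shows "isotropy D h (isotropy D (matrix_inv h) X) = X"
proof -
  let ?k = "matrix_inv h"
  have k: "?k \<in> Iso D" "invertible h" using Iso_group[OF h] by auto
  have hk: "h ** ?k = mat 1" "?k ** h = mat 1" using matrix_inv_mult[OF k(2)] by auto
  have k2: "?k ** matrix_inv ?k = mat 1" using matrix_inv_mult Iso_group[OF k(1)] by blast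
  have "matrix_inv ?k = h ** ?k ** matrix_inv ?k" by (simp add: hk)
  also have "\<dots> = h" unfolding matrix_mul_assoc[symmetric] k2 by simp
  finally have kk: "matrix_inv ?k = h" .
  have "Ad h (Ad ?k X) = (h ** ?k) ** X ** (h ** ?k)" by (simp add: Ad_def kk matrix_mul_assoc)
  also have "\<dots> = X" by (simp add: hk)
  finally show ?thesis using Sp_T[OF isotropy_Sp[OF k(1)] X] X by (simp add: isotropy_eq)
qed

section \<open>Antiholomorphic forms on the tangent space\<close>

text \<open>
  The induction on the degree runs over all forms with these properties, since a contraction visibly inherits them; that
  the forms in question are sums of wedge products is its conclusion.
\<close>
definition antihol_form :: "(real^'k^'k) form \<Rightarrow> bool" where
  "antihol_form \<alpha> \<longleftrightarrow> antihol_on T (phi D 1) \<alpha> \<and> (\<forall>vs. \<not> set vs \<subseteq> T \<longrightarrow> \<alpha> vs = 0)"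

definition iso_invariant :: "(real^'k^'k) form \<Rightarrow> bool" where
  "iso_invariant \<alpha> \<longleftrightarrow> (\<forall>h\<in>Iso D. \<forall>vs. set vs \<subseteq> T \<longrightarrow> \<alpha> (map (isotropy D h) vs) = \<alpha> vs)"

lemma antihol_form_on: "antihol_form \<alpha> \<Longrightarrow> antihol_on T (phi D 1) \<alpha>" and antihol_form_off: "antihol_form \<alpha> \<Longrightarrow> \<not> set vs \<subseteq> T \<Longrightarrow> \<alpha> vs = 0"
  by (simp_all add: antihol_form_def)

lemma phi1_T: "X \<in> T \<Longrightarrow> phi D 1 X \<in> T" by (simp add: phi_in_T)

lemma antihol_form_fone: "antihol_form fone" by (simp add: antihol_form_def antihol_on_fone) (auto simp: fone_def)
lemma antihol_form_fadd: "antihol_form \<alpha> \<Longrightarrow> antihol_form \<beta> \<Longrightarrow> antihol_form (fadd \<alpha> \<beta>)"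
  by (simp add: antihol_form_def antihol_on_fadd) (simp add: fadd_def)
lemma antihol_form_fscale: "antihol_form \<alpha> \<Longrightarrow> antihol_form (fscale z \<alpha>)"
  by (simp add: antihol_form_def antihol_on_fscale) (simp add: fscale_def)
lemma antihol_form_ins: "antihol_form \<alpha> \<Longrightarrow> v \<in> T \<Longrightarrow> antihol_form (int_prod v \<alpha>)"
  using antihol_on_int_prod[OF _ _ subspaces(6) phi1_T] by (simp add: antihol_form_def) (simp add: int_prod_def)
lemma antihol_form_sum: "(\<And>i. i \<in> S \<Longrightarrow> antihol_form (f i)) \<Longrightarrow> antihol_form (\<lambda>vs. \<Sum>i\<in>S. f i vs)"
  unfolding antihol_form_def by (auto intro!: antihol_on_sum sum.neutral)

lemma antihol_form_wedge: assumes "antihol_form \<alpha>" "antihol_form \<beta>" shows "antihol_form (wedge \<alpha> \<beta>)"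
  unfolding antihol_form_def
proof (intro conjI allI impI)
  show "antihol_on T (phi D 1) (wedge \<alpha> \<beta>)"
    using assms by (intro antihol_on_wedge subspaces phi1_T) (auto simp: antihol_form_def)
  fix vs assume "\<not> set vs \<subseteq> T"
  then obtain x where "x \<in> set vs" "x \<notin> T" by blast
  then show "wedge \<alpha> \<beta> vs = 0"
    using antihol_form_off[OF assms(1)] antihol_form_off[OF assms(2)] by (intro wedge_eq_0_support[of x]) auto
qed

lemma eigen1D:
  assumes "y \<in> eigen1 D (- \<i>)"
  shows "fst y \<in> T" "snd y \<in> T" "phi D 1 (fst y) = snd y" "phi D 1 (snd y) = - fst y"
    "met (xi 1) (fst y) = 0"
  using assms by (auto simp: eigen1_def perp1_def cscale_def map_prod_def prod_eq_iff)

lemma antihol_form_flat: assumes y: "y \<in> eigen1 D (- \<i>)" shows "antihol_form (flat D y)"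
proof -
  note e = eigen1D[OF y]
  have l: "flat D y us = 0" if "length us \<noteq> 1" for us
    using that by (auto simp: flat_def split: list.splits)
  have v: "flat D y [x] = of_real (met (fst y) x) + \<i> * of_real (met (snd y) x)" if "x \<in> T" for x
    using that by (simp add: flat_def)
  show ?thesis
    unfolding antihol_form_def
  proof (intro conjI antihol_onI allI impI)
    show "flat D y (us @ v # w # ws) = - flat D y (us @ w # v # ws)" for us v w ws
      by (simp add: l)
  next
    fix a b :: real and v w ws assume h: "v \<in> T" "w \<in> T" "set ws \<subseteq> T"
    have "a *\<^sub>R v + b *\<^sub>R w \<in> T" using h subspaces(6) by (simp add: subspace_add subspace_scale)
    then show "flat D y ((a *\<^sub>R v + b *\<^sub>R w) # ws) = of_real a * flat D y (v # ws) + of_real b * flat D y (w # ws)"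
      using h rlinD[OF met_lin2[OF e(1)] h(1,2), of a b] rlinD[OF met_lin2[OF e(2)] h(1,2), of a b]
      by (cases ws) (simp_all add: v l algebra_simps)
  next
    fix v' ws assume h: "v' \<in> T" "set ws \<subseteq> T"
    have "met (fst y) (phi D 1 v') = - met (snd y) v'" "met (snd y) (phi D 1 v') = met (fst y) v'"
      using phi_skew[OF e(1) h(1), of 1] phi_skew[OF e(2) h(1), of 1] e h
        rlin_minus[OF subspaces(6) met_lin[OF h(1)] e(1)] by simp_all
    then show "flat D y (phi D 1 v' # ws) = \<i> * flat D y (v' # ws)"
      using h phi1_T[OF h(1)] by (cases ws) (simp_all add: v l algebra_simps)
  next
    show "flat D y vs = 0" if "\<not> set vs \<subseteq> T" for vs
      using that by (auto simp: flat_def split: list.splits)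
  qed
qed

lemma antihol_form_antihol: "\<alpha> \<in> antihol_forms D \<Longrightarrow> antihol_form \<alpha>"
  unfolding antihol_forms_def
  by (induction rule: wedge_generated.induct)
     (auto intro: antihol_form_fone antihol_form_flat antihol_form_fadd antihol_form_fscale antihol_form_wedge)

lemma antihol_bounded: "\<alpha> \<in> antihol_forms D \<Longrightarrow> bounded_degree \<alpha>"
  unfolding antihol_forms_def
  by (erule bounded_degree_wedge_generated)
     (auto simp: bounded_degree_def flat_def intro!: exI[of _ 1] split: list.splits)

lemma iso_invariant_wedge: assumes "iso_invariant \<alpha>" "iso_invariant \<beta>" shows "iso_invariant (wedge \<alpha> \<beta>)"
  unfolding iso_invariant_def wedge_map
proof (intro ballI allI impI)
  fix h vs assume h: "h \<in> Iso D" and vs: "set vs \<subseteq> T"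
  show "wedge (\<lambda>us. \<alpha> (map (isotropy D h) us)) (\<lambda>us. \<beta> (map (isotropy D h) us)) vs = wedge \<alpha> \<beta> vs"
    using assms h vs unfolding iso_invariant_def by (intro wedge_cong) (meson order_trans)+
qed

section \<open>The generators\<close>

lemma y1_eigen: "cscale (of_real (1 / sqrt 2)) (xi 2, xi 3) \<in> eigen1 D (- \<i>)"
proof -
  have s: "s *\<^sub>R xi 2 \<in> T" "s *\<^sub>R xi 3 \<in> T" for s using subspaces(6) by (simp_all add: subspace_scale)
  have m: "met (xi 1) (s *\<^sub>R xi 2) = 0" "met (xi 1) (s *\<^sub>R xi 3) = 0" for s
    using rlin_scale[OF subspaces(6) met_lin2] xi_met by simp_all
  have p: "phi D 1 (s *\<^sub>R xi 2) = s *\<^sub>R xi 3" "phi D 1 (s *\<^sub>R xi 3) = - (s *\<^sub>R xi 2)" for s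
    using rlin_scale[OF subspaces(6) phi_lin] phi_xi by simp_all
  show ?thesis by (simp add: eigen1_def perp1_def cscale_def s m p)
qed

lemma y1_at: "x \<in> T \<Longrightarrow> y1_form D [x] = (of_real (met (xi 2) x) + \<i> * of_real (met (xi 3) x)) / of_real (sqrt 2)"
  using rlin_scale[OF subspaces(6) met_lin[of x], of "xi 2"] rlin_scale[OF subspaces(6) met_lin[of x], of "xi 3"]
  by (simp add: y1_form_def flat_def cscale_def field_simps)

lemma y1_length: "length us \<noteq> 1 \<Longrightarrow> y1_form D us = 0"
  by (auto simp: y1_form_def flat_def split: list.splits)

lemma y1_antihol: "y1_form D \<in> antihol_forms D"
  unfolding antihol_forms_def y1_form_def using y1_eigen by (intro wedge_generated.gen) blast

lemma iso_invariant_y1: "iso_invariant (y1_form D)"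
  unfolding iso_invariant_def
proof (intro ballI allI impI)
  fix h vs assume h: "h \<in> Iso D" and vs: "set vs \<subseteq> T"
  note A = isotropy_Sp[OF h]
  have "met (xi i) (isotropy D h x) = met (xi i) x" if "x \<in> T" "i \<in> {1,2,3}" for x i
    using Sp_met[OF A xi_T[OF that(2)] that(1)] Sp_xi[OF A that(2)] by simp
  from this[of _ 2] this[of _ 3]
  have "y1_form D [isotropy D h x] = y1_form D [x]" if "x \<in> T" for x
    using that Sp_T[OF A that] by (simp add: y1_at)
  then show "y1_form D (map (isotropy D h) vs) = y1_form D vs"
    using vs by (cases "length vs = 1") (auto simp: y1_length length_Suc_conv One_nat_def)
qed

lemma omega_at: "x \<in> T \<Longrightarrow> y \<in> T \<Longrightarrow> omega_form D [x, y] = Q.omega_val (hor D x) (hor D y)"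
  by (simp add: omega_form_def Q.omega_val_def Phi_def)

lemma omega_P: "x \<in> P \<Longrightarrow> y \<in> P \<Longrightarrow> omega_form D [x, y] = Q.omega_val x y"
  by (simp add: omega_at P_T)

lemma omega_length: "length us \<noteq> 2 \<Longrightarrow> omega_form D us = 0"
  by (auto simp: omega_form_def split: list.splits)

lemma iso_invariant_omega: "iso_invariant (omega_form D)"
  unfolding iso_invariant_def
proof (intro ballI allI impI)
  fix h vs assume h: "h \<in> Iso D" and vs: "set vs \<subseteq> T"
  let ?A = "isotropy D h"
  note A = isotropy_Sp[OF h]
  have "Q.omega_val (?A x) (?A y) = Q.omega_val x y" if "x \<in> P" "y \<in> P" for x y
  proof -
    have "met (?A x) (phi D i (?A y)) = met x (phi D i y)" if i: "i \<in> {1,2,3}" for i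
      using Sp_phi[OF A P_T[OF \<open>y \<in> P\<close>] i] Sp_met[OF A P_T[OF \<open>x \<in> P\<close>] P_T[OF phi_in_P[OF \<open>y \<in> P\<close> i]]] by simp
    from this[of 2] this[of 3] show ?thesis by (simp add: Q.omega_val_def)
  qed
  then have "omega_form D [?A x, ?A y] = omega_form D [x, y]" if "x \<in> T" "y \<in> T" for x y
    using that Sp_T[OF A] ver_hor(2) by (simp add: omega_at Sp_hor[OF A])
  then show "omega_form D (map ?A vs) = omega_form D vs"
    using vs by (cases "length vs = 2") (auto simp: omega_length length_Suc_conv numeral_2_eq_2)
qed

lemma odd_basis:
  obtains B C where "quat_curv P (metric D) (phi D 1) (phi D 2) (phi D 3) B curv"
    "finite C" "C \<subseteq> P" "card B = 2 * card C"
    "\<And>x. x \<in> P \<Longrightarrow> \<exists>c d. x = (\<Sum>e\<in>C. c e *\<^sub>R e + d e *\<^sub>R phi D 1 e)"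
proof -
  have "Q.qisom (\<lambda>x. x)" by (simp add: Q.qisom_def Q.qlin_def rlin_def)
  then obtain C where C: "Q.qframe P C" using Q.qframe_V by metis
  note F = Q.frame_basis[OF C]
  show thesis by (rule that[OF quat_curv[OF F(1)] F(3,4,2,5)])
qed

text \<open>
  \<open>\<omega>\<close> is half the sum of \<open>f\<^sub>e \<and> w\<^sub>e\<close> over an orthonormal basis, where the \<open>(-i)\<close>-eigenvectors
  \<open>f\<^sub>e = (e + i \<phi>\<^sub>1 e)/2\<close> and \<open>w\<^sub>e = (\<phi>\<^sub>2 e + i \<phi>\<^sub>3 e)/2\<close> represent the projection of \<open>e\<close> and the covector obtained by
  inserting \<open>e\<close> into \<open>\<omega>\<close>.
\<close>
lemma omega_antihol: "omega_form D \<in> antihol_forms D"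
proof -
  obtain B C where "quat_curv P (metric D) (phi D 1) (phi D 2) (phi D 3) B curv"
    using odd_basis by metis
  then interpret R: quat_curv P "metric D" "phi D 1" "phi D 2" "phi D 3" B curv .
  define f where "f e = ((1/2) *\<^sub>R e, (1/2) *\<^sub>R phi D 1 e)" for e
  define w where "w e = ((1/2) *\<^sub>R phi D 2 e, (1/2) *\<^sub>R phi D 3 e)" for e
  have perp: "x \<in> perp1 D" if "x \<in> P" for x
    using that met_Ve_P(1)[OF xi_T'(5)] P_T by (simp add: perp1_def)
  have fe: "f e \<in> eigen1 D (- \<i>)" and we: "w e \<in> eigen1 D (- \<i>)" if "e \<in> B" for e
    using R.B_in[OF that]
    by (simp_all add: f_def w_def eigen1_def cscale_def perp Q.V_in Q.I_simps Q.II Q.IJ Q.K_mult)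
  have "omega_form D vs = (\<Sum>e\<in>B. fscale (1/2) (wedge (flat D (f e)) (flat D (w e))) vs)" for vs
  proof (cases "\<exists>x y. vs = [x, y] \<and> x \<in> T \<and> y \<in> T")
    case False
    have "wedge (flat D (f e)) (flat D (w e)) vs = 0" if e: "e \<in> B" for e
    proof (cases "set vs \<subseteq> T")
      case True
      then have "length vs \<noteq> 2" using False by (auto simp: length_Suc_conv numeral_2_eq_2)
      have l: "flat D y us = 0" if "length us \<noteq> 1" for us y
        using that by (auto simp: flat_def split: list.splits)
      have "flat D (f e) (nths vs S) * flat D (w e) (nths vs (- S)) = 0" for S
        using length_nths_add[of vs S] \<open>length vs \<noteq> 2\<close> l
        by (cases "length (nths vs S) = 1") auto
      then show ?thesis unfolding wedge_def by (intro sum.neutral) (simp add: mult.assoc)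
    next
      case False
      then show ?thesis using antihol_form_off[OF antihol_form_wedge[OF antihol_form_flat[OF fe[OF e]] antihol_form_flat[OF we[OF e]]]] by blast
    qed
    moreover have "omega_form D vs = 0" using False by (auto simp: omega_form_def split: list.splits)
    ultimately show ?thesis by (simp add: fscale_def)
  next
    case True
    then obtain x y where vs: "vs = [x, y]" and x: "x \<in> T" and y: "y \<in> T" by blast
    define u v where "u = hor D x" and "v = hor D y"
    have u: "u \<in> P" and v: "v \<in> P" using ver_hor(2) x y by (auto simp: u_def v_def)
    have mh: "met p z = met p (hor D z)" if "p \<in> P" "z \<in> T" for p z
    proof -
      have "met p z = met p (ver D z + hor D z)" using ver_hor(3)[OF that(2)] by simp
      also have "\<dots> = met p (ver D z) + met p (hor D z)"
        using rlin_add[OF subspaces(6) met_lin2[OF P_T[OF that(1)]]] ver_hor[OF that(2)] Ve_T P_T by blast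
      finally show ?thesis using met_Ve_P(2)[OF ver_hor(1)[OF that(2)] that(1)] by simp
    qed
    have f1: "flat D (f e) [z] = (1/2) * (of_real (met e p) - \<i> * of_real (met e (phi D 1 p)))"
      if "e \<in> B" "z \<in> T" "p = hor D z" for e z p
    proof -
      have e: "e \<in> P" and p: "p \<in> P" using R.B_in that ver_hor(2) by auto
      have 1: "met ((1/2) *\<^sub>R e) z = met e p / 2" "met ((1/2) *\<^sub>R phi D 1 e) z = - met e (phi D 1 p) / 2"
        using that e p mh[of "(1/2) *\<^sub>R e" z] mh[of "(1/2) *\<^sub>R phi D 1 e" z]
        by (simp_all add: Q.V_in Q.g_simps Q.I_skew)
      show ?thesis using that(2) by (simp add: flat_def f_def 1 field_simps)
    qed
    have w1: "flat D (w e) [z] = - (1/2) * (of_real (met e (phi D 2 p)) + \<i> * of_real (met e (phi D 3 p)))"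
      if "e \<in> B" "z \<in> T" "p = hor D z" for e z p
    proof -
      have e: "e \<in> P" and p: "p \<in> P" using R.B_in that ver_hor(2) by auto
      have 1: "met ((1/2) *\<^sub>R phi D 2 e) z = - met e (phi D 2 p) / 2" "met ((1/2) *\<^sub>R phi D 3 e) z = - met e (phi D 3 p) / 2"
        using that e p mh[of "(1/2) *\<^sub>R phi D 2 e" z] mh[of "(1/2) *\<^sub>R phi D 3 e" z]
        by (simp_all add: Q.V_in Q.g_simps Q.J_skew Q.K_skew)
      show ?thesis using that(2) by (simp add: flat_def w_def 1 field_simps)
    qed
    have pars: "(\<Sum>e\<in>B. complex_of_real (met e a) * of_real (met e b)) = of_real (met a b)" if "a \<in> P" "b \<in> P" for a b
    proof (rule R.clin_expand[OF _ that(1)])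
      show "clin P (\<lambda>e. complex_of_real (met e b))" using Q.g_lin[OF that(2)] by (simp add: clin_def rlin_def)
    qed
    have pairing: "(\<Sum>e\<in>B. ((1/2) * (of_real (met e p) - \<i> * of_real (met e (phi D 1 p))))
        * (- (1/2) * (of_real (met e (phi D 2 q)) + \<i> * of_real (met e (phi D 3 q))))) = Q.omega_val p q"
      if p: "p \<in> P" and q: "q \<in> P" for p q
    proof -
      have "(\<Sum>e\<in>B. ((1/2) * (of_real (met e p) - \<i> * of_real (met e (phi D 1 p))))
        * (- (1/2) * (of_real (met e (phi D 2 q)) + \<i> * of_real (met e (phi D 3 q)))))
        = (\<Sum>e\<in>B. - (1/4) * (of_real (met e p) * of_real (met e (phi D 2 q)))
           - (\<i>/4) * (of_real (met e p) * of_real (met e (phi D 3 q)))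
           + (\<i>/4) * (of_real (met e (phi D 1 p)) * of_real (met e (phi D 2 q)))
           - (1/4) * (of_real (met e (phi D 1 p)) * of_real (met e (phi D 3 q))))"
        by (intro sum.cong refl) (simp add: field_simps)
      also have "\<dots> = - (1/4) * of_real (met p (phi D 2 q)) - (\<i>/4) * of_real (met p (phi D 3 q))
           + (\<i>/4) * of_real (met (phi D 1 p) (phi D 2 q)) - (1/4) * of_real (met (phi D 1 p) (phi D 3 q))"
        using p q by (simp only: sum.distrib sum_subtractf sum_distrib_left[symmetric] pars Q.V_in)
      also have "\<dots> = Q.omega_val p q"
        using p q by (simp add: Q.omega_val_def Q.I_skew Q.V_in Q.IJ Q.K_mult Q.g_simps field_simps)
      finally show ?thesis .
    qed
    have wv: "wedge (flat D (f e)) (flat D (w e)) vs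
        = flat D (f e) [x] * flat D (w e) [y] - flat D (f e) [y] * flat D (w e) [x]" for e
      by (simp add: vs wedge_Cons int_prod_def parity_def flat_def algebra_simps)
    have "(\<Sum>e\<in>B. fscale (1/2) (wedge (flat D (f e)) (flat D (w e))) vs) = (1/2) * (Q.omega_val u v - Q.omega_val v u)"
      unfolding fscale_def wv sum_distrib_left[symmetric] sum_subtractf
      using pairing[OF u v] pairing[OF v u] by (simp add: f1 w1 x y u_def v_def cong: sum.cong)
    also have "\<dots> = Q.omega_val u v" using Q.omega_val_swap[OF u v] by simp
    finally show ?thesis using x y by (simp add: vs omega_at u_def v_def)
  qed
  then have "omega_form D = (\<lambda>vs. \<Sum>e\<in>B. fscale (1/2) (wedge (flat D (f e)) (flat D (w e))) vs)" by blast
  moreover have "\<dots> \<in> antihol_forms D"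
    unfolding antihol_forms_def using fe we
    by (intro wedge_generated_sum wedge_generated.scale wedge_generated.wedge wedge_generated.gen) auto
  ultimately show ?thesis by simp
qed

abbreviation "W \<equiv> wedge_generated {y1_form D, omega_form D}"

lemma W_inv: "\<alpha> \<in> W \<Longrightarrow> \<alpha> \<in> antihol_forms D \<and> iso_invariant \<alpha>"
proof (induction rule: wedge_generated.induct)
  case one then show ?case by (auto simp: antihol_forms_def iso_invariant_def fone_def intro: wedge_generated.one[unfolded fone_def])
next
  case (gen \<alpha>) then show ?case using y1_antihol omega_antihol iso_invariant_y1 iso_invariant_omega by auto
next
  case (add \<alpha> \<beta>) then show ?case
    by (auto simp: antihol_forms_def intro: wedge_generated.add) (simp add: iso_invariant_def fadd_def)
next
  case (scale \<alpha> z) then show ?case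
    by (auto simp: antihol_forms_def intro: wedge_generated.scale) (simp add: iso_invariant_def fscale_def)
next
  case (wedge \<alpha> \<beta>) then show ?case
    by (auto simp: antihol_forms_def intro: wedge_generated.wedge iso_invariant_wedge)
qed

end

context sasaki
begin

section \<open>Vertical and horizontal arguments\<close>
lemma antihol_form_lin: "antihol_form \<alpha> \<Longrightarrow> set us \<subseteq> T \<Longrightarrow> rlin T (\<lambda>x. \<alpha> (x # us))"
  using antihol_on_clin[OF subspaces(6) phi1_T antihol_form_on] by (simp add: clin_iff_rlin)

lemma antihol_form_xi:
  assumes a: "antihol_form \<alpha>" and us: "set us \<subseteq> T"
  shows "\<alpha> (xi 1 # us) = 0" "\<alpha> (xi 3 # us) = \<i> * \<alpha> (xi 2 # us)" "\<alpha> (0 # us) = 0"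
proof -
  show z: "\<alpha> (0 # us) = 0" using rlin_0[OF subspaces(6) antihol_form_lin[OF a us]] .
  show "\<alpha> (xi 1 # us) = 0" "\<alpha> (xi 3 # us) = \<i> * \<alpha> (xi 2 # us)"
    using antihol_on_type[OF antihol_form_on[OF a] xi_T'(1) us] antihol_on_type[OF antihol_form_on[OF a] xi_T'(3) us] z
    by (simp_all add: phi_xi)
qed

lemma antihol_form_swap: "antihol_form \<alpha> \<Longrightarrow> v \<in> T \<Longrightarrow> w \<in> T \<Longrightarrow> set us \<subseteq> T \<Longrightarrow> \<alpha> (v # w # us) = - \<alpha> (w # v # us)"
  using antihol_on_swap0[OF antihol_form_on] by blast

text \<open>
  The type condition gives \<open>\<alpha>(\<xi>\<^sub>1, \<dots>) = 0\<close> and \<open>\<alpha>(\<xi>\<^sub>3, \<dots>) = i \<alpha>(\<xi>\<^sub>2, \<dots>)\<close>, so the vertical part of an argument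
  enters only through \<open>y\<^sub>1\<close>.
\<close>
lemma antihol_form_head:
  assumes a: "antihol_form \<alpha>" and us: "set us \<subseteq> T" and v: "v \<in> T"
  shows "\<alpha> (v # us) = \<alpha> (hor D v # us) + y1_form D [v] * (of_real (sqrt 2) * \<alpha> (xi 2 # us))"
proof -
  note l = antihol_form_lin[OF a us]
  have xm: "met (xi i) v = met (xi i) (ver D v)" if i: "i \<in> {1,2,3}" for i
  proof -
    have "met (xi i) v = met (xi i) (ver D v + hor D v)" using ver_hor(3)[OF v] by simp
    also have "\<dots> = met (xi i) (ver D v) + met (xi i) (hor D v)"
      using rlin_add[OF subspaces(6) met_lin2[OF xi_T[OF i]]] ver_hor[OF v] Ve_T P_T by blast
    finally show ?thesis using met_Ve_P(1)[OF xi_Ve[OF i] ver_hor(2)[OF v]] by simp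
  qed
  have "\<alpha> (ver D v # us) = \<alpha> ((met (xi 1) (ver D v) *\<^sub>R xi 1 + met (xi 2) (ver D v) *\<^sub>R xi 2 + met (xi 3) (ver D v) *\<^sub>R xi 3) # us)"
    using Ve_expand[OF ver_hor(1)[OF v]] by simp
  also have "\<dots> = (of_real (met (xi 2) v) + \<i> * of_real (met (xi 3) v)) * \<alpha> (xi 2 # us)"
    using subspaces(6) xm[of 2] xm[of 3]
    by (simp add: rlin_add[OF subspaces(6) l] rlin_scale[OF subspaces(6) l] subspace_add subspace_scale
        antihol_form_xi[OF a us] scaleR_conv_of_real[where 'a=complex] algebra_simps)
  also have "\<dots> = y1_form D [v] * (of_real (sqrt 2) * \<alpha> (xi 2 # us))"
    using v by (simp add: y1_at)
  finally have 1: "\<alpha> (ver D v # us) = y1_form D [v] * (of_real (sqrt 2) * \<alpha> (xi 2 # us))" .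
  have "\<alpha> (v # us) = \<alpha> ((ver D v + hor D v) # us)" using ver_hor(3)[OF v] by simp
  also have "\<dots> = \<alpha> (ver D v # us) + \<alpha> (hor D v # us)"
    using rlin_add[OF subspaces(6) l] ver_hor[OF v] Ve_T P_T by blast
  finally show ?thesis using 1 by simp
qed

definition horizontal :: "(real^'k^'k) form \<Rightarrow> bool" where
  "horizontal \<alpha> \<longleftrightarrow> (\<forall>vs. set vs \<subseteq> T \<longrightarrow> \<alpha> (xi 2 # vs) = 0)"

lemma hor_T: "v \<in> T \<Longrightarrow> hor D v \<in> T"
  using ver_hor(2) P_T by blast

lemma map_hor_T: "set vs \<subseteq> T \<Longrightarrow> set (map (hor D) vs) \<subseteq> T"
  and map_hor_P: "set vs \<subseteq> T \<Longrightarrow> set (map (hor D) vs) \<subseteq> P"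
  using hor_T ver_hor(2) by auto

lemma horizontal_int_prod: "antihol_form \<alpha> \<Longrightarrow> horizontal \<alpha> \<Longrightarrow> v \<in> T \<Longrightarrow> horizontal (int_prod v \<alpha>)"
  unfolding horizontal_def int_prod_def using antihol_form_swap[of \<alpha> v "xi 2"] by simp

lemma horizontal_eq:
  assumes "antihol_form \<alpha>" "horizontal \<alpha>" "set vs \<subseteq> T"
  shows "\<alpha> vs = \<alpha> (map (hor D) vs)"
  using assms
proof (induction vs arbitrary: \<alpha>)
  case (Cons v vs)
  have v: "v \<in> T" "set vs \<subseteq> T" using Cons.prems by auto
  have "\<alpha> (v # vs) = \<alpha> (v # map (hor D) vs)"
    using Cons.IH[OF antihol_form_ins[OF Cons.prems(1) v(1)] horizontal_int_prod[OF Cons.prems(1,2) v(1)] v(2)] by (simp add: int_prod_def)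
  also have "\<dots> = \<alpha> (hor D v # map (hor D) vs)"
    using antihol_form_head[OF Cons.prems(1) map_hor_T[OF v(2)] v(1)] Cons.prems(2) map_hor_T[OF v(2)]
    by (simp add: horizontal_def)
  finally show ?case by simp
qed simp

section \<open>Infinitesimal invariance\<close>

text \<open>
  The derivative at \<open>0\<close> of the constant values of \<open>\<alpha>\<close> along the one-parameter subgroup of \<open>X\<close>.
\<close>
lemma iso_invariant_form_deriv:
  assumes a: "antihol_form \<alpha>" and inv: "iso_invariant \<alpha>" and X: "X \<in> hh" and vs: "set vs \<subseteq> P"
  shows "form_deriv (lie_bracket X) \<alpha> vs = 0"
proof -
  obtain B C where "quat_curv P (metric D) (phi D 1) (phi D 2) (phi D 3) B curv"
    using odd_basis by metis
  then interpret R: quat_curv P "metric D" "phi D 1" "phi D 2" "phi D 3" B curv .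
  define E where "E t = mexp (t *\<^sub>R X)" for t
  have E: "E t \<in> Iso D" for t using X by (simp add: lie_algebra_of_def E_def)
  have AdE: "Ad (E t) v = isotropy D (E t) v" if "v \<in> P" for t v
    using isotropy_eq[OF P_T[OF that]] by simp
  have 1: "((\<lambda>t. \<alpha> (map (Ad (E t)) vs)) has_vector_derivative form_deriv (lie_bracket X) \<alpha> vs) (at 0)"
  proof (rule R.form_derivative)
    show "((\<lambda>t. Ad (E t) v) has_vector_derivative lie_bracket X v) (at 0)" for v
      unfolding E_def by (rule Ad_mexp_derivative) (use Iso_group E in \<open>simp add: E_def\<close>)
    show "Ad (E t) v \<in> P" if "v \<in> P" for t v
      using Sp_P[OF isotropy_Sp[OF E] that] AdE[OF that] by simp
    show "lie_bracket X v \<in> P" if "v \<in> P" for v using g0(3) hh_g0 X that by blast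
    show "Ad (E 0) v = v" if "v \<in> P" for v
    proof -
      have "E 0 = mat 1" by (simp only: E_def mexp_0)
      moreover have "invertible (mat 1 :: real^'k^'k)" unfolding invertible_def by (intro exI[of _ "mat 1"]) simp
      then have "matrix_inv (mat 1) = (mat 1 :: real^'k^'k)" using matrix_inv_mult(1)[of "mat 1"] by simp
      ultimately show ?thesis by (simp add: Ad_def)
    qed
    show "antihol_on P (phi D 1) \<alpha>" using antihol_on_mono[OF antihol_form_on[OF a]] P_T by blast
  qed (rule vs)
  have "\<alpha> (map (Ad (E t)) vs) = \<alpha> vs" for t
  proof -
    have "map (Ad (E t)) vs = map (isotropy D (E t)) vs" using AdE vs by (intro map_cong) auto
    moreover have "set vs \<subseteq> T" using vs P_T by blast
    then have "\<alpha> (map (isotropy D (E t)) vs) = \<alpha> vs" using inv E[of t] unfolding iso_invariant_def by blast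
    ultimately show ?thesis by (simp only:)
  qed
  then have "((\<lambda>t. \<alpha> (map (Ad (E t)) vs)) has_vector_derivative 0) (at 0)" by simp
  from vector_derivative_unique_at[OF 1 this] show ?thesis .
qed

section \<open>Horizontal invariant forms\<close>

text \<open>
  By \<open>invariant_form_eq_wedge\<close> the form is a multiple of \<open>\<omega> \<and> \<beta>\<close>, where the contraction \<open>\<beta>\<close> inherits all hypotheses in
  degree \<open>k - 2\<close>. The factor vanishes only for \<open>2 k = d + 4\<close>, a degree that is too large for nonzero forms.
\<close>
lemma horizontal_generated:
  assumes "antihol_form \<alpha>" "iso_invariant \<alpha>" "horizontal \<alpha>" "\<And>vs. length vs \<noteq> k \<Longrightarrow> \<alpha> vs = 0"
  shows "\<alpha> \<in> W"
proof -
  obtain B C where "quat_curv P (metric D) (phi D 1) (phi D 2) (phi D 3) B curv"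
    and C: "finite C" "C \<subseteq> P" "card B = 2 * card C" "\<And>x. x \<in> P \<Longrightarrow> \<exists>c d. x = (\<Sum>e\<in>C. c e *\<^sub>R e + d e *\<^sub>R phi D 1 e)"
    by (rule odd_basis) (rule that; blast)
  then interpret R: quat_curv P "metric D" "phi D 1" "phi D 2" "phi D 3" B curv by simp
  have BT: "e \<in> T" "phi D 2 e \<in> T" if "e \<in> B" for e
    using R.B_in[OF that] P_T phi_in_P[of e 2] by auto
  show ?thesis using assms
  proof (induction k arbitrary: \<alpha> rule: less_induct)
    case (less k)
    note a = less.prems(1) and inv = less.prems(2) and hz = less.prems(3) and deg = less.prems(4)
    have aP: "antihol_on P (phi D 1) \<alpha>" using antihol_on_mono[OF antihol_form_on[OF a]] P_T by blast
    show ?case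
    proof (cases "k = 0")
      case True
      then have "\<alpha> = fscale (\<alpha> []) fone" using deg by (auto simp: fscale_def fone_def fun_eq_iff)
      then show ?thesis using wedge_generated.scale[OF wedge_generated.one] by metis
    next
      case k0: False
      define \<beta> where "\<beta> = R.omega_trace \<alpha>"
      have b_eq: "\<beta> = (\<lambda>vs. \<Sum>e\<in>B. int_prod (phi D 2 e) (int_prod e \<alpha>) vs)"
        by (simp add: \<beta>_def R.omega_trace_def int_prod_def)
      have b: "antihol_form \<beta>" unfolding b_eq using BT by (intro antihol_form_sum antihol_form_ins a) auto
      have bhz: "horizontal \<beta>"
        unfolding horizontal_def b_eq
        using horizontal_int_prod[OF antihol_form_ins[OF a BT(1)] horizontal_int_prod[OF a hz BT(1)] BT(2)]
        by (auto simp: horizontal_def intro!: sum.neutral)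
      have binv: "iso_invariant \<beta>"
        unfolding iso_invariant_def
      proof (intro ballI allI impI)
        fix h vs assume h: "h \<in> Iso D" and vs: "set vs \<subseteq> T"
        let ?A = "isotropy D h" and ?A' = "isotropy D (matrix_inv h)"
        have k: "matrix_inv h \<in> Iso D" using Iso_group[OF h] by blast
        note A = isotropy_Sp[OF h] and A' = isotropy_Sp[OF k]
        define ws where "ws = map ?A vs"
        have ws: "set ws \<subseteq> T" using vs Sp_T[OF A] by (auto simp: ws_def)
        have eT: "e \<in> T" "e \<in> P" "phi D 2 e \<in> T" if "e \<in> B" for e using that R.B_in P_T BT by auto
        have "(\<Sum>e\<in>B. \<alpha> (?A e # phi D 2 (?A e) # ws)) = (\<Sum>e\<in>B. \<alpha> (e # phi D 2 (?A (?A' e)) # ws))"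
        proof (rule R.trace_adjoint[where b="\<lambda>u v. \<alpha> (u # phi D 2 (?A v) # ws)" and A="?A" and A'="?A'"])
          fix y assume y: "y \<in> P"
          have pT: "phi D 2 (?A y) \<in> T" using P_T phi_in_P Sp_P[OF A y] by simp
          show "clin P (\<lambda>x. \<alpha> (x # phi D 2 (?A y) # ws))"
            using antihol_form_lin[OF a, of "phi D 2 (?A y) # ws"] pT ws P_T
            by (auto simp: clin_iff_rlin rlin_def)
        next
          fix x assume x: "x \<in> P"
          have "rlin P (\<lambda>v. phi D 2 (?A v))"
            by (rule rlin_comp[OF _ Sp_P[OF A] Q.J_lin]) (use Sp_lin[OF A] P_T in \<open>auto simp: rlin_def\<close>)
          moreover have "clin P (\<lambda>v. \<alpha> (x # v # ws))"
            using antihol_form_lin[OF antihol_form_ins[OF a P_T[OF x]] ws] P_T by (auto simp: clin_iff_rlin rlin_def int_prod_def)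
          ultimately show "clin P (\<lambda>v. \<alpha> (x # phi D 2 (?A v) # ws))"
            using Q.clin_comp[of "\<lambda>v. \<alpha> (x # v # ws)" "\<lambda>v. phi D 2 (?A v)"] Sp_P[OF A] phi_in_P by simp
        next
          show "?A x \<in> P" "?A' x \<in> P" if "x \<in> P" for x using that Sp_P[OF A] Sp_P[OF A'] by auto
        next
          fix x y assume x: "x \<in> P" and y: "y \<in> P"
          show "met (?A x) y = met x (?A' y)"
            using Sp_met[OF A P_T[OF x] Sp_T[OF A' P_T[OF y]]] isotropy_inverse[OF h P_T[OF y]] by simp
        qed
        also have "\<dots> = \<beta> ws"
          unfolding \<beta>_def R.omega_trace_def using isotropy_inverse[OF h eT(1)] by (intro sum.cong refl) simp
        finally have "\<beta> ws = (\<Sum>e\<in>B. \<alpha> (map ?A (e # phi D 2 e # vs)))"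
          using Sp_phi[OF A eT(1), of _ 2] by (simp add: ws_def cong: sum.cong)
        also have "\<dots> = \<beta> vs"
          unfolding \<beta>_def R.omega_trace_def
        proof (intro sum.cong refl)
          fix e assume e: "e \<in> B"
          have "set (e # phi D 2 e # vs) \<subseteq> T" using eT[OF e] vs by simp
          then show "\<alpha> (map ?A (e # phi D 2 e # vs)) = \<alpha> (e # phi D 2 e # vs)"
            using inv h unfolding iso_invariant_def by blast
        qed
        finally show "\<beta> (map ?A vs) = \<beta> vs" unfolding ws_def .
      qed
      have bW: "\<beta> \<in> W"
      proof (cases "k = 1")
        case True
        then have "\<beta> = (\<lambda>vs. 0)" unfolding \<beta>_def R.omega_trace_def using deg by (auto intro!: sum.neutral)
        then show ?thesis using wedge_generated_fzero by simp
      next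
        case False
        show ?thesis
        proof (rule less.IH[OF _ b binv bhz])
          show "k - 2 < k" using k0 by simp
          show "\<beta> vs = 0" if "length vs \<noteq> k - 2" for vs
            unfolding \<beta>_def R.omega_trace_def using that k0 False by (intro sum.neutral ballI deg) simp
        qed
      qed
      have wW: "wedge (omega_form D) \<beta> \<in> W"
        by (rule wedge_generated.wedge[OF wedge_generated.gen bW]) simp
      let ?c = "of_nat k * (of_nat (card B) + 4 - 2 * of_nat k) :: complex"
      have key: "4 * wedge (omega_form D) \<beta> vs = ?c * \<alpha> vs" if vs: "set vs \<subseteq> P" for vs
      proof -
        have "form_deriv (curv x y) \<alpha> us = 0" if "x \<in> P" "y \<in> P" "set us \<subseteq> P" for x y us
        proof -
          have "curv x y = lie_bracket (hpart x y)" by (rule ext) (simp add: curv_def)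
          then show ?thesis using iso_invariant_form_deriv[OF a inv hpart_hh[OF that(1,2)] that(3)] by simp
        qed
        then have "4 * wedge (omega_form D) \<beta> vs = of_nat (length vs) * (of_nat (card B) + 4 - 2 * of_nat (length vs)) * \<alpha> vs"
          unfolding \<beta>_def by (intro R.invariant_form_eq_wedge omega_P omega_length aP vs)
        then show ?thesis using deg[of vs] by (cases "length vs = k") simp_all
      qed
      have key_T: "4 * wedge (omega_form D) \<beta> vs = ?c * \<alpha> vs" for vs
      proof (cases "set vs \<subseteq> T")
        case True
        have wa: "antihol_form (wedge (omega_form D) \<beta>)" using antihol_form_antihol[OF omega_antihol] b by (rule antihol_form_wedge)
        have "horizontal (wedge (omega_form D) \<beta>)"
          unfolding horizontal_def
        proof (intro allI impI)
          fix us assume us: "set us \<subseteq> T"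
          have "hor D (xi 2) = 0" by simp
          have z: "wedge (\<lambda>_. 0) \<gamma> us = 0" "wedge \<gamma> (\<lambda>_. 0) us = 0" for \<gamma> :: "(real^'k^'k) form"
            by (simp_all add: wedge_def)
          have "int_prod (xi 2) (omega_form D) ws = 0" if ws: "set ws \<subseteq> T" for ws
          proof (cases "\<exists>y. ws = [y]")
            case True
            then obtain y where y: "ws = [y]" by blast
            then have "y \<in> T" using ws by simp
            with y show ?thesis
              using Q.g_simps ver_hor(2)[of y] rlin_0[OF Q.V Q.g_lin[OF Q.J_in]] rlin_0[OF Q.V Q.g_lin[OF Q.K_in]]
              by (simp add: int_prod_def omega_at Q.omega_val_def)
          next
            case False
            then have "length (xi 2 # ws) \<noteq> 2" by (auto simp: length_Suc_conv numeral_2_eq_2)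
            then show ?thesis using omega_length unfolding int_prod_def by blast
          qed
          then have "wedge (int_prod (xi 2) (omega_form D)) \<beta> us = wedge (\<lambda>_. 0) \<beta> us"
            using us by (intro wedge_cong refl) auto
          moreover have "wedge (parity (omega_form D)) (int_prod (xi 2) \<beta>) us = wedge (parity (omega_form D)) (\<lambda>_. 0) us"
            using us bhz by (intro wedge_cong refl) (auto simp: horizontal_def int_prod_def)
          ultimately show "wedge (omega_form D) \<beta> (xi 2 # us) = 0" by (simp add: wedge_Cons z)
        qed
        then have "wedge (omega_form D) \<beta> vs = wedge (omega_form D) \<beta> (map (hor D) vs)"
          using horizontal_eq[OF wa _ True] by blast
        moreover have "\<alpha> vs = \<alpha> (map (hor D) vs)" by (rule horizontal_eq[OF a hz True])
        ultimately show ?thesis using key[OF map_hor_P[OF True]] by simp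
      next
        case False
        then show ?thesis
          using antihol_form_off[OF a] antihol_form_off[OF antihol_form_wedge[OF antihol_form_antihol[OF omega_antihol] b]] by simp
      qed
      show ?thesis
      proof (cases "2 * k = card B + 4")
        case True
        then have "k > card C" using C(3) by simp
        have "\<alpha> vs = 0" if vs: "set vs \<subseteq> T" for vs
        proof (cases "length vs = k")
          case True
          have "\<alpha> (map (hor D) vs) = 0"
            by (rule antihol_on_zero_long[OF subspaces(1) _ aP C(1,2,4) map_hor_P[OF vs]])
               (use True \<open>k > card C\<close> in \<open>auto simp: Q.I_in\<close>)
          then show ?thesis using horizontal_eq[OF a hz vs] by simp
        qed (rule deg)
        then have "\<alpha> = (\<lambda>vs. 0)" using antihol_form_off[OF a] by blast
        then show ?thesis using wedge_generated_fzero by simp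
      next
        case False
        have c0: "?c \<noteq> 0"
        proof
          assume "?c = 0"
          then have "complex_of_nat (card B + 4) = of_nat (2 * k)" using k0 by simp
          then have "card B + 4 = 2 * k" by (simp only: of_nat_eq_iff)
          then show False using False by simp
        qed
        have "\<alpha> = fscale (4 / ?c) (wedge (omega_form D) \<beta>)"
        proof
          fix vs
          have "\<alpha> vs = (?c * \<alpha> vs) / ?c" using c0 by simp
          also have "\<dots> = fscale (4 / ?c) (wedge (omega_form D) \<beta>) vs"
            unfolding key_T[symmetric] by (simp add: fscale_def)
          finally show "\<alpha> vs = fscale (4 / ?c) (wedge (omega_form D) \<beta>) vs" .
        qed
        then show ?thesis using wedge_generated.scale[OF wW] by metis
      qed
    qed
  qed
qed

lemma antihol_form_deg: assumes "antihol_form \<alpha>" shows "antihol_form (\<lambda>vs. if length vs = k then \<alpha> vs else 0)"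
  unfolding antihol_form_def
proof (intro conjI antihol_onI allI impI)
  note a = antihol_form_on[OF assms]
  fix us v w ws assume "set us \<subseteq> T" "v \<in> T" "w \<in> T" "set ws \<subseteq> T"
  from antihol_on_swap[OF a this]
  show "(if length (us @ v # w # ws) = k then \<alpha> (us @ v # w # ws) else 0) = - (if length (us @ w # v # ws) = k then \<alpha> (us @ w # v # ws) else 0)"
    by simp
next
  note a = antihol_form_on[OF assms]
  fix r s :: real and v w ws assume "v \<in> T" "w \<in> T" "set ws \<subseteq> T"
  from antihol_on_lin[OF a this]
  show "(if length ((r *\<^sub>R v + s *\<^sub>R w) # ws) = k then \<alpha> ((r *\<^sub>R v + s *\<^sub>R w) # ws) else 0)
     = of_real r * (if length (v # ws) = k then \<alpha> (v # ws) else 0) + of_real s * (if length (w # ws) = k then \<alpha> (w # ws) else 0)"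
    by simp
next
  note a = antihol_form_on[OF assms]
  fix v ws assume "v \<in> T" "set ws \<subseteq> T"
  from antihol_on_type[OF a this]
  show "(if length (phi D 1 v # ws) = k then \<alpha> (phi D 1 v # ws) else 0) = \<i> * (if length (v # ws) = k then \<alpha> (v # ws) else 0)"
    by simp
qed (simp add: antihol_form_off[OF assms])

lemma horizontal_generated':
  assumes a: "antihol_form \<alpha>" and inv: "iso_invariant \<alpha>" and hz: "horizontal \<alpha>" and bd: "bounded_degree \<alpha>"
  shows "\<alpha> \<in> W"
proof -
  obtain n where n: "\<And>vs. length vs > n \<Longrightarrow> \<alpha> vs = 0" using bd unfolding bounded_degree_def by blast
  have "\<alpha> = (\<lambda>vs. \<Sum>k\<le>n. if length vs = k then \<alpha> vs else 0)"
    using n by (auto simp: fun_eq_iff not_le)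
  moreover have "\<dots> \<in> W"
  proof (rule wedge_generated_sum)
    fix k
    show "(\<lambda>vs. if length vs = k then \<alpha> vs else 0) \<in> W"
    proof (rule horizontal_generated[OF antihol_form_deg[OF a], where k=k])
      show "iso_invariant (\<lambda>vs. if length vs = k then \<alpha> vs else 0)" using inv by (simp add: iso_invariant_def)
      show "horizontal (\<lambda>vs. if length vs = k then \<alpha> vs else 0)" using hz by (simp add: horizontal_def)
    qed simp
  qed
  ultimately show ?thesis by simp
qed

section \<open>Splitting off the vertical part\<close>

definition hor_form :: "(real^'k^'k) form \<Rightarrow> (real^'k^'k) form" where
  "hor_form \<alpha> = (\<lambda>vs. if set vs \<subseteq> T then \<alpha> (map (hor D) vs) else 0)"

lemma hor_phi1: assumes v: "v \<in> T" shows "hor D (phi D 1 v) = phi D 1 (hor D v)"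
proof -
  have "(1/2) *\<^sub>R lie_bracket (xi 1) (ver D v) \<in> Ve"
    using Ve_bracket[OF ver_hor(1)[OF v], of 1] subspaces(2) by (simp add: subspace_scale)
  moreover have "lie_bracket (xi 1) (hor D v) \<in> P" using g0(3) Ve_g0 xi_Ve[of 1] ver_hor(2)[OF v] by simp
  ultimately show ?thesis using ver_hor(2)[OF v] unfolding phi_def[of D 1 v] by (simp add: hor_eq phi_P)
qed

lemma antihol_form_hor_form: assumes "antihol_form \<alpha>" shows "antihol_form (hor_form \<alpha>)"
  unfolding antihol_form_def
proof (intro conjI antihol_onI allI impI)
  note a = antihol_form_on[OF assms]
  fix us v w ws assume h: "set us \<subseteq> T" "v \<in> T" "w \<in> T" "set ws \<subseteq> T"
  show "hor_form \<alpha> (us @ v # w # ws) = - hor_form \<alpha> (us @ w # v # ws)"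
    using antihol_on_swap[OF a map_hor_T[OF h(1)] hor_T[OF h(2)] hor_T[OF h(3)] map_hor_T[OF h(4)]] h
    by (simp add: hor_form_def)
next
  note a = antihol_form_on[OF assms]
  fix r s :: real and v w ws assume h: "v \<in> T" "w \<in> T" "set ws \<subseteq> T"
  have "r *\<^sub>R v + s *\<^sub>R w \<in> T" using h subspaces(6) by (simp add: subspace_add subspace_scale)
  then show "hor_form \<alpha> ((r *\<^sub>R v + s *\<^sub>R w) # ws) = of_real r * hor_form \<alpha> (v # ws) + of_real s * hor_form \<alpha> (w # ws)"
    using antihol_on_lin[OF a hor_T[OF h(1)] hor_T[OF h(2)] map_hor_T[OF h(3)], of r s] h rlinD[OF rlin_hor h(1,2)]
    by (simp add: hor_form_def)
next
  note a = antihol_form_on[OF assms]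
  fix v ws assume h: "v \<in> T" "set ws \<subseteq> T"
  show "hor_form \<alpha> (phi D 1 v # ws) = \<i> * hor_form \<alpha> (v # ws)"
    using antihol_on_type[OF a hor_T[OF h(1)] map_hor_T[OF h(2)]] h phi1_T[OF h(1)]
    by (simp add: hor_form_def hor_phi1)
qed (simp add: hor_form_def)

lemma iso_invariant_hor_form: assumes "iso_invariant \<alpha>" shows "iso_invariant (hor_form \<alpha>)"
  unfolding iso_invariant_def
proof (intro ballI allI impI)
  fix h vs assume h: "h \<in> Iso D" and vs: "set vs \<subseteq> T"
  note A = isotropy_Sp[OF h]
  have 1: "map (hor D) (map (isotropy D h) vs) = map (isotropy D h) (map (hor D) vs)"
    using vs Sp_hor[OF A] by (auto simp: subset_iff)
  have 2: "set (map (isotropy D h) vs) \<subseteq> T" using vs Sp_T[OF A] by auto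
  have 3: "\<alpha> (map (isotropy D h) (map (hor D) vs)) = \<alpha> (map (hor D) vs)"
    using assms h map_hor_T[OF vs] unfolding iso_invariant_def by blast
  show "hor_form \<alpha> (map (isotropy D h) vs) = hor_form \<alpha> vs"
    unfolding hor_form_def by (simp only: 1 2 3 vs if_True)
qed

lemma hor_form_generated:
  assumes "antihol_form \<alpha>" "iso_invariant \<alpha>" "bounded_degree \<alpha>" shows "hor_form \<alpha> \<in> W"
proof (rule horizontal_generated'[OF antihol_form_hor_form[OF assms(1)] iso_invariant_hor_form[OF assms(2)]])
  show "horizontal (hor_form \<alpha>)"
    unfolding horizontal_def hor_form_def using antihol_form_xi(3)[OF assms(1) map_hor_T] by simp
  obtain n where n: "\<And>vs. length vs > n \<Longrightarrow> \<alpha> vs = 0" using assms(3) unfolding bounded_degree_def by blast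
  then show "bounded_degree (hor_form \<alpha>)" unfolding bounded_degree_def hor_form_def
    by (intro exI[of _ n]) simp
qed

text \<open>
  The alternation is the wedge product of \<open>y\<^sub>1\<close> with \<open>sqrt 2\<close> times the horizontal part of the interior product with
  \<open>\<xi>\<^sub>2\<close>; the factor compensates \<open>y\<^sub>1(\<xi>\<^sub>2) = 1 / sqrt 2\<close>.
\<close>
lemma split_form:
  assumes "antihol_form \<alpha>" "set vs \<subseteq> T"
  shows "\<alpha> vs = \<alpha> (map (hor D) vs)
     + alternate (\<lambda>x us. y1_form D [x] * (of_real (sqrt 2) * \<alpha> (xi 2 # map (hor D) us))) vs"
  using assms
proof (induction vs arbitrary: \<alpha>)
  case (Cons v vs)
  note a = Cons.prems(1)
  have v: "v \<in> T" and vs: "set vs \<subseteq> T" using Cons.prems by auto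
  have "\<alpha> (v # vs) = \<alpha> (v # map (hor D) vs)
     + alternate (\<lambda>x us. y1_form D [x] * (of_real (sqrt 2) * \<alpha> (v # xi 2 # map (hor D) us))) vs"
    using Cons.IH[OF antihol_form_ins[OF a v] vs] by (simp add: int_prod_def)
  also have "alternate (\<lambda>x us. y1_form D [x] * (of_real (sqrt 2) * \<alpha> (v # xi 2 # map (hor D) us))) vs
     = alternate (\<lambda>x us. - (y1_form D [x] * (of_real (sqrt 2) * \<alpha> (xi 2 # hor D v # map (hor D) us)))) vs"
  proof (rule alternate_cong[OF vs])
    fix x us assume us: "set us \<subseteq> T"
    let ?us = "map (hor D) us"
    note us' = map_hor_T[OF us]
    have "\<alpha> (xi 2 # xi 2 # ?us) = 0" using antihol_form_swap[OF a xi_T'(3) xi_T'(3) us'] by simp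
    then have "\<alpha> (v # xi 2 # ?us) = \<alpha> (hor D v # xi 2 # ?us)"
      using antihol_form_head[OF a _ v, of "xi 2 # ?us"] us' by simp
    also have "\<dots> = - \<alpha> (xi 2 # hor D v # ?us)" by (rule antihol_form_swap[OF a hor_T[OF v] xi_T'(3) us'])
    finally show "y1_form D [x] * (of_real (sqrt 2) * \<alpha> (v # xi 2 # ?us)) = - (y1_form D [x] * (of_real (sqrt 2) * \<alpha> (xi 2 # hor D v # ?us)))"
      by simp
  qed
  also have "\<alpha> (v # map (hor D) vs) = \<alpha> (hor D v # map (hor D) vs)
      + y1_form D [v] * (of_real (sqrt 2) * \<alpha> (xi 2 # map (hor D) vs))"
    by (rule antihol_form_head[OF a map_hor_T[OF vs] v])
  finally show ?case by (simp add: alternate_minus int_prod_def)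
qed simp

lemma inv_antihol_eq: "inv_antihol_forms D = W"
proof
  have eq: "inv_antihol_forms D = {\<alpha> \<in> antihol_forms D. iso_invariant \<alpha>}"
    by (simp add: inv_antihol_forms_def iso_invariant_def)
  show "W \<subseteq> inv_antihol_forms D" unfolding eq using W_inv by blast
  show "inv_antihol_forms D \<subseteq> W"
  proof
    fix \<alpha> assume "\<alpha> \<in> inv_antihol_forms D"
    then have "\<alpha> \<in> antihol_forms D" and inv: "iso_invariant \<alpha>" by (simp_all add: eq)
    then have a: "antihol_form \<alpha>" and bd: "bounded_degree \<alpha>" by (simp_all add: antihol_form_antihol antihol_bounded)
    define \<gamma> where "\<gamma> = hor_form (int_prod (xi 2) \<alpha>)"
    have "iso_invariant (int_prod (xi 2) \<alpha>)"
      unfolding iso_invariant_def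
    proof (intro ballI allI impI)
      fix h vs assume h: "h \<in> Iso D" and vs: "set vs \<subseteq> T"
      have "isotropy D h (xi 2) = xi 2" using Sp_xi[OF isotropy_Sp[OF h], of 2] by simp
      moreover have "\<alpha> (map (isotropy D h) (xi 2 # vs)) = \<alpha> (xi 2 # vs)"
        using inv h vs unfolding iso_invariant_def by (metis insert_subset list.simps(15) xi_T'(3))
      ultimately show "int_prod (xi 2) \<alpha> (map (isotropy D h) vs) = int_prod (xi 2) \<alpha> vs" by (simp add: int_prod_def)
    qed
    moreover have "bounded_degree (int_prod (xi 2) \<alpha>)"
      using bd unfolding bounded_degree_def int_prod_def by (metis length_Cons less_Suc_eq)
    ultimately have g: "\<gamma> \<in> W" unfolding \<gamma>_def using a by (intro hor_form_generated antihol_form_ins) simp_all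
    have b: "hor_form \<alpha> \<in> W" using a inv bd by (rule hor_form_generated)
    have y: "y1_form D \<in> W" by (rule wedge_generated.gen) simp
    have "\<alpha> = fadd (hor_form \<alpha>) (wedge (y1_form D) (fscale (of_real (sqrt 2)) \<gamma>))"
    proof
      fix vs
      show "\<alpha> vs = fadd (hor_form \<alpha>) (wedge (y1_form D) (fscale (of_real (sqrt 2)) \<gamma>)) vs"
      proof (cases "set vs \<subseteq> T")
        case True
        have "wedge (y1_form D) (fscale (of_real (sqrt 2)) \<gamma>) vs
            = alternate (\<lambda>x us. y1_form D [x] * fscale (of_real (sqrt 2)) \<gamma> us) vs"
          by (rule wedge_one_form) (rule y1_length)
        also have "\<dots> = alternate (\<lambda>x us. y1_form D [x] * (of_real (sqrt 2) * \<alpha> (xi 2 # map (hor D) us))) vs"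
          by (rule alternate_cong[OF True]) (simp add: fscale_def \<gamma>_def hor_form_def int_prod_def)
        finally show ?thesis using split_form[OF a True] True by (simp add: fadd_def hor_form_def)
      next
        case False
        have "antihol_form \<gamma>" unfolding \<gamma>_def using a by (intro antihol_form_hor_form antihol_form_ins) simp_all
        then have "antihol_form (wedge (y1_form D) (fscale (of_real (sqrt 2)) \<gamma>))"
          using antihol_form_antihol[OF y1_antihol] by (intro antihol_form_wedge antihol_form_fscale)
        from antihol_form_off[OF this False] antihol_form_off[OF a False] False show ?thesis by (simp add: fadd_def hor_form_def)
      qed
    qed
    moreover have "\<dots> \<in> W"
      using b y g by (intro wedge_generated.add wedge_generated.wedge wedge_generated.scale)
    ultimately show "\<alpha> \<in> W" by metis
  qed
qed

end

section \<open>Left multiplication by generators\<close>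
text \<open>
  Associativity turns every product of generators into one that is built by multiplying from the left.
\<close>
lemma wedge_generated_left_induct [consumes 1, case_names one add scale wedge]:
  assumes "\<alpha> \<in> wedge_generated S"
    and one: "Pr fone"
    and add: "\<And>\<alpha> \<beta>. \<alpha> \<in> wedge_generated S \<Longrightarrow> \<beta> \<in> wedge_generated S \<Longrightarrow> Pr \<alpha> \<Longrightarrow> Pr \<beta> \<Longrightarrow> Pr (fadd \<alpha> \<beta>)"
    and scale: "\<And>\<alpha> z. \<alpha> \<in> wedge_generated S \<Longrightarrow> Pr \<alpha> \<Longrightarrow> Pr (fscale z \<alpha>)"
    and wedge: "\<And>y \<alpha>. y \<in> S \<Longrightarrow> \<alpha> \<in> wedge_generated S \<Longrightarrow> Pr \<alpha> \<Longrightarrow> Pr (wedge y \<alpha>)"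
  shows "Pr \<alpha>"
proof -
  have "\<forall>\<beta>\<in>wedge_generated S. Pr \<beta> \<longrightarrow> Pr (wedge \<alpha> \<beta>)"
    using assms(1)
  proof induction
    case one then show ?case by simp
  next
    case (gen \<alpha>) then show ?case using wedge by blast
  next
    case (add \<alpha> \<beta>)
    then show ?case
      unfolding wedge_fadd_left by (blast intro: assms(3) wedge_generated.wedge)
  next
    case (scale \<alpha> z)
    then show ?case
      unfolding wedge_fscale_left by (blast intro: assms(4) wedge_generated.wedge)
  next
    case (wedge \<alpha> \<beta>)
    then show ?case
      unfolding wedge_assoc by (blast intro: wedge_generated.wedge)
  qed
  then have "Pr (wedge \<alpha> fone)" using wedge_generated.one one by blast
  then show ?thesis by simp
qed

lemma int_prod_wedge_one_form:
  assumes "\<And>us. length us \<noteq> 1 \<Longrightarrow> y us = 0"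
  shows "int_prod v (wedge y \<alpha>) = fadd (fscale (y [v]) \<alpha>) (fscale (- 1) (wedge y (int_prod v \<alpha>)))"
    and "parity y = fscale (- 1) y"
proof -
  have 1: "int_prod v y = fscale (y [v]) fone"
    by (rule ext) (auto simp: int_prod_def fscale_def fone_def assms)
  show 2: "parity y = fscale (- 1) y"
  proof (rule ext)
    fix us show "parity y us = fscale (- 1) y us"
      using assms[of us] by (cases "length us = 1") (simp_all add: parity_def fscale_def)
  qed
  show "int_prod v (wedge y \<alpha>) = fadd (fscale (y [v]) \<alpha>) (fscale (- 1) (wedge y (int_prod v \<alpha>)))"
    by (simp add: int_prod_wedge 1 2 wedge_fscale_left)
qed

lemma wedge_one_form_self:
  assumes "\<And>us. length us \<noteq> 1 \<Longrightarrow> y us = 0"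
  shows "wedge y y vs = 0"
proof (cases vs)
  case Nil then show ?thesis by (simp add: assms)
next
  case (Cons v us)
  have iv: "int_prod v y = fscale (y [v]) fone"
    by (rule ext) (auto simp: int_prod_def fscale_def fone_def assms)
  have "wedge y y vs = int_prod v (wedge y y) us" by (simp add: Cons int_prod_def)
  also have "int_prod v (wedge y y) = fadd (fscale (y [v]) y) (fscale (- 1) (wedge y (int_prod v y)))"
    by (rule int_prod_wedge_one_form(1)) (rule assms)
  also have "fadd (fscale (y [v]) y) (fscale (- 1) (wedge y (int_prod v y))) us = 0"
    unfolding iv wedge_fscale_right by (simp add: fadd_def fscale_def)
  finally show ?thesis .
qed

context sasaki
begin

abbreviation "anti \<equiv> antihol_forms D"

lemma anti_fone: "fone \<in> anti" and anti_fadd: "\<alpha> \<in> anti \<Longrightarrow> \<beta> \<in> anti \<Longrightarrow> fadd \<alpha> \<beta> \<in> anti"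
  and anti_fscale: "\<alpha> \<in> anti \<Longrightarrow> fscale z \<alpha> \<in> anti"
  and anti_flat: "y \<in> eigen1 D (- \<i>) \<Longrightarrow> \<alpha> \<in> anti \<Longrightarrow> wedge (flat D y) \<alpha> \<in> anti"
  unfolding antihol_forms_def
  by (auto intro: wedge_generated.intros)

lemma anti_zero: "(\<lambda>vs. 0) \<in> anti"
  unfolding antihol_forms_def by (rule wedge_generated_fzero)

lemma flat_length: "length us \<noteq> 1 \<Longrightarrow> flat D y us = 0"
  by (auto simp: flat_def split: list.splits)

lemma anti_int_prod: assumes v: "v \<in> T" shows "\<alpha> \<in> anti \<Longrightarrow> int_prod v \<alpha> \<in> anti"
  unfolding antihol_forms_def
proof (induction rule: wedge_generated_left_induct)
  case one
  have "int_prod v fone = (\<lambda>vs. 0)" by (simp add: int_prod_def fone_def)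
  then show ?case using wedge_generated_fzero by simp
next
  case (wedge y \<alpha>)
  then obtain z where y: "y = flat D z" by blast
  have e: "int_prod v (wedge y \<alpha>) = fadd (fscale (y [v]) \<alpha>) (fscale (- 1) (wedge y (int_prod v \<alpha>)))"
    by (rule int_prod_wedge_one_form(1)) (simp add: y flat_length)
  show ?case
    unfolding e
    by (intro wedge_generated.add wedge_generated.scale wedge(2)
        wedge_generated.wedge[OF wedge_generated.gen[OF wedge(1)] wedge(3)])
qed (auto intro: wedge_generated.intros)

lemma anti_parity: "\<alpha> \<in> anti \<Longrightarrow> parity \<alpha> \<in> anti"
  unfolding antihol_forms_def
proof (induction rule: wedge_generated_left_induct)
  case one
  have "parity fone = fone" by (rule ext) (simp add: parity_def fone_def)
  then show ?case using wedge_generated.one by metis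
next
  case (wedge y \<alpha>)
  then obtain z where y: "y = flat D z" by blast
  have e: "parity y = fscale (- 1) y" by (rule int_prod_wedge_one_form(2)) (simp add: y flat_length)
  show ?case
    unfolding parity_wedge e wedge_fscale_left
    by (intro wedge_generated.scale wedge_generated.wedge[OF wedge_generated.gen[OF wedge(1)] wedge(3)])
qed (auto intro: wedge_generated.intros)

section \<open>Clifford multiplication\<close>

text \<open>
  The \<open>L'\<close>-component of a vector orthogonal to \<open>\<xi>\<^sub>1\<close>.
\<close>
definition antihol_vec :: "real^'k^'k \<Rightarrow> (real^'k^'k) \<times> (real^'k^'k)" where
  "antihol_vec u = ((1/2) *\<^sub>R u, (1/2) *\<^sub>R phi D 1 u)"

definition wedge_vec :: "real^'k^'k \<Rightarrow> (real^'k^'k) form \<Rightarrow> (real^'k^'k) form" where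
  "wedge_vec u = wedge (flat D (antihol_vec u))"

lemma perp1_T: "u \<in> perp1 D \<Longrightarrow> u \<in> T" by (simp add: perp1_def)

lemma phi_perp1:
  assumes u: "u \<in> perp1 D" shows "phi D 1 u \<in> perp1 D" "phi D 1 (phi D 1 u) = - u"
proof -
  have uT: "u \<in> T" using u by (rule perp1_T)
  have "met (xi 1) (phi D 1 u) = 0"
    using phi_skew[OF xi_T'(1) uT, of 1] rlin_0[OF subspaces(6) met_lin[OF uT]] by (simp add: phi_xi)
  then show "phi D 1 u \<in> perp1 D" using phi1_T[OF uT] by (simp add: perp1_def)
  let ?v = "ver D u" and ?h = "hor D u"
  have v: "?v \<in> Ve" "?h \<in> P" "?v + ?h = u" using ver_hor[OF uT] by auto
  have "met (xi 1) ?v = 0"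
  proof -
    have "met (xi 1) u = met (xi 1) (?v + ?h)" using v by simp
    also have "\<dots> = met (xi 1) ?v + met (xi 1) ?h"
      using rlin_add[OF subspaces(6) met_lin2[OF xi_T'(1)]] v Ve_T P_T by blast
    finally show ?thesis using u met_Ve_P(1)[OF xi_T'(5) v(2)] by (simp add: perp1_def)
  qed
  then have ve: "?v = met (xi 2) ?v *\<^sub>R xi 2 + met (xi 3) ?v *\<^sub>R xi 3" using Ve_expand[OF v(1)] by simp
  note l = rlin_add[OF subspaces(6) phi_lin] rlin_diff[OF subspaces(6) phi_lin] rlin_scale[OF subspaces(6) phi_lin] rlin_minus[OF subspaces(6) phi_lin]
  have "phi D 1 (phi D 1 (a *\<^sub>R xi 2 + b *\<^sub>R xi 3)) = - (a *\<^sub>R xi 2 + b *\<^sub>R xi 3)" for a b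
    using subspaces(6) by (simp add: l phi_xi subspace_scale subspace_add subspace_neg subspace_diff algebra_simps)
  then have "phi D 1 (phi D 1 ?v) = - ?v" using ve by metis
  moreover have "phi D 1 (phi D 1 ?h) = - ?h" using v(2) by (rule Q.II)
  moreover have "phi D 1 (phi D 1 (?v + ?h)) = phi D 1 (phi D 1 ?v) + phi D 1 (phi D 1 ?h)"
    using Ve_T[OF v(1)] P_T[OF v(2)] by (simp add: l phi1_T)
  ultimately show "phi D 1 (phi D 1 u) = - u" using v(3) by (metis minus_add_distrib)
qed

lemma yv_eigen: assumes u: "u \<in> perp1 D" shows "antihol_vec u \<in> eigen1 D (- \<i>)"
proof -
  have sc: "s *\<^sub>R x \<in> perp1 D" if "x \<in> perp1 D" for s x
    using that subspaces(6) rlin_scale[OF subspaces(6) met_lin2[OF xi_T'(1)]] by (simp add: perp1_def subspace_scale)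
  have "phi D 1 ((1/2) *\<^sub>R x) = (1/2) *\<^sub>R phi D 1 x" if "x \<in> perp1 D" for x
    using rlin_scale[OF subspaces(6) phi_lin perp1_T[OF that]] .
  then show ?thesis
    using sc phi_perp1[OF u] u by (simp add: eigen1_def antihol_vec_def cscale_def)
qed

lemma flat_yv: "u \<in> T \<Longrightarrow> x \<in> T \<Longrightarrow> flat D (antihol_vec u) [x] = (1/2) * (of_real (met u x) + \<i> * of_real (met (phi D 1 u) x))"
  using rlin_scale[OF subspaces(6) met_lin[of x]] phi1_T[of u]
  by (simp add: flat_def antihol_vec_def algebra_simps)

text \<open>
  On antiholomorphic forms the contraction with the \<open>L\<close>-component of \<open>u\<close> is the interior product with the real vector
  \<open>u\<close>, because the \<open>L'\<close>-component contributes nothing.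
\<close>
lemma cliff_eq:
  assumes a: "antihol_form \<psi>" and X: "X \<in> T" and u: "u = X - eta D 1 X *\<^sub>R xi 1"
  shows "cliff D X \<psi> = fadd (fscale (\<i> * of_real (eta D 1 X)) (parity \<psi>))
     (fscale (\<i> * of_real (sqrt 2)) (fadd (int_prod u \<psi>) (wedge_vec u \<psi>)))"
proof -
  have uT: "u \<in> T" unfolding u using X subspaces(6) by (simp add: subspace_diff subspace_scale)
  have "contract ((1/2) *\<^sub>R u, - (1/2) *\<^sub>R phi D 1 u) \<psi> vs = int_prod u \<psi> vs" for vs
  proof (cases "set vs \<subseteq> T")
    case True
    note l = antihol_form_lin[OF a True]
    have "\<psi> (phi D 1 u # vs) = \<i> * \<psi> (u # vs)" by (rule antihol_on_type[OF antihol_form_on[OF a] uT True])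
    then have 2: "\<psi> (- (1/2) *\<^sub>R phi D 1 u # vs) = - (1/2) * (\<i> * \<psi> (u # vs))"
      using rlin_scale[OF subspaces(6) l phi1_T[OF uT], of "- (1/2)"]
      by (simp only: scaleR_conv_of_real[where 'a=complex]) simp
    have 1: "\<psi> ((1/2) *\<^sub>R u # vs) = (1/2) * \<psi> (u # vs)"
      using rlin_scale[OF subspaces(6) l uT, of "1/2"]
      by (simp only: scaleR_conv_of_real[where 'a=complex]) simp
    show ?thesis by (simp only: contract_def int_prod_def fst_conv snd_conv 1 2) (simp add: field_simps)
  next
    case False
    then show ?thesis using antihol_form_off[OF a] by (simp add: contract_def int_prod_def)
  qed
  then have c: "contract ((1/2) *\<^sub>R u, - (1/2) *\<^sub>R phi D 1 u) \<psi> = int_prod u \<psi>" by blast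
  show ?thesis
    unfolding cliff_def Let_def u[symmetric] c wedge_vec_def antihol_vec_def
    by (rule ext) (simp add: fadd_def fscale_def parity_def algebra_simps)
qed

lemma perp1_proj: assumes "X \<in> T" shows "X - eta D 1 X *\<^sub>R xi 1 \<in> perp1 D"
  using assms subspaces(6) rlin_diff[OF subspaces(6) met_lin2[OF xi_T'(1)]] rlin_scale[OF subspaces(6) met_lin2[OF xi_T'(1)]]
  by (simp add: perp1_def eta_def subspace_diff subspace_scale xi_met)

lemma anti_wedge_vec: "u \<in> perp1 D \<Longrightarrow> \<psi> \<in> anti \<Longrightarrow> wedge_vec u \<psi> \<in> anti"
  unfolding wedge_vec_def by (intro anti_flat yv_eigen)

lemma anti_cliff:
  assumes "X \<in> T" "\<psi> \<in> anti"
  shows "cliff D X \<psi> \<in> anti"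
  unfolding cliff_eq[OF antihol_form_antihol[OF assms(2)] assms(1) refl]
  using perp1_proj[OF assms(1)] assms(2)
  by (intro anti_fadd anti_fscale anti_parity anti_int_prod anti_wedge_vec perp1_T)

lemma cliff_fadd:
  assumes "X \<in> T" "\<psi> \<in> anti" "\<theta> \<in> anti"
  shows "cliff D X (fadd \<psi> \<theta>) = fadd (cliff D X \<psi>) (cliff D X \<theta>)"
  unfolding cliff_eq[OF antihol_form_antihol[OF assms(2)] assms(1) refl] cliff_eq[OF antihol_form_antihol[OF assms(3)] assms(1) refl]
    cliff_eq[OF antihol_form_antihol[OF anti_fadd[OF assms(2,3)]] assms(1) refl] wedge_vec_def
  by (simp add: wedge_fadd_right) (simp add: fadd_def fscale_def algebra_simps)

lemma cliff_fscale:
  assumes "X \<in> T" "\<psi> \<in> anti"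
  shows "cliff D X (fscale z \<psi>) = fscale z (cliff D X \<psi>)"
  unfolding cliff_eq[OF antihol_form_antihol[OF assms(2)] assms(1) refl]
    cliff_eq[OF antihol_form_antihol[OF anti_fscale[OF assms(2)]] assms(1) refl] wedge_vec_def
  by (simp add: wedge_fscale_right) (simp add: fadd_def fscale_def algebra_simps)

lemma cliff_square:
  assumes X: "X \<in> T" "met X X = 1" and p: "\<psi> \<in> anti"
  shows "cliff D X (cliff D X \<psi>) = fscale (- 1) \<psi>"
proof -
  define e where "e = eta D 1 X"
  define u where "u = X - e *\<^sub>R xi 1"
  define y where "y = flat D (antihol_vec u)"
  have u: "u \<in> perp1 D" using perp1_proj[OF X(1)] by (simp add: u_def e_def)
  have uT: "u \<in> T" using u by (rule perp1_T)
  have yl: "y us = 0" if "length us \<noteq> 1" for us using that by (simp add: y_def flat_length)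
  have yu: "y [u] = of_real (met u u) / 2"
  proof -
    have "met (phi D 1 u) u = 0"
      using phi_skew[OF uT uT, of 1] met_sym[OF uT phi1_T[OF uT]] by simp
    then show ?thesis using flat_yv[OF uT uT] by (simp add: y_def)
  qed
  have "met X X = met (u + e *\<^sub>R xi 1) (u + e *\<^sub>R xi 1)" by (simp add: u_def)
  also have "\<dots> = met u u + e * met u (xi 1) + (e * met (xi 1) u + e * (e * met (xi 1) (xi 1)))"
    using uT subspaces(6)
      rlin_add[OF subspaces(6) met_lin, of "u + e *\<^sub>R xi 1" u "e *\<^sub>R xi 1"]
      rlin_scale[OF subspaces(6) met_lin, of "u + e *\<^sub>R xi 1" "xi 1" e]
      rlin_add[OF subspaces(6) met_lin2, of u u "e *\<^sub>R xi 1"] rlin_scale[OF subspaces(6) met_lin2, of u "xi 1" e]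
      rlin_add[OF subspaces(6) met_lin2, of "xi 1" u "e *\<^sub>R xi 1"] rlin_scale[OF subspaces(6) met_lin2, of "xi 1" "xi 1" e]
    by (simp add: subspace_add subspace_scale algebra_simps)
  finally have n: "met u u + e * e = 1"
    using X(2) u met_sym[OF uT xi_T'(1)] by (simp add: perp1_def xi_met)
  have C: "cliff D X \<phi> = fadd (fscale (\<i> * of_real e) (parity \<phi>))
     (fscale (\<i> * of_real (sqrt 2)) (fadd (int_prod u \<phi>) (wedge y \<phi>)))" if "\<phi> \<in> anti" for \<phi>
    using cliff_eq[OF antihol_form_antihol[OF that] X(1), of u] by (simp add: u_def e_def y_def wedge_vec_def)
  have ii: "int_prod u (int_prod u \<psi>) = (\<lambda>vs. 0)"
  proof
    fix vs show "int_prod u (int_prod u \<psi>) vs = 0"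
      using antihol_form_swap[OF antihol_form_antihol[OF p] uT uT, of vs] antihol_form_off[OF antihol_form_antihol[OF p], of "u # u # vs"]
      by (cases "set vs \<subseteq> T") (simp_all add: int_prod_def)
  qed
  have ww: "wedge y (wedge y \<psi>) = (\<lambda>vs. 0)"
  proof -
    have "wedge y y = (\<lambda>vs. 0)" using wedge_one_form_self[of y, OF yl] by blast
    then show ?thesis unfolding wedge_assoc[symmetric] by (simp add: wedge_def)
  qed
  have py: "parity y = fscale (- 1) y" by (rule int_prod_wedge_one_form(2)) (rule yl)
  have iw: "int_prod u (wedge y \<psi>) = fadd (fscale (y [u]) \<psi>) (fscale (- 1) (wedge y (int_prod u \<psi>)))"
    by (rule int_prod_wedge_one_form(1)) (rule yl)
  have s2: "complex_of_real (sqrt 2) * of_real (sqrt 2) = 2" by (simp flip: of_real_mult)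
  have e2: "of_real (met u u) + of_real e * of_real e = (1::complex)" using n by (metis of_real_1 of_real_add of_real_mult)
  show ?thesis
  proof
    fix vs
    have "cliff D X (cliff D X \<psi>) vs = - (of_real e * of_real e * \<psi> vs)
      - (of_real (sqrt 2) * of_real (sqrt 2)) * (y [u] * \<psi> vs)"
      unfolding C[OF anti_cliff[OF X(1) p]] unfolding C[OF p]
      by (simp add: wedge_fadd_right wedge_fscale_right ii ww iw int_prod_par parity_wedge py wedge_fscale_left)
         (simp add: fadd_def fscale_def algebra_simps)
    also have "\<dots> = - (of_real (met u u) + of_real e * of_real e) * \<psi> vs"
      unfolding s2 yu by (simp add: algebra_simps)
    finally show "cliff D X (cliff D X \<psi>) vs = fscale (- 1) \<psi> vs" unfolding e2 by (simp add: fscale_def)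
  qed
qed

text \<open>
  Replacing \<open>u\<close> by \<open>\<phi>\<^sub>1 u\<close> multiplies the two summands of Clifford multiplication by \<open>i\<close> and \<open>-i\<close>, which separates them.
\<close>
lemma cliff_perp1:
  assumes u: "u \<in> perp1 D" and p: "\<psi> \<in> anti"
  shows "int_prod u \<psi> = fscale (1 / (2 * \<i> * of_real (sqrt 2))) (fadd (cliff D u \<psi>) (fscale (- \<i>) (cliff D (phi D 1 u) \<psi>)))"
    and "wedge_vec u \<psi> = fscale (1 / (2 * \<i> * of_real (sqrt 2))) (fadd (cliff D u \<psi>) (fscale \<i> (cliff D (phi D 1 u) \<psi>)))"
proof -
  note f = phi_perp1[OF u]
  have uT: "u \<in> T" and fT: "phi D 1 u \<in> T" using u f perp1_T by auto
  have 0: "eta D 1 u = 0" "eta D 1 (phi D 1 u) = 0" using u f by (simp_all add: perp1_def eta_def)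
  have a: "antihol_form \<psi>" by (rule antihol_form_antihol[OF p])
  have 1: "cliff D u \<psi> = fscale (\<i> * of_real (sqrt 2)) (fadd (int_prod u \<psi>) (wedge_vec u \<psi>))"
    using cliff_eq[OF a uT refl] unfolding 0 by (simp add: fadd_def fscale_def)
  have 2: "cliff D (phi D 1 u) \<psi> = fscale (\<i> * of_real (sqrt 2)) (fadd (int_prod (phi D 1 u) \<psi>) (wedge_vec (phi D 1 u) \<psi>))"
    using cliff_eq[OF a fT refl] unfolding 0 by (simp add: fadd_def fscale_def)
  have 3: "int_prod (phi D 1 u) \<psi> = fscale \<i> (int_prod u \<psi>)"
  proof
    fix vs show "int_prod (phi D 1 u) \<psi> vs = fscale \<i> (int_prod u \<psi>) vs"
      using antihol_on_type[OF antihol_form_on[OF a] uT, of vs] antihol_form_off[OF a, of "phi D 1 u # vs"] antihol_form_off[OF a, of "u # vs"]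
      by (cases "set vs \<subseteq> T") (simp_all add: int_prod_def fscale_def)
  qed
  have "flat D (antihol_vec (phi D 1 u)) = fscale (- \<i>) (flat D (antihol_vec u))"
  proof
    fix vs
    show "flat D (antihol_vec (phi D 1 u)) vs = fscale (- \<i>) (flat D (antihol_vec u)) vs"
    proof (cases "\<exists>x. vs = [x] \<and> x \<in> T")
      case True
      then obtain x where x: "vs = [x]" "x \<in> T" by blast
      have "met (- u) x = - met u x" using rlin_minus[OF subspaces(6) met_lin[OF x(2)] uT] .
      then show ?thesis using flat_yv[OF uT x(2)] flat_yv[OF fT x(2)] x f(2)
        by (simp add: fscale_def algebra_simps)
    next
      case False
      then have "flat D z vs = 0" for z by (auto simp: flat_def split: list.splits)
      then show ?thesis by (simp add: fscale_def)
    qed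
  qed
  then have 4: "wedge_vec (phi D 1 u) \<psi> = fscale (- \<i>) (wedge_vec u \<psi>)" unfolding wedge_vec_def by (simp add: wedge_fscale_left)
  have s: "complex_of_real (sqrt 2) \<noteq> 0" by simp
  show "int_prod u \<psi> = fscale (1 / (2 * \<i> * of_real (sqrt 2))) (fadd (cliff D u \<psi>) (fscale (- \<i>) (cliff D (phi D 1 u) \<psi>)))"
    "wedge_vec u \<psi> = fscale (1 / (2 * \<i> * of_real (sqrt 2))) (fadd (cliff D u \<psi>) (fscale \<i> (cliff D (phi D 1 u) \<psi>)))"
    unfolding 1 2 3 4 by (rule ext, simp add: fadd_def fscale_def field_simps s)+
qed

lemma foldr_cliff:
  assumes "\<forall>u\<in>set us. u \<in> T \<and> met u u = 1"
  shows "\<psi> \<in> anti \<Longrightarrow> foldr (cliff D) us \<psi> \<in> anti"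
    and "\<psi> \<in> anti \<Longrightarrow> \<theta> \<in> anti \<Longrightarrow> foldr (cliff D) us (fadd \<psi> \<theta>) = fadd (foldr (cliff D) us \<psi>) (foldr (cliff D) us \<theta>)"
    and "\<psi> \<in> anti \<Longrightarrow> foldr (cliff D) us (fscale z \<psi>) = fscale z (foldr (cliff D) us \<psi>)"
    and "\<psi> \<in> anti \<Longrightarrow> foldr (cliff D) us \<psi> = (\<lambda>vs. 0) \<Longrightarrow> \<psi> = (\<lambda>vs. 0)"
proof -
  have cl: "foldr (cliff D) us \<psi> \<in> anti" if "\<psi> \<in> anti" "\<forall>u\<in>set us. u \<in> T \<and> met u u = 1" for us \<psi>
    using that by (induction us) (auto intro: anti_cliff)
  show "\<psi> \<in> anti \<Longrightarrow> foldr (cliff D) us \<psi> \<in> anti" using cl assms by blast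
  show "\<psi> \<in> anti \<Longrightarrow> \<theta> \<in> anti \<Longrightarrow> foldr (cliff D) us (fadd \<psi> \<theta>) = fadd (foldr (cliff D) us \<psi>) (foldr (cliff D) us \<theta>)"
    using assms by (induction us) (auto simp: cliff_fadd cl)
  show "\<psi> \<in> anti \<Longrightarrow> foldr (cliff D) us (fscale z \<psi>) = fscale z (foldr (cliff D) us \<psi>)"
    using assms by (induction us) (auto simp: cliff_fscale cl)
  show "\<psi> \<in> anti \<Longrightarrow> foldr (cliff D) us \<psi> = (\<lambda>vs. 0) \<Longrightarrow> \<psi> = (\<lambda>vs. 0)"
    using assms
  proof (induction us)
    case (Cons u us)
    let ?r = "foldr (cliff D) us \<psi>"
    have u: "u \<in> T" "met u u = 1" and r: "?r \<in> anti" using Cons.prems cl by auto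
    have z: "cliff D u (\<lambda>vs. 0) = (\<lambda>vs. 0)"
      using cliff_fscale[OF u(1) anti_zero, of 0] by (simp add: fscale_def)
    \<comment> \<open>Clifford multiplication by a unit vector is invertible, its square being \<open>-1\<close>.\<close>
    have "fscale (- 1) ?r = cliff D u (cliff D u ?r)" using cliff_square[OF u r] by simp
    also have "\<dots> = (\<lambda>vs. 0)" using Cons.prems z by simp
    finally have "?r = (\<lambda>vs. 0)" by (auto simp: fscale_def fun_eq_iff)
    then show ?case using Cons.IH Cons.prems by simp
  qed simp
qed

end

section \<open>The lifted action\<close>

locale sasaki_spin = sasaki D for D :: "(real^'k^'k) homog_data" +
  fixes \<tau> :: "(real^'k^'k \<Rightarrow> real^'k^'k) \<Rightarrow> (real^'k^'k) form \<Rightarrow> (real^'k^'k) form"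
  assumes lift: "spin_lift D \<tau>"
begin

lemma tau_operator:
  assumes A: "A \<in> Sp_hor D"
  shows "\<psi> \<in> anti \<Longrightarrow> \<tau> A \<psi> \<in> anti"
    and "\<psi> \<in> anti \<Longrightarrow> \<theta> \<in> anti \<Longrightarrow> \<tau> A (fadd \<psi> \<theta>) = fadd (\<tau> A \<psi>) (\<tau> A \<theta>)"
    and "\<psi> \<in> anti \<Longrightarrow> \<tau> A (fscale z \<psi>) = fscale z (\<tau> A \<psi>)"
    and "\<psi> \<in> anti \<Longrightarrow> \<tau> A \<psi> = (\<lambda>vs. 0) \<Longrightarrow> \<psi> = (\<lambda>vs. 0)"
proof -
  have "spin_operator D (\<tau> A)" using lift A by (simp add: spin_lift_def)
  then obtain us where us: "\<forall>u\<in>set us. u \<in> T \<and> met u u = 1"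
    and t: "\<And>\<psi>. \<psi> \<in> anti \<Longrightarrow> \<tau> A \<psi> = foldr (cliff D) us \<psi>"
    unfolding spin_operator_def by blast
  note f = foldr_cliff[OF us]
  show "\<psi> \<in> anti \<Longrightarrow> \<tau> A \<psi> \<in> anti" using f(1) t by simp
  show "\<psi> \<in> anti \<Longrightarrow> \<theta> \<in> anti \<Longrightarrow> \<tau> A (fadd \<psi> \<theta>) = fadd (\<tau> A \<psi>) (\<tau> A \<theta>)"
    using f(2) t anti_fadd by simp
  show "\<psi> \<in> anti \<Longrightarrow> \<tau> A (fscale z \<psi>) = fscale z (\<tau> A \<psi>)" using f(3) t anti_fscale by simp
  show "\<psi> \<in> anti \<Longrightarrow> \<tau> A \<psi> = (\<lambda>vs. 0) \<Longrightarrow> \<psi> = (\<lambda>vs. 0)" using f(4) t by simp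
qed

lemma tau_cliff: "A \<in> Sp_hor D \<Longrightarrow> X \<in> T \<Longrightarrow> \<psi> \<in> anti \<Longrightarrow> \<tau> A (cliff D X \<psi>) = cliff D (A X) (\<tau> A \<psi>)"
  using lift by (simp add: spin_lift_def)

lemma tau_compose: "A \<in> Sp_hor D \<Longrightarrow> B \<in> Sp_hor D \<Longrightarrow> \<psi> \<in> anti \<Longrightarrow> \<tau> (compose T A B) \<psi> = \<tau> A (\<tau> B \<psi>)"
  using lift by (simp add: spin_lift_def)

lemma Sp_perp1:
  assumes A: "A \<in> Sp_hor D" and u: "u \<in> perp1 D" shows "A u \<in> perp1 D"
  using u Sp_T[OF A perp1_T[OF u]] Sp_met[OF A xi_T'(1) perp1_T[OF u]] Sp_xi[OF A, of 1]
  by (simp add: perp1_def)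

text \<open>
  Contractions and left multiplications are complex combinations of Clifford multiplications, so the lift intertwines
  them as well.
\<close>
lemma tau_int_prod_wedge_vec:
  assumes A: "A \<in> Sp_hor D" and u: "u \<in> perp1 D" and p: "\<psi> \<in> anti"
  shows "\<tau> A (int_prod u \<psi>) = int_prod (A u) (\<tau> A \<psi>)" and "\<tau> A (wedge_vec u \<psi>) = wedge_vec (A u) (\<tau> A \<psi>)"
proof -
  note t = tau_operator[OF A]
  note f = phi_perp1(1)[OF u]
  have c: "cliff D u \<psi> \<in> anti" "cliff D (phi D 1 u) \<psi> \<in> anti" using anti_cliff perp1_T u f p by auto
  have e: "\<tau> A (cliff D u \<psi>) = cliff D (A u) (\<tau> A \<psi>)"
    "\<tau> A (cliff D (phi D 1 u) \<psi>) = cliff D (phi D 1 (A u)) (\<tau> A \<psi>)"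
    using tau_cliff[OF A perp1_T[OF u] p] tau_cliff[OF A perp1_T[OF f] p] Sp_phi[OF A perp1_T[OF u], of 1] by simp_all
  show "\<tau> A (int_prod u \<psi>) = int_prod (A u) (\<tau> A \<psi>)"
    unfolding cliff_perp1(1)[OF u p] cliff_perp1(1)[OF Sp_perp1[OF A u] t(1)[OF p]]
    using c by (simp add: t(2,3) anti_fadd anti_fscale e)
  show "\<tau> A (wedge_vec u \<psi>) = wedge_vec (A u) (\<tau> A \<psi>)"
    unfolding cliff_perp1(2)[OF u p] cliff_perp1(2)[OF Sp_perp1[OF A u] t(1)[OF p]]
    using c by (simp add: t(2,3) anti_fadd anti_fscale e)
qed

text \<open>
  The scalar by which the lift differs from the natural action, read off from the constant form \<open>1\<close>.
\<close>
definition lift_scalar :: "(real^'k^'k \<Rightarrow> real^'k^'k) \<Rightarrow> complex" where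
  "lift_scalar A = \<tau> A fone []"

text \<open>
  The lift of \<open>1\<close> is killed by the contractions with all vectors in the image of \<open>A\<close>, so it vanishes on
  nonempty lists of such vectors. The other forms are obtained from \<open>1\<close> by left multiplications, which the lift
  intertwines.
\<close>
lemma tau_pullback:
  assumes A: "A \<in> Sp_hor D"
  shows "\<psi> \<in> anti \<Longrightarrow> set vs \<subseteq> T \<Longrightarrow> \<tau> A \<psi> (map A vs) = lift_scalar A * \<psi> vs"
  unfolding antihol_forms_def
proof (induction arbitrary: vs rule: wedge_generated_left_induct)
  note t = tau_operator[OF A]
  case one
  show ?case
  proof (cases vs)
    case Nil then show ?thesis by (simp add: lift_scalar_def fone_def)
  next
    case (Cons v us)
    have v: "v \<in> T" and us: "set us \<subseteq> T" using one Cons by auto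
    define e where "e = eta D 1 v"
    define u where "u = v - e *\<^sub>R xi 1"
    have u: "u \<in> perp1 D" unfolding u_def e_def by (rule perp1_proj[OF v])
    note uT = perp1_T[OF u]
    let ?us = "map A us"
    have us': "set ?us \<subseteq> T" using us Sp_T[OF A] by auto
    have a: "antihol_form (\<tau> A fone)" using t(1)[OF anti_fone] by (rule antihol_form_antihol)
    have i0: "int_prod u fone = (\<lambda>vs. 0)" by (simp add: int_prod_def fone_def)
    have "\<tau> A (\<lambda>vs. 0) = (\<lambda>vs. 0)" using t(3)[OF anti_fone, of 0] by (simp add: fscale_def)
    then have "int_prod (A u) (\<tau> A fone) = (\<lambda>vs. 0)" using tau_int_prod_wedge_vec(1)[OF A u anti_fone] unfolding i0 by simp
    then have z: "\<tau> A fone (A u # ?us) = 0" by (metis int_prod_def)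
    have "A v = A (u + e *\<^sub>R xi 1)" by (simp add: u_def)
    also have "\<dots> = A u + e *\<^sub>R xi 1"
      using uT subspaces(6) Sp_xi[OF A, of 1]
      by (simp add: rlin_add[OF subspaces(6) Sp_lin[OF A]] rlin_scale[OF subspaces(6) Sp_lin[OF A]] subspace_scale)
    finally have "\<tau> A fone (A v # ?us) = \<tau> A fone ((A u + e *\<^sub>R xi 1) # ?us)" by simp
    also have "\<dots> = 0"
      using rlin_add[OF subspaces(6) antihol_form_lin[OF a us'] Sp_T[OF A uT], of "e *\<^sub>R xi 1"]
        rlin_scale[OF subspaces(6) antihol_form_lin[OF a us'], of "xi 1" e] antihol_form_xi(1)[OF a us'] z subspaces(6)
      by (simp add: subspace_scale)
    finally show ?thesis by (simp add: Cons fone_def)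
  qed
next
  note t = tau_operator[OF A]
  case (add \<alpha> \<beta>)
  then show ?case using t(2)[of \<alpha> \<beta>] unfolding antihol_forms_def by (simp add: fadd_def algebra_simps)
next
  note t = tau_operator[OF A]
  case (scale \<alpha> z)
  then show ?case using t(3)[of \<alpha> z] unfolding antihol_forms_def by (simp add: fscale_def)
next
  case (wedge y \<alpha>)
  have p: "\<alpha> \<in> anti" using wedge by (simp add: antihol_forms_def)
  obtain z where z: "z \<in> eigen1 D (- \<i>)" "y = flat D z" using wedge by blast
  define u where "u = 2 *\<^sub>R fst z"
  have zz: "fst z \<in> T" "phi D 1 (fst z) = snd z" "met (xi 1) (fst z) = 0" using eigen1D[OF z(1)] by auto
  have u: "u \<in> perp1 D"
    using zz subspaces(6) rlin_scale[OF subspaces(6) met_lin2[OF xi_T'(1)] zz(1)]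
    by (simp add: u_def perp1_def subspace_scale)
  have "antihol_vec u = z"
    using rlin_scale[OF subspaces(6) phi_lin zz(1)] zz(2) by (simp add: antihol_vec_def u_def prod_eq_iff)
  then have y: "y = flat D (antihol_vec u)" by (simp add: z)
  note uT = perp1_T[OF u]
  have "\<tau> A (wedge y \<alpha>) = wedge (flat D (antihol_vec (A u))) (\<tau> A \<alpha>)"
    using tau_int_prod_wedge_vec(2)[OF A u p] by (simp add: wedge_vec_def y)
  then have "\<tau> A (wedge y \<alpha>) (map A vs)
      = wedge (\<lambda>us. flat D (antihol_vec (A u)) (map A us)) (\<lambda>us. \<tau> A \<alpha> (map A us)) vs"
    by (simp add: wedge_map)
  also have "\<dots> = wedge y (fscale (lift_scalar A) \<alpha>) vs"
  proof (rule wedge_cong)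
    fix us assume us: "set us \<subseteq> set vs"
    show "flat D (antihol_vec (A u)) (map A us) = y us"
    proof (cases "length us = 1")
      case True
      then obtain x where x: "us = [x]" by (metis One_nat_def length_0_conv length_Suc_conv)
      then have xT: "x \<in> T" using us wedge by auto
      have "flat D (antihol_vec (A u)) [A x] = flat D (antihol_vec u) [x]"
        unfolding flat_yv[OF uT xT] flat_yv[OF Sp_T[OF A uT] Sp_T[OF A xT]]
        using Sp_met[OF A uT xT] Sp_met[OF A phi1_T[OF uT] xT] Sp_phi[OF A uT, of 1] by simp
      then show ?thesis by (simp add: x y)
    next
      case False
      then show ?thesis by (simp add: y flat_length)
    qed
    show "\<tau> A \<alpha> (map A us) = fscale (lift_scalar A) \<alpha> us"
      using wedge us by (simp add: fscale_def)
  qed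
  finally show ?case by (simp add: wedge_fscale_right) (simp add: fscale_def)
qed

lemma lift_scalar_compose:
  assumes A: "A \<in> Sp_hor D" and B: "B \<in> Sp_hor D"
  shows "lift_scalar (compose T A B) = lift_scalar A * lift_scalar B"
  using tau_pullback[OF A tau_operator(1)[OF B anti_fone], of "[]"]
  by (simp add: lift_scalar_def tau_compose[OF A B anti_fone])

section \<open>Quaternionic isometries of the horizontal space\<close>

text \<open>
  A quaternionic isometry of the horizontal space acts on the tangent space with the Reeb vectors fixed.
\<close>
definition extend :: "(real^'k^'k \<Rightarrow> real^'k^'k) \<Rightarrow> real^'k^'k \<Rightarrow> real^'k^'k" where
  "extend S = restrict (\<lambda>X. ver D X + S (hor D X)) T"

lemma phi_ver_hor:
  assumes X: "X \<in> T" and i: "i \<in> {1,2,3}"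
  shows "ver D (phi D i X) = phi D i (ver D X)" "hor D (phi D i X) = phi D i (hor D X)"
proof -
  have v: "(1/2) *\<^sub>R lie_bracket (xi i) (ver D X) \<in> Ve"
    using Ve_bracket[OF ver_hor(1)[OF X] i] subspaces(2) by (simp add: subspace_scale)
  have h: "lie_bracket (xi i) (hor D X) \<in> P" using g0(3) Ve_g0 xi_Ve[OF i] ver_hor(2)[OF X] by simp
  show "ver D (phi D i X) = phi D i (ver D X)" "hor D (phi D i X) = phi D i (hor D X)"
    unfolding phi_def[of D i X] using ver_eq[OF v h] hor_eq[OF v h] ver_hor[OF X] by (simp_all add: phi_P phi_Ve)
qed

lemma extend_Sp:
  assumes S: "Q.qisom S" shows "extend S \<in> Sp_hor D"
proof -
  have q: "Q.qlin S" using S by (simp add: Q.qisom_def)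
  have SP: "S x \<in> P" and SI: "S (phi D 1 x) = phi D 1 (S x)" and SJ: "S (phi D 2 x) = phi D 2 (S x)"
    if "x \<in> P" for x using q that by (auto simp: Q.qlin_def)
  have Sg: "met (S x) (S y) = met x y" if "x \<in> P" "y \<in> P" for x y using S that by (simp add: Q.qisom_def)
  have Sl: "rlin P S" using q by (simp add: Q.qlin_def)
  have e: "extend S X = ver D X + S (hor D X)" if "X \<in> T" for X using that by (simp add: extend_def)
  have eT: "extend S X \<in> T" if "X \<in> T" for X
    unfolding e[OF that] using ver_hor[OF that] SP Ve_T P_T subspaces(6) by (simp add: subspace_add)
  have m: "met (v + p) (w + q) = met v w + met p q" if "v \<in> Ve" "w \<in> Ve" "p \<in> P" "q \<in> P" for v w p q
  proof -
    have T: "v \<in> T" "w \<in> T" "p \<in> T" "q \<in> T" "w + q \<in> T" using that Ve_T P_T subspaces(6) by (auto simp: subspace_add)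
    show ?thesis
      using rlin_add[OF subspaces(6) met_lin[OF T(5)] T(1,3)] rlin_add[OF subspaces(6) met_lin2[OF T(1)] T(2,4)]
        rlin_add[OF subspaces(6) met_lin2[OF T(3)] T(2,4)] met_Ve_P that by simp
  qed
  show ?thesis
    unfolding Sp_hor_def mem_Collect_eq
  proof (intro conjI ballI allI)
    show "extend S \<in> T \<rightarrow>\<^sub>E T" using eT by (auto simp: extend_def)
  next
    fix X Y and a b :: real assume X: "X \<in> T" and Y: "Y \<in> T"
    have "a *\<^sub>R X + b *\<^sub>R Y \<in> T" using X Y subspaces(6) by (simp add: subspace_add subspace_scale)
    then show "extend S (a *\<^sub>R X + b *\<^sub>R Y) = a *\<^sub>R extend S X + b *\<^sub>R extend S Y"
      using X Y ver_hor(2) by (simp add: e rlinD[OF rlin_ver] rlinD[OF rlin_hor] rlinD[OF Sl] algebra_simps)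
  next
    fix X Y assume X: "X \<in> T" and Y: "Y \<in> T"
    have "met (extend S X) (extend S Y) = met (ver D X) (ver D Y) + met (hor D X) (hor D Y)"
      using ver_hor[OF X] ver_hor[OF Y] by (simp add: e X Y m SP Sg)
    also have "\<dots> = met (ver D X + hor D X) (ver D Y + hor D Y)" using ver_hor[OF X] ver_hor[OF Y] by (intro m[symmetric])
    finally show "met (extend S X) (extend S Y) = met X Y" using ver_hor(3)[OF X] ver_hor(3)[OF Y] by simp
  next
    fix i :: nat assume i: "i \<in> {1,2,3}"
    have S0: "S 0 = 0" by (rule rlin_0[OF subspaces(1) Sl])
    show "extend S (xi i) = xi i" using xi_T[OF i] xi_Ve[OF i] by (simp add: e S0)
    fix X assume X: "X \<in> T"
    have h: "hor D X \<in> P" by (rule ver_hor(2)[OF X])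
    have "S (phi D i (hor D X)) = phi D i (S (hor D X))" using i h SI SJ Q.qlin_K[OF q h] by auto
    then have "extend S (phi D i X) = phi D i (ver D X) + phi D i (S (hor D X))"
      using phi_in_T[OF X i] phi_ver_hor[OF X i] by (simp add: e)
    also have "\<dots> = phi D i (ver D X + S (hor D X))"
      using rlin_add[OF subspaces(6) phi_lin Ve_T[OF ver_hor(1)[OF X]] P_T[OF SP[OF h]]] by simp
    finally show "extend S (phi D i X) = phi D i (extend S X)" by (simp add: e X)
  qed
qed

lemma extend_compose:
  assumes S: "Q.qisom S" and R: "Q.qisom R"
  shows "compose T (extend S) (extend R) = extend (\<lambda>x. S (R x))"
proof
  fix X show "compose T (extend S) (extend R) X = extend (\<lambda>x. S (R x)) X"
  proof (cases "X \<in> T")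
    case True
    have R: "R (hor D X) \<in> P" using R ver_hor(2)[OF True] by (simp add: Q.qisom_def Q.qlin_def)
    have v: "ver D X \<in> Ve" using ver_hor(1)[OF True] .
    have "ver D X + R (hor D X) \<in> T" using v R Ve_T P_T subspaces(6) by (simp add: subspace_add)
    then show ?thesis using True ver_eq[OF v R] hor_eq[OF v R] by (simp add: compose_def extend_def)
  qed (simp add: compose_def extend_def)
qed

lemma extend_self:
  assumes A: "A \<in> Sp_hor D" shows "extend A = A"
proof
  fix X show "extend A X = A X"
  proof (cases "X \<in> T")
    case True
    have "A X = A (ver D X + hor D X)" using ver_hor(3)[OF True] by simp
    also have "\<dots> = ver D X + A (hor D X)"
      using rlin_add[OF subspaces(6) Sp_lin[OF A] Ve_T[OF ver_hor(1)[OF True]] P_T[OF ver_hor(2)[OF True]]]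
        Sp_Ve[OF A ver_hor(1)[OF True]] by simp
    finally show ?thesis using True by (simp add: extend_def)
  next
    case False
    then have "A X = undefined" using A by (auto simp: Sp_hor_def PiE_def extensional_def)
    then show ?thesis using False by (simp add: extend_def)
  qed
qed

lemma extend_cong: "(\<And>x. x \<in> P \<Longrightarrow> S x = R x) \<Longrightarrow> extend S = extend R"
  using ver_hor(2) by (auto simp: extend_def fun_eq_iff)

lemma qisom_comp: "Q.qisom S \<Longrightarrow> Q.qisom R \<Longrightarrow> Q.qisom (\<lambda>x. S (R x))"
  using Q.qlin_comp[of S R] by (auto simp: Q.qisom_def Q.qlin_def)

lemma lift_scalar_extend: "Q.qisom S \<Longrightarrow> Q.qisom R \<Longrightarrow> lift_scalar (extend (\<lambda>x. S (R x))) = lift_scalar (extend S) * lift_scalar (extend R)"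
  using lift_scalar_compose[OF extend_Sp extend_Sp, of S R] by (simp add: extend_compose)

text \<open>
  By multiplicativity a zero of the scalar would force its vanishing at the identity, where the lift would then kill the
  form \<open>1\<close>; but products of Clifford multiplications by unit vectors are injective.
\<close>
lemma lift_scalar_nonzero: assumes S: "Q.qisom S" shows "lift_scalar (extend S) \<noteq> 0"
proof
  assume 0: "lift_scalar (extend S) = 0"
  obtain S' where S': "Q.qisom S'" "\<And>x. x \<in> P \<Longrightarrow> S (S' x) = x" using Q.qisom_inverse[OF S] by blast
  have id: "Q.qisom (\<lambda>x. x)" by (simp add: Q.qisom_def Q.qlin_def rlin_def)
  let ?e = "extend (\<lambda>x. x)"
  have "extend (\<lambda>x. S (S' x)) = ?e" using S'(2) by (rule extend_cong)
  then have c: "lift_scalar ?e = 0" using lift_scalar_extend[OF S S'(1)] 0 by simp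
  note e = extend_Sp[OF id]
  have eX: "?e X = X" if "X \<in> T" for X using that ver_hor(3)[OF that] by (simp add: extend_def)
  have "\<tau> ?e fone vs = 0" for vs
  proof (cases "set vs \<subseteq> T")
    case True
    then have "map ?e vs = vs" using eX by (auto intro!: map_idI)
    then show ?thesis using tau_pullback[OF e anti_fone True] c by simp
  next
    case False
    then show ?thesis using antihol_form_off[OF antihol_form_antihol[OF tau_operator(1)[OF e anti_fone]]] by blast
  qed
  then have "fone = (\<lambda>vs :: (real^'k^'k) list. 0)" by (intro tau_operator(4)[OF e anti_fone]) blast
  then have "fone ([] :: (real^'k^'k) list) = 0" by metis
  then show False by (simp add: fone_def)
qed

text \<open>
  A multiplicative function with nonzero values in a commutative field is \<open>1\<close> on commutators.
\<close>
lemma lift_scalar_trivial: assumes A: "A \<in> Sp_hor D" shows "lift_scalar A = 1"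
proof -
  have qA: "Q.qisom A" using A by (rule Sp_qisom)
  obtain S R where S: "Q.qisom S" and R: "Q.qisom R" and e: "\<And>x. x \<in> P \<Longrightarrow> A (S (R x)) = R (S x)"
    using Q.qisom_commutator[OF qA] by blast
  have "extend (\<lambda>x. A (S (R x))) = extend (\<lambda>x. R (S x))" using e by (rule extend_cong)
  then have "lift_scalar (extend A) * (lift_scalar (extend S) * lift_scalar (extend R)) = lift_scalar (extend R) * lift_scalar (extend S)"
    using lift_scalar_extend[OF qA qisom_comp[OF S R]] lift_scalar_extend[OF S R] lift_scalar_extend[OF R S] by metis
  then show ?thesis using lift_scalar_nonzero[OF S] lift_scalar_nonzero[OF R] by (auto simp: extend_self[OF A])
qed

lemma inv_spinors_eq: "inv_spinors D \<tau> = inv_antihol_forms D"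
proof -
  have "(\<forall>h\<in>Iso D. \<tau> (isotropy D h) \<psi> = \<psi>) \<longleftrightarrow> iso_invariant \<psi>" if p: "\<psi> \<in> anti" for \<psi>
  proof
    assume inv: "\<forall>h\<in>Iso D. \<tau> (isotropy D h) \<psi> = \<psi>"
    show "iso_invariant \<psi>"
      unfolding iso_invariant_def
    proof (intro ballI allI impI)
      fix h vs assume h: "h \<in> Iso D" and vs: "set vs \<subseteq> T"
      note A = isotropy_Sp[OF h]
      show "\<psi> (map (isotropy D h) vs) = \<psi> vs"
        using tau_pullback[OF A p vs] lift_scalar_trivial[OF A] inv h by simp
    qed
  next
    assume inv: "iso_invariant \<psi>"
    show "\<forall>h\<in>Iso D. \<tau> (isotropy D h) \<psi> = \<psi>"
    proof (intro ballI ext)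
      fix h ws assume h: "h \<in> Iso D"
      note A = isotropy_Sp[OF h]
      have k: "matrix_inv h \<in> Iso D" using Iso_group[OF h] by blast
      note A' = isotropy_Sp[OF k]
      show "\<tau> (isotropy D h) \<psi> ws = \<psi> ws"
      proof (cases "set ws \<subseteq> T")
        case True
        define vs where "vs = map (isotropy D (matrix_inv h)) ws"
        have vs: "set vs \<subseteq> T" using True Sp_T[OF A'] by (auto simp: vs_def)
        have ws: "map (isotropy D h) vs = ws"
          unfolding vs_def map_map using True isotropy_inverse[OF h] by (intro map_idI) auto
        have "\<psi> (map (isotropy D h) vs) = \<psi> vs" using inv h vs unfolding iso_invariant_def by blast
        then show ?thesis using tau_pullback[OF A p vs] lift_scalar_trivial[OF A] by (simp add: ws)
      next
        case False
        then show ?thesis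
          using antihol_form_off[OF antihol_form_antihol[OF p]] antihol_form_off[OF antihol_form_antihol[OF tau_operator(1)[OF A p]]] by simp
      qed
    qed
  qed
  then show ?thesis by (auto simp: inv_spinors_def inv_antihol_forms_def iso_invariant_def)
qed

end

lemma wedge_algebra_generated: "wedge_algebra (wedge_generated S)"
  unfolding wedge_algebra_def fzero_def
  using wedge_generated_fzero by (blast intro: wedge_generated.intros)

theorem mainTheorem3:
  fixes D :: "(real^'k^'k) homog_data"
    and \<tau> :: "(real^'k^'k \<Rightarrow> real^'k^'k) \<Rightarrow> (real^'k^'k) form \<Rightarrow> (real^'k^'k) form"
  assumes "sc_homogeneous_3_sasakian D"
    and "spin_lift D \<tau>"
  shows "wedge_algebra (inv_spinors D \<tau>) \<and>
     wedge_algebra (inv_antihol_forms D) \<and>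
     (\<exists>F. wedge_iso F (inv_spinors D \<tau>) (inv_antihol_forms D)) \<and>
     inv_spinors D \<tau> = wedge_generated {y1_form D, omega_form D} \<and>
     inv_antihol_forms D = wedge_generated {y1_form D, omega_form D}"
proof -
  interpret sasaki_spin D \<tau>
    using assms by unfold_locales
  have "wedge_iso (\<lambda>\<alpha>. \<alpha>) W W" by (simp add: wedge_iso_def bij_betw_def)
  then show ?thesis
    unfolding inv_spinors_eq inv_antihol_eq using wedge_algebra_generated by blast
qed

end
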